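(* Let $n>1$. Fix values $T_1,\ldots,T_n\in(0,\infty)$ and $(0,T)=(0,T_1)\times\cdots\times(0,T_n)$. Let $J^\alpha$ be a family of operators on $\mathrm{L}^1(0,T)$ for $\alpha\in[0,\infty)^n$, such that $J^\alpha:\mathrm{L}^1(0,T)\rightarrow\mathrm{L}^1(0,T)$ is linear and continuous. Suppose: - Identity: for all $i\in\{1,\ldots,n\}$, $J^{e_i}=I^{e_i}$ on $\mathrm{L}^1(0,T)$, where $e_i$ is the $i$th canonical vector of $\mathbb{R}^n$; - Index law: $J^{\alpha+\beta}=J^\alpha\circ J^\beta$ on $\mathrm{L}^1(0,T)$ for all $\alpha,\beta\in[0,\infty)^n$; - Continuity: the map $\alpha\mapsto J^\alpha 1$ from $(0,\infty)^n$ to $\mathrm{L}^1(0,T)$ is continuous at one point. Then $J^\alpha=I^\alpha$ is the multidimensional Riemann-Liouville integral on $\mathrm{L}^1(0,T)$, for all $\alpha\in[0,\infty)^n$.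
   Context: $\mathrm{L}^1(0,T)$ consists of real-valued functions on the box $(0,T)$; $1$ is the constant function. For $\alpha\in[0,\infty)^n$, $I^\alpha$ is the Riemann-Liouville integral of multiorder $\alpha$ with left origin $(0,\ldots,0)$: the composition over $i$ of the one-dimensional operators $\frac{1}{\Gamma(\alpha_i)}\int_0^{t_i}(t_i-s_i)^{\alpha_i-1}f(\ldots,s_i,\ldots)\,\mathrm{d}s_i$ in the $i$th variable (the identity in that variable if $\alpha_i=0$). *)

theory Defs
  imports "HOL-Analysis.Analysis"
begin

text \<open>
  Elements of L1(0,T) are represented by Borel functions integrable on the open box (0,T);
  two representatives denote the same element iff they agree almost everywhere on the box.
  Values outside the box are irrelevant.
\<close>

abbreviation box_measure :: "real ^ 'n \<Rightarrow> (real ^ 'n) measure" where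
  "box_measure T \<equiv> restrict_space lborel (box 0 T)"

definition L1 :: "real ^ 'n \<Rightarrow> (real ^ 'n \<Rightarrow> real) set" where
  "L1 T = {f. integrable (box_measure T) f}"

definition L1_eq :: "real ^ 'n \<Rightarrow> (real ^ 'n \<Rightarrow> real) \<Rightarrow> (real ^ 'n \<Rightarrow> real) \<Rightarrow> bool" where
  "L1_eq T f g \<longleftrightarrow> (AE t in box_measure T. f t = g t)"

definition L1_dist :: "real ^ 'n \<Rightarrow> (real ^ 'n \<Rightarrow> real) \<Rightarrow> (real ^ 'n \<Rightarrow> real) \<Rightarrow> real" where
  "L1_dist T f g = (\<integral>t. \<bar>f t - g t\<bar> \<partial>(box_measure T))"

text \<open>The first two conjuncts say that \<open>A\<close> induces a map on the quotient space L1(0,T).\<close>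

definition L1_operator ::
    "real ^ 'n \<Rightarrow> ((real ^ 'n \<Rightarrow> real) \<Rightarrow> (real ^ 'n \<Rightarrow> real)) \<Rightarrow> bool" where
  "L1_operator T A \<longleftrightarrow>
     (\<forall>f\<in>L1 T. A f \<in> L1 T) \<and>
     (\<forall>f\<in>L1 T. \<forall>g\<in>L1 T. L1_eq T f g \<longrightarrow> L1_eq T (A f) (A g))"

definition L1_linear ::
    "real ^ 'n \<Rightarrow> ((real ^ 'n \<Rightarrow> real) \<Rightarrow> (real ^ 'n \<Rightarrow> real)) \<Rightarrow> bool" where
  "L1_linear T A \<longleftrightarrow>
     (\<forall>f\<in>L1 T. \<forall>g\<in>L1 T. \<forall>a b.
        L1_eq T (A (\<lambda>t. a * f t + b * g t)) (\<lambda>t. a * A f t + b * A g t))"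

definition L1_continuous ::
    "real ^ 'n \<Rightarrow> ((real ^ 'n \<Rightarrow> real) \<Rightarrow> (real ^ 'n \<Rightarrow> real)) \<Rightarrow> bool" where
  "L1_continuous T A \<longleftrightarrow>
     (\<forall>f\<in>L1 T. \<forall>\<epsilon>>0. \<exists>\<delta>>0. \<forall>g\<in>L1 T. L1_dist T g f < \<delta> \<longrightarrow> L1_dist T (A g) (A f) < \<epsilon>)"

definition RL_partial ::
    "'n::finite \<Rightarrow> real \<Rightarrow> (real ^ 'n \<Rightarrow> real) \<Rightarrow> (real ^ 'n \<Rightarrow> real)" where
  "RL_partial i a f =
     (if a = 0 then f
      else (\<lambda>t. 1 / Gamma a *
        (LBINT s:{0<..<t $ i}. (t $ i - s) powr (a - 1) * f (\<chi> j. if j = i then s else t $ j))))"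

text \<open>
  The linear order on the index type only fixes the order of composition
  (the partial operators commute almost everywhere, by Fubini).
\<close>

definition RL ::
    "real ^ 'n::{finite,linorder} \<Rightarrow> (real ^ 'n::_ \<Rightarrow> real) \<Rightarrow> (real ^ 'n::_ \<Rightarrow> real)" where
  "RL \<alpha> f = foldr (\<lambda>i. RL_partial i (\<alpha> $ i)) (sorted_list_of_set UNIV) f"

end

theory Submission
  imports Defs
begin

text \<open>
  Every \<open>J \<alpha>\<close> commutes with the integrations \<open>J e\<^sub>j\<close>, and the monomials are dense in L1, so \<open>J \<alpha>\<close> is
  determined by \<open>J \<alpha> 1\<close> and commutes with convolution on the box.  It then suffices to treat
  dyadic multiples of the axes, by repeated halving: if \<open>a\<close> and \<open>b\<close> are the values at \<open>1\<close> of \<open>J\<close> and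
  of the Riemann-Liouville integral of order \<open>c e\<^sub>i\<close>, then \<open>a * a = b * b\<close>, and \<open>a * 1 = g * g\<close> for the
  value \<open>g\<close> of order \<open>(c/2) e\<^sub>i\<close>.  Along the rays \<open>\<kappa> + \<sigma> (1/T\<^sub>1, \<dots>, 1/T\<^sub>n)\<close> the Laplace transform is
  multiplicative up to an error of order \<open>exp (- \<sigma>)\<close>; positivity of \<open>g * g\<close> and of \<open>b\<close> excludes
  \<open>a = - b\<close>, so the transform of \<open>u = a - b\<close> is of that order and \<open>u\<close> vanishes where
  \<open>\<Sum> t\<^sub>i / T\<^sub>i < 1\<close>.  Hence \<open>u\<close> is nilpotent for convolution, and \<open>u * u = - 2 b * u\<close> with \<open>b\<close>
  a non-zero-divisor gives \<open>u = 0\<close>.  Continuity at one point \<open>\<alpha>\<^sub>0\<close> extends the identity from dyadic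
  orders to all orders below \<open>\<alpha>\<^sub>0\<close>, and the index law to all orders.
\<close>

section \<open>Density of spans of multiplicative families in L1\<close>

text \<open>Convolution on the box has many nilpotents: a function supported near the far corner
  \<open>T\<close> squares to zero. From equal squares of a and b one therefore cannot read off that
  a is b or - b. Hence the comparison has an analytic half, which shows that the difference vanishes
  near the origin, and an algebraic half, which removes the nilpotent remainder. In the analytic
  half all transforms are real, and the sign is settled by a square of a real number, the transform
  of g; nothing is known about the signs of a and g themselves. Decay along a single ray only sees
  integrals of u over the slices on which the sum of the t_i / T_i is constant. This is why the base
  point \<kappa> stays free: u is recovered from all its integrals against exp (- \<kappa> \<bullet>
  t) at once. Halving proceeds one axis at a time because the orders e_i are the only ones at which
  the family is known from the start. Not even order 0 is known: it is reached only at the end, as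
  an order below that of the continuity point.\<close>

inductive lin_span :: "('a \<Rightarrow> real) set \<Rightarrow> ('a \<Rightarrow> real) \<Rightarrow> bool" for F where
  scale: "f \<in> F \<Longrightarrow> lin_span F (\<lambda>x. c * f x)"
| add: "lin_span F f \<Longrightarrow> lin_span F g \<Longrightarrow> lin_span F (\<lambda>x. f x + g x)"

lemma lin_span_mult:
  assumes "lin_span F f" "lin_span F g"
    and mult: "\<And>f g. f \<in> F \<Longrightarrow> g \<in> F \<Longrightarrow> (\<lambda>x. f x * g x) \<in> F"
  shows "lin_span F (\<lambda>x. f x * g x)"
  using assms(1)
proof induction
  case (scale f c)
  from assms(2) show ?case
  proof induction
    case (scale g d)
    have "lin_span F (\<lambda>x. (c * d) * (f x * g x))"
      using mult[OF \<open>f \<in> F\<close> scale] by (rule lin_span.scale)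
    then show ?case by (simp add: ac_simps)
  next
    case (add g h)
    from lin_span.add[OF add.IH] show ?case by (simp add: algebra_simps)
  qed
next
  case (add f1 f2)
  from lin_span.add[OF add.IH] show ?case by (simp add: algebra_simps)
qed

lemma integrable_continuous_on_compact:
  fixes f :: "'a::euclidean_space \<Rightarrow> real"
  assumes "finite_measure M" and sets: "sets M = sets borel"
    and S: "compact S" "AE x in M. x \<in> S" and f: "continuous_on UNIV f"
  shows "integrable M f"
proof -
  interpret finite_measure M by fact
  have "bounded (f ` S)"
    using S(1) f by (meson compact_continuous_image compact_imp_bounded continuous_on_subset subset_UNIV)
  then obtain B where "\<forall>x\<in>S. norm (f x) \<le> B"
    by (auto simp: bounded_iff)
  moreover have "f \<in> borel_measurable M"
    using borel_measurable_continuous_onI[OF f] measurable_cong_sets[OF sets refl] by blast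
  ultimately show ?thesis
    using S(2) by (intro integrable_const_bound[where B=B]) auto
qed

text \<open>Inner and outer regularity, each spending half of \<open>e\<close>. The pair is the
  input for Urysohn's lemma when indicators are approximated by continuous functions.\<close>

lemma regular_sandwich:
  fixes M :: "'a::euclidean_space measure"
  assumes fin: "finite_measure M" and sets: "sets M = sets borel" and A: "A \<in> sets M" and "e > (0::real)"
  obtains K U where "K \<subseteq> A" "A \<subseteq> U" "compact K" "open U" "measure M (U - K) < e"
proof -
  interpret finite_measure M by fact
  have A_fin: "emeasure M A \<noteq> \<infinity>" by (simp add: emeasure_eq_measure)
  have inner: "emeasure M A = (SUP K \<in> {K. K \<subseteq> A \<and> compact K}. emeasure M K)"
    using A sets by (intro inner_regular) (auto simp: emeasure_eq_measure)
  have "\<exists>K\<in>{K. K \<subseteq> A \<and> compact K}. emeasure M A < emeasure M K + ennreal (e/2)"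
    by (rule SUP_approx_ennreal[OF _ _ inner A_fin]) (use \<open>e > 0\<close> in auto)
  then obtain K where K: "K \<subseteq> A" "compact K" "emeasure M A < emeasure M K + ennreal (e/2)"
    by blast
  have outer: "emeasure M A = (INF U \<in> {U. A \<subseteq> U \<and> open U}. emeasure M U)"
    using A sets by (intro outer_regular) (auto simp: emeasure_eq_measure)
  have "\<exists>U\<in>{U. A \<subseteq> U \<and> open U}. emeasure M U < emeasure M A + ennreal (e/2)"
    by (rule INF_approx_ennreal[OF _ outer A_fin]) (use \<open>e > 0\<close> in auto)
  then obtain U where U: "A \<subseteq> U" "open U" "emeasure M U < emeasure M A + ennreal (e/2)"
    by blast
  have m: "K \<in> sets M" "U \<in> sets M"
    using K U sets by (auto simp: compact_imp_closed)
  have "measure M A < measure M K + e/2" "measure M U < measure M A + e/2"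
    using K(3) U(3) \<open>e > 0\<close>
    by (auto simp: emeasure_eq_measure ennreal_plus[symmetric] ennreal_less_iff simp del: ennreal_plus)
  then have "measure M (U - K) < e"
    using finite_measure_Diff[of U K] m K(1) U(1) by auto
  with K U that show ?thesis by blast
qed

text \<open>The span of \<open>F\<close> is an algebra, so Stone-Weierstrass on the compact carrier
  \<open>S\<close> approximates continuous functions uniformly; Urysohn functions then reach
  indicators, and induction over integrable functions the rest. The form is that of an induction
  rule: the predicate \<open>V\<close> plays the part of a closed subspace.\<close>

theorem L1_dense_span:
  fixes M :: "'a::euclidean_space measure" and f :: "'a \<Rightarrow> real"
  assumes fin: "finite_measure M" and sets: "sets M = sets borel"
    and S: "compact S" "AE x in M. x \<in> S"
    and cont: "\<And>f. f \<in> F \<Longrightarrow> continuous_on UNIV f"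
    and one: "(\<lambda>_. 1) \<in> F"
    and mult: "\<And>f g. f \<in> F \<Longrightarrow> g \<in> F \<Longrightarrow> (\<lambda>x. f x * g x) \<in> F"
    and sep: "\<And>x y. x \<in> S \<Longrightarrow> y \<in> S \<Longrightarrow> x \<noteq> y \<Longrightarrow> \<exists>f\<in>F. f x \<noteq> f y"
    and V_F: "\<And>f c. f \<in> F \<Longrightarrow> V (\<lambda>x. c * f x)"
    and V_add: "\<And>f g. integrable M f \<Longrightarrow> integrable M g \<Longrightarrow> V f \<Longrightarrow> V g \<Longrightarrow> V (\<lambda>x. f x + g x)"
    and V_lim: "\<And>f s. integrable M f \<Longrightarrow> (\<And>i. integrable M (s i)) \<Longrightarrow> (\<And>i::nat. V (s i)) \<Longrightarrow>
        (\<lambda>i. \<integral>x. \<bar>s i x - f x\<bar> \<partial>M) \<longlonglongrightarrow> 0 \<Longrightarrow> V f"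
    and f: "integrable M f"
  shows "V f"
proof -
  interpret finite_measure M by fact
  note int = integrable_continuous_on_compact[OF fin sets S]
  have span_cont: "continuous_on UNIV f" if "lin_span F f" for f
    using that by induction (auto intro!: continuous_on_mult_left continuous_on_add dest: cont)
  have V_span: "V f" if "lin_span F f" for f
    using that by induction (auto intro!: V_F V_add int span_cont)
  have const: "lin_span F (\<lambda>_. c)" for c
    using lin_span.scale[OF one, of c] by simp
  have V_approx: "V f" if f: "integrable M f"
    and "\<And>e. e > 0 \<Longrightarrow> \<exists>g. integrable M g \<and> V g \<and> (\<integral>x. \<bar>g x - f x\<bar> \<partial>M) \<le> e" for f
  proof -
    have "\<exists>g. integrable M g \<and> V g \<and> (\<integral>x. \<bar>g x - f x\<bar> \<partial>M) \<le> 1 / real (Suc i)" for i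
      using that(2)[of "1 / real (Suc i)"] by simp
    then obtain s where s: "\<And>i. integrable M (s i)" "\<And>i. V (s i)"
        "\<And>i. (\<integral>x. \<bar>s i x - f x\<bar> \<partial>M) \<le> 1 / real (Suc i)"
      by metis
    have "(\<lambda>i. \<integral>x. \<bar>s i x - f x\<bar> \<partial>M) \<longlonglongrightarrow> 0"
      using s(3) by (intro real_tendsto_sandwich[OF _ _ tendsto_const LIMSEQ_inverse_real_of_nat])
                    (auto intro!: always_eventually simp: inverse_eq_divide simp del: of_nat_Suc)
    from V_lim[OF f s(1,2) this] show ?thesis .
  qed
  have V_cont: "V f" if f: "continuous_on UNIV f" for f
  proof (rule V_approx)
    show "integrable M f" by (rule int[OF f])
    fix e :: real assume "e > 0"
    \<comment> \<open>A uniform error \<open>e'\<close> integrates to at most \<open>e\<close>; the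
      added 1 covers a measure of mass 0.\<close>
    define e' where "e' = e / (measure M (space M) + 1)"
    have "e' > 0" using \<open>e > 0\<close> by (auto simp: e'_def intro!: divide_pos_pos add_nonneg_pos)
    have "\<exists>g. lin_span F g \<and> (\<forall>x\<in>S. \<bar>f x - g x\<bar> < e')"
    proof (rule Stone_Weierstrass_HOL[OF S(1)])
      show "continuous_on S g" if "lin_span F g" for g
        using span_cont[OF that] continuous_on_subset by blast
      show "\<exists>f. lin_span F f \<and> f x \<noteq> f y" if "x \<in> S \<and> y \<in> S \<and> x \<noteq> y" for x y
      proof -
        have "\<exists>f\<in>F. f x \<noteq> f y" using that by (intro sep) auto
        then obtain h where "h \<in> F" "h x \<noteq> h y" by (elim bexE)
        with lin_span.scale[of h F 1] show ?thesis by (intro exI[of _ h]) simp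
      qed
      show "lin_span F (\<lambda>x. g x * h x)" if "lin_span F g \<and> lin_span F h" for g h
        using that by (intro lin_span_mult mult) auto
      show "continuous_on S f"
        using f continuous_on_subset by blast
    qed (use const lin_span.add \<open>e' > 0\<close> in auto)
    then obtain g where g: "lin_span F g" "\<forall>x\<in>S. \<bar>f x - g x\<bar> < e'" by blast
    note gi = int[OF span_cont[OF g(1)]]
    have "(\<integral>x. \<bar>g x - f x\<bar> \<partial>M) \<le> (\<integral>x. e' \<partial>M)"
    proof (rule integral_mono_AE)
      show "AE x in M. \<bar>g x - f x\<bar> \<le> e'"
        using S(2) by eventually_elim (use g(2) in \<open>auto simp: abs_minus_commute less_imp_le\<close>)
    qed (use gi int[OF f] in auto)
    also have "\<dots> = measure M (space M) * e'" by simp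
    also have "\<dots> \<le> e"
    proof -
      have "measure M (space M) + 1 > 0" by (auto intro!: add_nonneg_pos)
      with \<open>e > 0\<close> show ?thesis by (simp add: e'_def pos_divide_le_eq algebra_simps)
    qed
    finally show "\<exists>g. integrable M g \<and> V g \<and> (\<integral>x. \<bar>g x - f x\<bar> \<partial>M) \<le> e"
      using gi V_span[OF g(1)] by blast
  qed
  from f show ?thesis
  proof induction
    case (base A c)
    show ?case
    proof (rule V_approx)
      show iA: "integrable M (\<lambda>x. indicator A x *\<^sub>R c)"
        using base by (intro integrable_scaleR_left) (auto simp: emeasure_eq_measure)
      fix e :: real assume "e > 0"
      \<comment> \<open>The mass of \<open>U - K\<close> is later multiplied by
        \<open>\<bar>c\<bar>\<close>, which may be 0.\<close>
      then have "e / (\<bar>c\<bar> + 1) > 0" by simp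
      from regular_sandwich[OF fin sets base(1) this] obtain K U where KU:
        "K \<subseteq> A" "A \<subseteq> U" "compact K" "open U" "measure M (U - K) < e / (\<bar>c\<bar> + 1)" .
      obtain h where h: "continuous_on UNIV h" "\<And>x. h x \<in> closed_segment 0 (1::real)"
        "\<And>x. x \<in> - U \<Longrightarrow> h x = 0" "\<And>x. x \<in> K \<Longrightarrow> h x = 1"
        using Urysohn[of "- U" K 0 1] KU by (auto simp: compact_imp_closed)
      have h01: "0 \<le> h x" "h x \<le> 1" for x
        using h(2)[of x] by (auto simp: closed_segment_eq_real_ivl)
      have hc: "continuous_on UNIV (\<lambda>x. h x * c)" by (intro continuous_intros h)
      have UK: "U - K \<in> sets M" using KU sets by (auto simp: compact_imp_closed)
      have "(\<integral>x. \<bar>h x * c - indicator A x *\<^sub>R c\<bar> \<partial>M) \<le> (\<integral>x. indicator (U - K) x * \<bar>c\<bar> \<partial>M)"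
      proof (rule integral_mono)
        show "integrable M (\<lambda>x. \<bar>h x * c - indicator A x *\<^sub>R c\<bar>)"
          using int[OF hc] iA by auto
        show "integrable M (\<lambda>x. indicator (U - K) x * \<bar>c\<bar>)"
          using UK by (auto simp: emeasure_eq_measure)
        fix x
        have "\<bar>h x - indicator A x\<bar> \<le> indicator (U - K) x"
          using h01[of x] h(3,4)[of x] KU(1,2) by (auto simp: indicator_def)
        then have "\<bar>h x - indicator A x\<bar> * \<bar>c\<bar> \<le> indicator (U - K) x * \<bar>c\<bar>"
          by (rule mult_right_mono) simp
        then show "\<bar>h x * c - indicator A x *\<^sub>R c\<bar> \<le> indicator (U - K) x * \<bar>c\<bar>"
          by (simp add: abs_mult[symmetric] left_diff_distrib)
      qed
      also have "\<dots> = measure M (U - K) * \<bar>c\<bar>"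
        using UK sets.sets_into_space[OF UK] by (simp add: Int_absorb2)
      also have "\<dots> \<le> (e / (\<bar>c\<bar> + 1)) * \<bar>c\<bar>"
        using KU(5) by (intro mult_right_mono) auto
      also have "\<dots> \<le> e"
        using \<open>e > 0\<close> by (auto simp: field_simps)
      finally show "\<exists>g. integrable M g \<and> V g \<and> (\<integral>x. \<bar>g x - indicator A x *\<^sub>R c\<bar> \<partial>M) \<le> e"
        using int[OF hc] V_cont[OF hc] by blast
    qed
  next
    case (lim f s)
    \<comment> \<open>The approximants satisfy \<open>norm (s i x) \<le> 2 * norm (f x)\<close>,
      whence the dominating function \<open>3 * \<bar>f x\<bar>\<close>.\<close>
    have "(\<lambda>i. \<integral>x. \<bar>s i x - f x\<bar> \<partial>M) \<longlonglongrightarrow> (\<integral>x. 0 \<partial>M)"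
    proof (rule integral_dominated_convergence[where w="\<lambda>x. 3 * \<bar>f x\<bar>"])
      show "AE x in M. (\<lambda>i. \<bar>s i x - f x\<bar>) \<longlonglongrightarrow> 0"
      proof (rule AE_I2)
        fix x assume "x \<in> space M"
        from tendsto_rabs[OF tendsto_diff[OF lim.hyps(2)[OF this] tendsto_const[of "f x"]]]
        show "(\<lambda>i. \<bar>s i x - f x\<bar>) \<longlonglongrightarrow> 0" by simp
      qed
      show "AE x in M. norm \<bar>s i x - f x\<bar> \<le> 3 * \<bar>f x\<bar>" for i
      proof (rule AE_I2)
        fix x assume "x \<in> space M"
        from lim.hyps(3)[OF this, of i]
        show "norm \<bar>s i x - f x\<bar> \<le> 3 * \<bar>f x\<bar>" by simp
      qed
    qed (use lim.hyps(1,4) in auto)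
    then show ?case using V_lim[OF lim.hyps(4,1) lim.IH] by simp
  qed (use V_add in auto)
qed

section \<open>Convolution with causal kernels on a box\<close>

text \<open>Representatives are arbitrary outside the box, while translates and convolutions need a
  function on the whole space: extension by zero provides one that depends only on the values in the
  box.\<close>

definition ext :: "real ^ 'n \<Rightarrow> (real ^ 'n \<Rightarrow> real) \<Rightarrow> real ^ 'n \<Rightarrow> real" where
  "ext T f t = indicator (box 0 T) t * f t"

lemma ext_in [simp]: "t \<in> box 0 T \<Longrightarrow> ext T f t = f t"
  and ext_out [simp]: "t \<notin> box 0 T \<Longrightarrow> ext T f t = 0"
  by (simp_all add: ext_def)

lemma L1_iff: "f \<in> L1 T \<longleftrightarrow> integrable lborel (ext T f)"
  by (simp add: L1_def integrable_restrict_space ext_def[abs_def])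

lemma integral_box_measure: "(\<integral>t. f t \<partial>(box_measure T)) = (\<integral>t. ext T f t \<partial>lborel)"
  for f :: "real ^ 'n \<Rightarrow> real"
  by (simp add: integral_restrict_space ext_def)

lemma L1_dist_ext: "L1_dist T f g = (\<integral>t. \<bar>ext T f t - ext T g t\<bar> \<partial>lborel)"
  unfolding L1_dist_def integral_box_measure
  by (intro Bochner_Integration.integral_cong) (auto simp: ext_def indicator_def)

lemma L1_eq_iff: "L1_eq T f g \<longleftrightarrow> (AE t in lborel. t \<in> box 0 T \<longrightarrow> f t = g t)"
  by (simp add: L1_eq_def AE_restrict_space_iff)

lemma L1_eq_ext: "L1_eq T f g \<longleftrightarrow> (AE t in lborel. ext T f t = ext T g t)"
  unfolding L1_eq_iff by (intro AE_cong) (auto simp: ext_def indicator_def)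

lemma L1_eq_refl [simp, intro]: "L1_eq T f f"
  by (simp add: L1_eq_def)

lemma L1_eq_sym: "L1_eq T f g \<Longrightarrow> L1_eq T g f"
  unfolding L1_eq_def by (auto elim: AE_mp)

lemma L1_eq_trans [trans]: "L1_eq T f g \<Longrightarrow> L1_eq T g h \<Longrightarrow> L1_eq T f h"
  unfolding L1_eq_def by (elim AE_mp) (auto elim: AE_mp)

lemma L1_eqI: "(\<And>t. t \<in> box 0 T \<Longrightarrow> f t = g t) \<Longrightarrow> L1_eq T f g"
  by (auto simp: L1_eq_iff)

lemma L1_cong: "(\<And>t. t \<in> box 0 T \<Longrightarrow> f t = g t) \<Longrightarrow> f \<in> L1 T \<longleftrightarrow> g \<in> L1 T"
  unfolding L1_iff by (intro Bochner_Integration.integrable_cong) (auto simp: ext_def indicator_def)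

lemma ext_linear: "ext T (\<lambda>t. a * f t + b * g t) = (\<lambda>t. a * ext T f t + b * ext T g t)"
  by (auto simp: ext_def algebra_simps)

lemma L1_linear_comb [intro]:
  "f \<in> L1 T \<Longrightarrow> g \<in> L1 T \<Longrightarrow> (\<lambda>t. a * f t + b * g t) \<in> L1 T"
  unfolding L1_iff ext_linear by auto

lemma L1_const [simp, intro]: "(\<lambda>_. c) \<in> L1 T"
  unfolding L1_iff ext_def by (auto simp: emeasure_lborel_box_eq)

lemma L1_diff: "f \<in> L1 T \<Longrightarrow> g \<in> L1 T \<Longrightarrow> (\<lambda>t. f t - g t) \<in> L1 T"
  using L1_linear_comb[of f T g 1 "-1"] by simp

lemma L1_dist_nonneg [simp]: "0 \<le> L1_dist T f g"
  by (simp add: L1_dist_def)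

lemma L1_dist_commute: "L1_dist T f g = L1_dist T g f"
  by (simp add: L1_dist_def abs_minus_commute)

lemma L1_dist_refl [simp]: "L1_dist T f f = 0"
  by (simp add: L1_dist_def)

lemma L1_dist_eq_0_iff:
  assumes "f \<in> L1 T" "g \<in> L1 T"
  shows "L1_dist T f g = 0 \<longleftrightarrow> L1_eq T f g"
proof -
  have "integrable lborel (\<lambda>t. \<bar>ext T f t - ext T g t\<bar>)"
    using assms by (auto simp: L1_iff)
  from integral_nonneg_eq_0_iff_AE[OF this] show ?thesis
    by (simp add: L1_dist_ext L1_eq_ext)
qed

lemma L1_dist_triangle:
  assumes "f \<in> L1 T" "g \<in> L1 T" "h \<in> L1 T"
  shows "L1_dist T f h \<le> L1_dist T f g + L1_dist T g h"
proof -
  note [simp] = assms[unfolded L1_iff]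
  have "L1_dist T f h \<le> (\<integral>t. \<bar>ext T f t - ext T g t\<bar> + \<bar>ext T g t - ext T h t\<bar> \<partial>lborel)"
    unfolding L1_dist_ext by (intro integral_mono) auto
  also have "\<dots> = L1_dist T f g + L1_dist T g h"
    unfolding L1_dist_ext by (intro Bochner_Integration.integral_add) auto
  finally show ?thesis .
qed

lemma L1_dist_cong:
  assumes "L1_eq T f f'" "L1_eq T g g'" "f \<in> L1 T" "f' \<in> L1 T" "g \<in> L1 T" "g' \<in> L1 T"
  shows "L1_dist T f g = L1_dist T f' g'"
  unfolding L1_dist_ext
  using assms unfolding L1_eq_ext L1_iff
  by (intro integral_cong_AE) (auto elim: AE_mp)

lemma L1_limit_unique:
  assumes "g \<in> L1 T" "h \<in> L1 T" "\<And>i::nat. s i \<in> L1 T"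
    and "(\<lambda>i. L1_dist T (s i) g) \<longlonglongrightarrow> 0" "(\<lambda>i. L1_dist T (s i) h) \<longlonglongrightarrow> 0"
  shows "L1_eq T g h"
proof -
  have "L1_dist T g h \<le> L1_dist T (s i) g + L1_dist T (s i) h" for i
    using L1_dist_triangle[of g T "s i" h] assms by (simp add: L1_dist_commute)
  moreover have "(\<lambda>i. L1_dist T (s i) g + L1_dist T (s i) h) \<longlonglongrightarrow> 0"
    using tendsto_add[OF assms(4,5)] by simp
  ultimately have "L1_dist T g h \<le> 0"
    by (intro LIMSEQ_le_const[of _ 0]) auto
  then have "L1_dist T g h = 0" using L1_dist_nonneg[of T g h] by linarith
  then show ?thesis using L1_dist_eq_0_iff assms by blast
qed

section \<open>Superpositions of translates and causal kernels\<close>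

lemma lborel_integral_shift:
  fixes F :: "'a::euclidean_space \<Rightarrow> real"
  shows "(\<integral>t. F (t - c) \<partial>lborel) = (\<integral>t. F t \<partial>lborel)"
    and "integrable lborel F \<Longrightarrow> integrable lborel (\<lambda>t. F (t - c))"
proof -
  have *: "distr lborel borel (\<lambda>t. t - c) = lborel"
    using lborel_distr_plus[of "-c"] by (simp add: algebra_simps cong: distr_cong)
  show "integrable lborel F \<Longrightarrow> integrable lborel (\<lambda>t. F (t - c))"
    by (rule integrable_distr[of _ _ borel]) (simp_all add: *)
  show "(\<integral>t. F (t - c) \<partial>lborel) = (\<integral>t. F t \<partial>lborel)"
  proof (cases "integrable lborel F")
    case True
    then show ?thesis using integral_distr[of "\<lambda>t. t - c" lborel borel F] * by simp
  next
    \<comment> \<open>Here both integrals take the default value 0, once the translate is seen to be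
      non-integrable too.\<close>
    case False
    have *: "distr lborel borel (\<lambda>t. t + c) = lborel"
      using lborel_distr_plus[of c] by (simp add: add.commute cong: distr_cong)
    have "\<not> integrable lborel (\<lambda>t. F (t - c))"
    proof
      assume "integrable lborel (\<lambda>t. F (t - c))"
      then have "integrable lborel (\<lambda>t. F ((t + c) - c))"
        by (intro integrable_distr[of "\<lambda>t. t + c" lborel borel]) (simp_all add: *)
      with False show False by simp
    qed
    with False show ?thesis by (simp add: not_integrable_integral_eq)
  qed
qed

text \<open>Translation invariance makes the inner norm independent of \<open>h\<close>, so by
  Fubini the norm factorizes. This is Young's inequality for a family of shifts, and every operator
  bound below comes from it.\<close>

lemma integrable_translates:
  fixes F :: "'a::euclidean_space \<Rightarrow> real"
  assumes F: "integrable lborel F" and N: "sigma_finite_measure N"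
    and w: "integrable N w" and \<phi> [measurable]: "\<phi> \<in> borel_measurable N"
  shows "integrable (lborel \<Otimes>\<^sub>M N) (\<lambda>(t, h). w h * F (t - \<phi> h))"
    and "(\<integral>t. \<integral>h. \<bar>w h * F (t - \<phi> h)\<bar> \<partial>N \<partial>lborel) = (\<integral>h. \<bar>w h\<bar> \<partial>N) * (\<integral>t. \<bar>F t\<bar> \<partial>lborel)"
proof -
  interpret N: sigma_finite_measure N by fact
  interpret P: pair_sigma_finite N lborel by standard
  interpret Q: pair_sigma_finite lborel N by standard
  have [measurable]: "F \<in> borel_measurable borel" "w \<in> borel_measurable N"
    using F w by auto
  have [measurable]: "(\<lambda>(t, h). w h * F (t - \<phi> h)) \<in> borel_measurable (lborel \<Otimes>\<^sub>M N)"
    by measurable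
  have sh: "(\<integral>t. \<bar>F (t - \<phi> h)\<bar> \<partial>lborel) = (\<integral>t. \<bar>F t\<bar> \<partial>lborel)" for h
    using lborel_integral_shift(1)[of "\<lambda>t. \<bar>F t\<bar>" "\<phi> h"] by simp
  have "integrable (N \<Otimes>\<^sub>M lborel) (\<lambda>(h, t). w h * F (t - \<phi> h))"
  proof (rule P.Fubini_integrable)
    show "integrable N (\<lambda>h. \<integral>t. norm (case (h, t) of (h, t) \<Rightarrow> w h * F (t - \<phi> h)) \<partial>lborel)"
      using w by (simp add: abs_mult sh)
    show "AE h in N. integrable lborel (\<lambda>t. case (h, t) of (h, t) \<Rightarrow> w h * F (t - \<phi> h))"
      using lborel_integral_shift(2)[OF F] by auto
  qed measurable
  from P.integrable_product_swap[OF this]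
  show *: "integrable (lborel \<Otimes>\<^sub>M N) (\<lambda>(t, h). w h * F (t - \<phi> h))"
    by (simp add: case_prod_unfold split_beta')
  then have "integrable (lborel \<Otimes>\<^sub>M N) (\<lambda>(t, h). \<bar>w h * F (t - \<phi> h)\<bar>)"
    using integrable_abs[OF *] by (simp add: case_prod_unfold)
  from Q.Fubini_integral[OF this]
  show "(\<integral>t. \<integral>h. \<bar>w h * F (t - \<phi> h)\<bar> \<partial>N \<partial>lborel) = (\<integral>h. \<bar>w h\<bar> \<partial>N) * (\<integral>t. \<bar>F t\<bar> \<partial>lborel)"
    by (simp add: abs_mult sh)
qed

text \<open>One notion for two kinds of operators: with shifts \<open>axis i h\<close> along one
  axis it is fractional integration in one variable, with \<open>\<phi>\<close> the identity on the
  whole space it is convolution.\<close>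

definition kern ::
  "real ^ 'n \<Rightarrow> 'h measure \<Rightarrow> ('h \<Rightarrow> real) \<Rightarrow> ('h \<Rightarrow> real ^ 'n) \<Rightarrow> (real ^ 'n \<Rightarrow> real) \<Rightarrow> real ^ 'n \<Rightarrow> real"
  where "kern T N w \<phi> f t = (\<integral>h. w h * ext T f (t - \<phi> h) \<partial>N)"

text \<open>The sign condition means that the value at a point depends only on points below it in
  every coordinate. This makes truncation to the box compatible with composition.\<close>

definition causal_kernel :: "'h measure \<Rightarrow> ('h \<Rightarrow> real) \<Rightarrow> ('h \<Rightarrow> real ^ 'n) \<Rightarrow> bool" where
  "causal_kernel N w \<phi> \<longleftrightarrow> sigma_finite_measure N \<and> integrable N w \<and> \<phi> \<in> borel_measurable N \<and>
     (\<forall>h. w h \<noteq> 0 \<longrightarrow> (\<forall>i. 0 \<le> \<phi> h $ i))"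

lemma kern_L1:
  assumes K: "causal_kernel N w \<phi>" and f: "f \<in> L1 T"
  shows "kern T N w \<phi> f \<in> L1 T"
proof -
  interpret N: sigma_finite_measure N using K by (simp add: causal_kernel_def)
  interpret Q: pair_sigma_finite lborel N by standard
  have "integrable (lborel \<Otimes>\<^sub>M N) (\<lambda>(t, h). w h * ext T f (t - \<phi> h))"
    using K f by (intro integrable_translates) (auto simp: causal_kernel_def L1_iff)
  from Q.integrable_fst'[OF this] have "integrable lborel (kern T N w \<phi> f)"
    by (simp add: kern_def[abs_def])
  then show ?thesis unfolding L1_iff ext_def
    by (simp add: integrable_mult_indicator[where 'b=real, simplified])
qed

lemma kern_AE_integrable:
  assumes K: "causal_kernel N w \<phi>" and f: "f \<in> L1 T"
  shows "AE t in lborel. integrable N (\<lambda>h. w h * ext T f (t - \<phi> h))"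
proof -
  interpret N: sigma_finite_measure N using K by (simp add: causal_kernel_def)
  interpret Q: pair_sigma_finite lborel N by standard
  have "integrable (lborel \<Otimes>\<^sub>M N) (\<lambda>(t, h). w h * ext T f (t - \<phi> h))"
    using K f by (intro integrable_translates) (auto simp: causal_kernel_def L1_iff)
  from Q.AE_integrable_fst'[OF this] show ?thesis by simp
qed

lemma kern_linear:
  assumes K: "causal_kernel N w \<phi>" and f: "f \<in> L1 T" "g \<in> L1 T"
  shows "AE t in lborel. kern T N w \<phi> (\<lambda>t. a * f t + b * g t) t
           = a * kern T N w \<phi> f t + b * kern T N w \<phi> g t"
  using kern_AE_integrable[OF K f(1)] kern_AE_integrable[OF K f(2)]
proof eventually_elim
  case (elim t)
  have "kern T N w \<phi> (\<lambda>t. a * f t + b * g t) t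
     = (\<integral>h. a * (w h * ext T f (t - \<phi> h)) + b * (w h * ext T g (t - \<phi> h)) \<partial>N)"
    unfolding kern_def ext_linear by (intro Bochner_Integration.integral_cong) (auto simp: algebra_simps)
  also have "\<dots> = a * kern T N w \<phi> f t + b * kern T N w \<phi> g t"
    unfolding kern_def using elim by (subst Bochner_Integration.integral_add) auto
  finally show ?case .
qed

lemma kern_norm_le:
  assumes K: "causal_kernel N w \<phi>" and f: "f \<in> L1 T"
  shows "(\<integral>t. \<bar>ext T (kern T N w \<phi> f) t\<bar> \<partial>lborel) \<le> (\<integral>h. \<bar>w h\<bar> \<partial>N) * (\<integral>t. \<bar>ext T f t\<bar> \<partial>lborel)"
proof -
  interpret N: sigma_finite_measure N using K by (simp add: causal_kernel_def)
  interpret Q: pair_sigma_finite lborel N by standard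
  have *: "integrable (lborel \<Otimes>\<^sub>M N) (\<lambda>(t, h). w h * ext T f (t - \<phi> h))"
    using K f by (intro integrable_translates) (auto simp: causal_kernel_def L1_iff)
  have **: "integrable (lborel \<Otimes>\<^sub>M N) (\<lambda>(t, h). \<bar>w h * ext T f (t - \<phi> h)\<bar>)"
    using integrable_abs[OF *] by (simp add: case_prod_unfold)
  have "(\<integral>t. \<bar>ext T (kern T N w \<phi> f) t\<bar> \<partial>lborel) \<le> (\<integral>t. \<integral>h. \<bar>w h * ext T f (t - \<phi> h)\<bar> \<partial>N \<partial>lborel)"
  proof (rule integral_mono)
    show "integrable lborel (\<lambda>t. \<bar>ext T (kern T N w \<phi> f) t\<bar>)"
      using kern_L1[OF K f] by (simp add: L1_iff)
    show "integrable lborel (\<lambda>t. \<integral>h. \<bar>w h * ext T f (t - \<phi> h)\<bar> \<partial>N)"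
      using Q.integrable_fst'[OF **] by simp
    show "\<bar>ext T (kern T N w \<phi> f) t\<bar> \<le> (\<integral>h. \<bar>w h * ext T f (t - \<phi> h)\<bar> \<partial>N)" for t
      by (cases "t \<in> box 0 T") (auto simp: kern_def)
  qed
  also have "\<dots> = (\<integral>h. \<bar>w h\<bar> \<partial>N) * (\<integral>t. \<bar>ext T f t\<bar> \<partial>lborel)"
    using K f by (intro integrable_translates) (auto simp: causal_kernel_def L1_iff)
  finally show ?thesis .
qed

lemma kern_dist_le:
  assumes K: "causal_kernel N w \<phi>" and f: "f \<in> L1 T" "g \<in> L1 T"
  shows "L1_dist T (kern T N w \<phi> f) (kern T N w \<phi> g) \<le> (\<integral>h. \<bar>w h\<bar> \<partial>N) * L1_dist T f g"
proof -
  define d where "d = (\<lambda>t. 1 * f t + (-1) * g t)"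
  have d: "d \<in> L1 T" unfolding d_def using f by (rule L1_linear_comb)
  have "AE t in lborel. kern T N w \<phi> d t = kern T N w \<phi> f t - kern T N w \<phi> g t"
    using kern_linear[OF K f, of 1 "-1"] by (simp add: d_def)
  then have "AE t in lborel. \<bar>ext T (kern T N w \<phi> f) t - ext T (kern T N w \<phi> g) t\<bar>
      = \<bar>ext T (kern T N w \<phi> d) t\<bar>"
    by eventually_elim (simp add: ext_def right_diff_distrib)
  then have "L1_dist T (kern T N w \<phi> f) (kern T N w \<phi> g) = (\<integral>t. \<bar>ext T (kern T N w \<phi> d) t\<bar> \<partial>lborel)"
    unfolding L1_dist_ext
    using kern_L1[OF K f(1)] kern_L1[OF K f(2)] kern_L1[OF K d]
    by (intro integral_cong_AE) (auto simp: L1_iff)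
  also have "\<dots> \<le> (\<integral>h. \<bar>w h\<bar> \<partial>N) * (\<integral>t. \<bar>ext T d t\<bar> \<partial>lborel)"
    by (rule kern_norm_le[OF K d])
  also have "(\<integral>t. \<bar>ext T d t\<bar> \<partial>lborel) = L1_dist T f g"
    by (simp add: L1_dist_ext d_def ext_def right_diff_distrib)
  finally show ?thesis .
qed

definition L1_op :: "real ^ 'n \<Rightarrow> ((real ^ 'n \<Rightarrow> real) \<Rightarrow> (real ^ 'n \<Rightarrow> real)) \<Rightarrow> bool" where
  "L1_op T A \<longleftrightarrow> L1_operator T A \<and> L1_linear T A \<and> L1_continuous T A"

lemma L1_op_kern:
  assumes K: "causal_kernel N w \<phi>"
  shows "L1_op T (kern T N w \<phi>)"
  unfolding L1_op_def
proof (intro conjI)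
  show "L1_operator T (kern T N w \<phi>)"
    unfolding L1_operator_def
  proof (intro conjI ballI impI)
    fix f g assume fg: "f \<in> L1 T" "g \<in> L1 T" "L1_eq T f g"
    then have "L1_dist T (kern T N w \<phi> f) (kern T N w \<phi> g) \<le> 0"
      using kern_dist_le[OF K fg(1,2)] L1_dist_eq_0_iff[OF fg(1,2)] by simp
    then have "L1_dist T (kern T N w \<phi> f) (kern T N w \<phi> g) = 0"
      using L1_dist_nonneg antisym by blast
    then show "L1_eq T (kern T N w \<phi> f) (kern T N w \<phi> g)"
      using L1_dist_eq_0_iff kern_L1[OF K] fg(1,2) by blast
  qed (rule kern_L1[OF K])
  show "L1_linear T (kern T N w \<phi>)"
    unfolding L1_linear_def L1_eq_iff
  proof (intro ballI allI)
    fix f g a b assume "f \<in> L1 T" "g \<in> L1 T"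
    from kern_linear[OF K this, of a b]
    show "AE t in lborel. t \<in> box 0 T \<longrightarrow> kern T N w \<phi> (\<lambda>t. a * f t + b * g t) t
        = a * kern T N w \<phi> f t + b * kern T N w \<phi> g t"
      by eventually_elim simp
  qed
  show "L1_continuous T (kern T N w \<phi>)"
    unfolding L1_continuous_def
  proof (intro ballI allI impI)
    fix f \<epsilon> assume f: "f \<in> L1 T" and "(0::real) < \<epsilon>"
    define W where "W = (\<integral>h. \<bar>w h\<bar> \<partial>N) + 1"
    have W: "W > 0" "(\<integral>h. \<bar>w h\<bar> \<partial>N) \<le> W" by (auto simp: W_def intro!: add_nonneg_pos)
    show "\<exists>\<delta>>0. \<forall>g\<in>L1 T. L1_dist T g f < \<delta> \<longrightarrow> L1_dist T (kern T N w \<phi> g) (kern T N w \<phi> f) < \<epsilon>"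
    proof (intro exI[of _ "\<epsilon> / W"] conjI ballI impI)
      fix g assume g: "g \<in> L1 T" "L1_dist T g f < \<epsilon> / W"
      have "L1_dist T (kern T N w \<phi> g) (kern T N w \<phi> f) \<le> (\<integral>h. \<bar>w h\<bar> \<partial>N) * L1_dist T g f"
        by (rule kern_dist_le[OF K g(1) f])
      also have "\<dots> \<le> W * L1_dist T g f"
        using W by (intro mult_right_mono) auto
      also have "\<dots> < \<epsilon>" using g(2) W by (simp add: field_simps)
      finally show "L1_dist T (kern T N w \<phi> g) (kern T N w \<phi> f) < \<epsilon>" .
    qed (use W \<open>\<epsilon> > 0\<close> in auto)
  qed
qed

lemma box_between:
  fixes t u v :: "real ^ 'n"
  assumes "t \<in> box 0 T" "v \<in> box 0 T" "\<And>i. v $ i \<le> u $ i" "\<And>i. u $ i \<le> t $ i"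
  shows "u \<in> box 0 T"
  unfolding mem_box_cart
proof (intro allI conjI)
  fix i
  show "0 $ i < u $ i" using assms(2) assms(3)[of i] by (auto simp: mem_box_cart intro: less_le_trans)
  show "u $ i < T $ i" using assms(1) assms(4)[of i] by (auto simp: mem_box_cart intro: le_less_trans)
qed

text \<open>The truncation between the two operators is invisible: if \<open>t\<close> and
  \<open>t - \<phi> h - \<psi> k\<close> both lie in the box, then by causality the intermediate
  point lies coordinatewise between them, hence in the box as well.\<close>

lemma kern_kern:
  assumes K: "causal_kernel N w \<phi>" and L: "causal_kernel M v \<psi>" and f: "f \<in> L1 T" and t: "t \<in> box 0 T"
  shows "kern T N w \<phi> (kern T M v \<psi> f) t
          = (\<integral>h. \<integral>k. w h * v k * ext T f (t - \<phi> h - \<psi> k) \<partial>M \<partial>N)"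
  unfolding kern_def
proof (intro Bochner_Integration.integral_cong refl)
  fix h
  show "w h * ext T (\<lambda>t. \<integral>k. v k * ext T f (t - \<psi> k) \<partial>M) (t - \<phi> h)
     = (\<integral>k. w h * v k * ext T f (t - \<phi> h - \<psi> k) \<partial>M)"
  proof (cases "w h \<noteq> 0 \<and> t - \<phi> h \<notin> box 0 T")
    case True
    have z: "w h * v k * ext T f (t - \<phi> h - \<psi> k) = 0" for k
    proof (rule ccontr)
      assume "w h * v k * ext T f (t - \<phi> h - \<psi> k) \<noteq> 0"
      then have k: "v k \<noteq> 0" "t - \<phi> h - \<psi> k \<in> box 0 T" by (auto intro: ccontr)
      then have "t - \<phi> h \<in> box 0 T"
        using K L True by (intro box_between[OF t k(2)]) (auto simp: causal_kernel_def)
      with True show False by simp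
    qed
    show ?thesis unfolding z using True by simp
  qed (auto simp: mult.assoc)
qed

text \<open>Fubini in the double integral of \<open>kern_kern\<close>. The equality is only almost
  everywhere because the integrand is integrable in both shifts jointly only for almost every
  \<open>t\<close>.\<close>

lemma kern_commute:
  fixes f :: "real ^ 'n \<Rightarrow> real"
  assumes K: "causal_kernel N w \<phi>" and L: "causal_kernel M v \<psi>" and f: "f \<in> L1 T"
  shows "L1_eq T (kern T N w \<phi> (kern T M v \<psi> f)) (kern T M v \<psi> (kern T N w \<phi> f))"
proof -
  interpret N: sigma_finite_measure N using K by (simp add: causal_kernel_def)
  interpret M: sigma_finite_measure M using L by (simp add: causal_kernel_def)
  interpret P: pair_sigma_finite N M by standard
  interpret Q: pair_sigma_finite "lborel :: (real^'n) measure" "N \<Otimes>\<^sub>M M"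
    by (intro pair_sigma_finite.intro P.sigma_finite_measure_axioms sigma_finite_lborel)
  have [measurable]: "\<phi> \<in> borel_measurable N" "\<psi> \<in> borel_measurable M"
    and w: "integrable N w" "integrable M v" using K L by (auto simp: causal_kernel_def)
  have [measurable]: "w \<in> borel_measurable N" "v \<in> borel_measurable M" using w by auto
  have wv: "integrable (N \<Otimes>\<^sub>M M) (\<lambda>(h, k). w h * v k)"
    by (rule P.Fubini_integrable) (use w in \<open>auto simp: abs_mult\<close>)
  have "integrable (lborel \<Otimes>\<^sub>M (N \<Otimes>\<^sub>M M))
      (\<lambda>(t, p). (case p of (h, k) \<Rightarrow> w h * v k) * ext T f (t - (case p of (h, k) \<Rightarrow> \<phi> h + \<psi> k)))"
    by (intro integrable_translates wv) (use f in \<open>auto simp: L1_iff P.sigma_finite_measure_axioms\<close>)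
  from Q.AE_integrable_fst'[OF this]
  have "AE t in lborel. integrable (N \<Otimes>\<^sub>M M) (\<lambda>(h, k). w h * v k * ext T f (t - \<phi> h - \<psi> k))"
    by (simp add: case_prod_unfold diff_diff_eq)
  then show ?thesis unfolding L1_eq_iff
  proof eventually_elim
    case (elim t)
    show ?case
    proof
      assume t: "t \<in> box 0 T"
      have "kern T N w \<phi> (kern T M v \<psi> f) t = (\<integral>h. \<integral>k. w h * v k * ext T f (t - \<phi> h - \<psi> k) \<partial>M \<partial>N)"
        by (rule kern_kern[OF K L f t])
      also have "\<dots> = (\<integral>k. \<integral>h. w h * v k * ext T f (t - \<phi> h - \<psi> k) \<partial>N \<partial>M)"
        using P.Fubini_integral[OF elim] by simp
      also have "\<dots> = (\<integral>k. \<integral>h. v k * w h * ext T f (t - \<psi> k - \<phi> h) \<partial>N \<partial>M)"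
        by (simp add: ac_simps diff_diff_eq)
      also have "\<dots> = kern T M v \<psi> (kern T N w \<phi> f) t"
        by (rule kern_kern[OF L K f t, symmetric])
      finally show "kern T N w \<phi> (kern T M v \<psi> f) t = kern T M v \<psi> (kern T N w \<phi> f) t" .
    qed
  qed
qed

section \<open>Operators commuting with integration\<close>

lemma L1_opD:
  assumes "L1_op T A"
  shows "f \<in> L1 T \<Longrightarrow> A f \<in> L1 T"
    and "f \<in> L1 T \<Longrightarrow> g \<in> L1 T \<Longrightarrow> L1_eq T f g \<Longrightarrow> L1_eq T (A f) (A g)"
    and "f \<in> L1 T \<Longrightarrow> g \<in> L1 T \<Longrightarrow>
      L1_eq T (A (\<lambda>t. a * f t + b * g t)) (\<lambda>t. a * A f t + b * A g t)"
  using assms by (auto simp: L1_op_def L1_operator_def L1_linear_def)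

lemma L1_op_tendsto:
  assumes A: "L1_op T A" and f: "f \<in> L1 T" and s: "\<And>i::nat. s i \<in> L1 T"
    and lim: "(\<lambda>i. L1_dist T (s i) f) \<longlonglongrightarrow> 0"
  shows "(\<lambda>i. L1_dist T (A (s i)) (A f)) \<longlonglongrightarrow> 0"
proof (rule LIMSEQ_I)
  fix e :: real assume "e > 0"
  then obtain d where d: "d > 0" "\<And>g. g \<in> L1 T \<Longrightarrow> L1_dist T g f < d \<Longrightarrow> L1_dist T (A g) (A f) < e"
    using A f unfolding L1_op_def L1_continuous_def by meson
  from LIMSEQ_D[OF lim d(1)] obtain N where "\<forall>n\<ge>N. L1_dist T (s n) f < d" by auto
  then show "\<exists>N. \<forall>n\<ge>N. norm (L1_dist T (A (s n)) (A f) - 0) < e"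
    using d(2)[OF s] by (intro exI[of _ N]) auto
qed

lemma L1_op_compose:
  assumes A: "L1_op T A" and B: "L1_op T B"
  shows "L1_op T (\<lambda>f. A (B f))"
  unfolding L1_op_def
proof (intro conjI)
  show "L1_operator T (\<lambda>f. A (B f))"
    unfolding L1_operator_def
    by (intro conjI ballI impI L1_opD(1,2)[OF A] L1_opD(1,2)[OF B])
  show "L1_linear T (\<lambda>f. A (B f))"
    unfolding L1_linear_def
  proof (intro ballI allI)
    fix f g a b assume f: "f \<in> L1 T" "g \<in> L1 T"
    have "L1_eq T (A (B (\<lambda>t. a * f t + b * g t))) (A (\<lambda>t. a * B f t + b * B g t))"
      by (intro L1_opD(2)[OF A] L1_opD(3)[OF B] L1_opD(1)[OF B] L1_linear_comb f)
    also have "L1_eq T \<dots> (\<lambda>t. a * A (B f) t + b * A (B g) t)"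
      by (intro L1_opD(3)[OF A] L1_opD(1)[OF B] f)
    finally show "L1_eq T (A (B (\<lambda>t. a * f t + b * g t))) (\<lambda>t. a * A (B f) t + b * A (B g) t)" .
  qed
  show "L1_continuous T (\<lambda>f. A (B f))"
    unfolding L1_continuous_def
  proof (intro ballI allI impI)
    fix f e assume f: "f \<in> L1 T" and e: "e > (0::real)"
    obtain d where d: "d > 0" "\<And>g. g \<in> L1 T \<Longrightarrow> L1_dist T g (B f) < d \<Longrightarrow> L1_dist T (A g) (A (B f)) < e"
      using A L1_opD(1)[OF B f] e unfolding L1_op_def L1_continuous_def by meson
    obtain c where c: "c > 0" "\<And>g. g \<in> L1 T \<Longrightarrow> L1_dist T g f < c \<Longrightarrow> L1_dist T (B g) (B f) < d"
      using B f d(1) unfolding L1_op_def L1_continuous_def by meson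
    show "\<exists>\<delta>>0. \<forall>g\<in>L1 T. L1_dist T g f < \<delta> \<longrightarrow> L1_dist T (A (B g)) (A (B f)) < e"
      using c d L1_opD(1)[OF B] by blast
  qed
qed

lemma L1_op_cong:
  assumes A: "L1_op T A" and eq: "\<And>f t. t \<in> box 0 T \<Longrightarrow> A f t = B f t"
  shows "L1_op T B"
proof -
  have m: "A f \<in> L1 T \<longleftrightarrow> B f \<in> L1 T" for f using eq by (rule L1_cong)
  have e: "L1_eq T (A f) (B f)" for f using eq by (rule L1_eqI)
  have d: "L1_dist T (A f) (A g) = L1_dist T (B f) (B g)" for f g
    unfolding L1_dist_ext by (intro Bochner_Integration.integral_cong) (auto simp: ext_def indicator_def eq)
  have q: "L1_eq T (A f) (A g) \<longleftrightarrow> L1_eq T (B f) (B g)" for f g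
    using e L1_eq_trans L1_eq_sym by metis
  have l: "L1_eq T (A h) (\<lambda>t. a * A f t + b * A g t) \<longleftrightarrow> L1_eq T (B h) (\<lambda>t. a * B f t + b * B g t)" for h f g a b
    unfolding L1_eq_iff using eq by (intro AE_cong) auto
  show ?thesis
    using A unfolding L1_op_def L1_operator_def L1_linear_def L1_continuous_def m d q l .
qed

lemma L1_op_id: "L1_op T (\<lambda>f. f)"
  by (auto simp: L1_op_def L1_operator_def L1_linear_def L1_continuous_def)

section \<open>Partial Riemann-Liouville integrals as causal kernels\<close>

lemma set_integrable_powr:
  assumes "a > (0::real)" "c > 0"
  shows "set_integrable lborel {0<..<c} (\<lambda>h. h powr (a - 1))"
proof -
  have "(\<lambda>h. h powr (a - 1)) integrable_on {0..c}"
    using integrable_on_powr_from_0[of "a - 1" c] assms by simp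
  then have "(\<lambda>h. h powr (a - 1)) absolutely_integrable_on {0<..<c}"
    by (intro nonnegative_absolutely_integrable_1)
       (auto simp: integrable_on_Icc_iff_Ioo)
  then show ?thesis
    unfolding set_integrable_def by (subst (asm) integrable_completion) auto
qed

text \<open>The fractional kernel is cut off at \<open>T $ i\<close>, which makes it integrable;
  longer steps leave the box anyway.\<close>

definition rl_weight :: "real ^ 'n \<Rightarrow> 'n \<Rightarrow> real \<Rightarrow> real \<Rightarrow> real" where
  "rl_weight T i a h = indicator {0<..<T $ i} h * (h powr (a - 1)) / Gamma a"

lemma axis_measurable [measurable]: "(axis i :: real \<Rightarrow> real ^ 'n) \<in> borel_measurable (borel :: real measure)"
proof -
  have "linear (axis i :: real \<Rightarrow> real ^ 'n)"
    by (rule linearI) (auto simp: axis_def vec_eq_iff)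
  then show ?thesis
    by (intro borel_measurable_continuous_onI linear_continuous_on linear_conv_bounded_linear[THEN iffD1])
qed

lemma causal_rl_weight:
  fixes T :: "real ^ 'n"
  assumes "T $ i > 0" "a > 0"
  shows "causal_kernel lborel (rl_weight T i a) (axis i :: real \<Rightarrow> real ^ 'n)"
  unfolding causal_kernel_def
proof (intro conjI allI impI)
  have "integrable lborel (\<lambda>h. indicator {0<..<T $ i} h *\<^sub>R h powr (a - 1))"
    using set_integrable_powr[OF assms(2,1)] by (simp add: set_integrable_def)
  then show "integrable lborel (rl_weight T i a)"
    unfolding rl_weight_def[abs_def] by simp
  fix h j assume "rl_weight T i a h \<noteq> 0"
  then show "0 \<le> axis i h $ j" by (auto simp: rl_weight_def axis_def indicator_def split: if_splits)
qed (auto intro: sigma_finite_lborel)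

text \<open>Substitute h = t_i - s. For \<open>t\<close> in the box, the truncation of
  \<open>f\<close> and the cut-off of the weight together leave exactly the range 0 < s <
  t_i.\<close>

lemma RL_partial_eq_kern:
  fixes T :: "real ^ 'n"
  assumes t: "t \<in> box 0 T" and a: "a \<noteq> 0"
  shows "RL_partial i a f t = kern T lborel (rl_weight T i a) (axis i) f t"
proof -
  let ?u = "\<lambda>s. \<chi> j. if j = i then s else t $ j"
  have u: "t - axis i (t $ i - s) = ?u s" for s
    by (auto simp: vec_eq_iff axis_def)
  have tj: "0 < t $ j" "t $ j < T $ j" for j using t by (auto simp: mem_box_cart)
  have ub: "?u s \<in> box 0 T \<longleftrightarrow> 0 < s \<and> s < T $ i" for s
    using tj by (auto simp: mem_box_cart)
  have "kern T lborel (rl_weight T i a) (axis i) f t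
      = (\<integral>s. rl_weight T i a (t $ i - s) * ext T f (?u s) \<partial>lborel)"
    unfolding kern_def by (subst lborel_integral_real_affine[where c="-1" and t="t $ i"]) (simp_all add: u)
  also have "\<dots> = (\<integral>s. (1 / Gamma a) * (indicator {0<..<t $ i} s *\<^sub>R ((t $ i - s) powr (a - 1) * f (?u s))) \<partial>lborel)"
  proof (intro Bochner_Integration.integral_cong refl)
    fix s show "rl_weight T i a (t $ i - s) * ext T f (?u s)
      = (1 / Gamma a) * (indicator {0<..<t $ i} s *\<^sub>R ((t $ i - s) powr (a - 1) * f (?u s)))"
      using tj[of i] ub[of s] by (auto simp: rl_weight_def ext_def indicator_def)
  qed
  also have "\<dots> = RL_partial i a f t"
    using a by (simp add: RL_partial_def set_lebesgue_integral_def)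
  finally show ?thesis by simp
qed

lemma kern_cong_box:
  assumes "\<And>t. t \<in> box 0 T \<Longrightarrow> f t = g t"
  shows "kern T N w \<phi> f = kern T N w \<phi> g"
proof -
  have "ext T f = ext T g" using assms by (auto simp: ext_def indicator_def)
  then show ?thesis by (simp add: kern_def[abs_def])
qed

lemma RL_partial_cong_box:
  assumes "\<And>t. t \<in> box 0 T \<Longrightarrow> f t = g t" and t: "t \<in> box 0 T"
  shows "RL_partial i a f t = RL_partial i a g t"
proof (cases "a = 0")
  case False
  show ?thesis
    unfolding RL_partial_eq_kern[OF t False] by (rule fun_cong[OF kern_cong_box[OF assms(1)]])
qed (use assms in \<open>auto simp: RL_partial_def\<close>)

lemma L1_op_RL_partial:
  assumes "\<And>i. T $ i > 0" "a \<ge> 0"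
  shows "L1_op T (RL_partial i a)"
proof (cases "a = 0")
  case True
  then show ?thesis using L1_op_id by (simp add: RL_partial_def[abs_def])
next
  case False
  then have "L1_op T (kern T lborel (rl_weight T i a) (axis i))"
    using assms by (intro L1_op_kern causal_rl_weight) auto
  then show ?thesis
    by (rule L1_op_cong) (simp add: RL_partial_eq_kern[OF _ False])
qed

text \<open>Commutation is demanded only for order 1 in each variable: this is what the identity
  hypothesis and the index law give for \<open>J\<close>, and iterated integrals of the constant 1
  already span a dense subspace.\<close>

definition comm_op :: "real ^ 'n \<Rightarrow> ((real ^ 'n \<Rightarrow> real) \<Rightarrow> (real ^ 'n \<Rightarrow> real)) \<Rightarrow> bool" where
  "comm_op T A \<longleftrightarrow> L1_op T A \<and>
    (\<forall>j. \<forall>f\<in>L1 T. L1_eq T (A (RL_partial j 1 f)) (RL_partial j 1 (A f)))"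

lemma comm_op_op: "comm_op T A \<Longrightarrow> L1_op T A"
  by (simp add: comm_op_def)

lemma comm_op_kern:
  assumes T: "\<And>i. T $ i > 0" and K: "causal_kernel N w \<phi>"
  shows "comm_op T (kern T N w \<phi>)"
  unfolding comm_op_def
proof (intro conjI allI ballI)
  fix j f assume f: "f \<in> L1 T"
  let ?I = "kern T lborel (rl_weight T j 1) (axis j)"
  have I: "RL_partial j 1 g t = ?I g t" if "t \<in> box 0 T" for g t
    by (rule RL_partial_eq_kern[OF that]) simp
  have "kern T N w \<phi> (RL_partial j 1 f) = kern T N w \<phi> (?I f)"
    by (rule kern_cong_box) (rule I)
  then have "L1_eq T (kern T N w \<phi> (RL_partial j 1 f)) (kern T N w \<phi> (?I f))"
    by simp
  also have "L1_eq T \<dots> (?I (kern T N w \<phi> f))"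
    using kern_commute[OF K causal_rl_weight f] T by simp
  also have "L1_eq T \<dots> (RL_partial j 1 (kern T N w \<phi> f))"
    by (rule L1_eqI) (simp add: I)
  finally show "L1_eq T (kern T N w \<phi> (RL_partial j 1 f)) (RL_partial j 1 (kern T N w \<phi> f))" .
qed (rule L1_op_kern[OF K])

lemma comm_opD:
  "comm_op T A \<Longrightarrow> f \<in> L1 T \<Longrightarrow> L1_eq T (A (RL_partial j 1 f)) (RL_partial j 1 (A f))"
  by (simp add: comm_op_def)

lemma comm_op_compose:
  assumes T: "\<And>i. T $ i > 0" and A: "comm_op T A" and B: "comm_op T B"
  shows "comm_op T (\<lambda>f. A (B f))"
  unfolding comm_op_def
proof (intro conjI allI ballI)
  show "L1_op T (\<lambda>f. A (B f))"
    by (rule L1_op_compose[OF comm_op_op[OF A] comm_op_op[OF B]])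
  fix j f assume f: "f \<in> L1 T"
  have i: "RL_partial j 1 g \<in> L1 T" if "g \<in> L1 T" for g
    using L1_opD(1)[OF L1_op_RL_partial[OF T] that] by simp
  note Bf = L1_opD(1)[OF comm_op_op[OF B]]
  have "L1_eq T (A (B (RL_partial j 1 f))) (A (RL_partial j 1 (B f)))"
    by (rule L1_opD(2)[OF comm_op_op[OF A] Bf[OF i[OF f]] i[OF Bf[OF f]] comm_opD[OF B f]])
  also have "L1_eq T \<dots> (RL_partial j 1 (A (B f)))"
    by (rule comm_opD[OF A Bf[OF f]])
  finally show "L1_eq T (A (B (RL_partial j 1 f))) (RL_partial j 1 (A (B f)))" .
qed

lemma comm_op_id: "comm_op T (\<lambda>f. f)"
  by (simp add: comm_op_def L1_op_id)

lemma comm_op_RL_partial: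
  assumes T: "\<And>i. T $ i > 0" and "a \<ge> 0"
  shows "comm_op T (RL_partial i a)"
proof (cases "a = 0")
  case True
  then show ?thesis using comm_op_id by (simp add: RL_partial_def[abs_def])
next
  case False
  then have K: "comm_op T (kern T lborel (rl_weight T i a) (axis i))"
    using assms by (intro comm_op_kern causal_rl_weight) auto
  show ?thesis unfolding comm_op_def
  proof (intro conjI allI ballI)
    show "L1_op T (RL_partial i a)" using assms by (rule L1_op_RL_partial)
    fix j f assume f: "f \<in> L1 T"
    let ?K = "kern T lborel (rl_weight T i a) (axis i)"
    have e: "RL_partial i a g t = ?K g t" if "t \<in> box 0 T" for g t
      by (rule RL_partial_eq_kern[OF that False])
    have "L1_eq T (RL_partial i a (RL_partial j 1 f)) (?K (RL_partial j 1 f))"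
      by (rule L1_eqI) (rule e)
    also have "L1_eq T \<dots> (RL_partial j 1 (?K f))"
      by (rule comm_opD[OF K f])
    also have "L1_eq T \<dots> (RL_partial j 1 (RL_partial i a f))"
      by (rule L1_eqI, rule RL_partial_cong_box) (simp_all add: e)
    finally show "L1_eq T (RL_partial i a (RL_partial j 1 f)) (RL_partial j 1 (RL_partial i a f))" .
  qed
qed

lemma comm_op_RL:
  fixes T :: "real ^ 'n::{finite,linorder}"
  assumes T: "\<And>i. T $ i > 0" and a: "\<And>i. \<alpha> $ i \<ge> 0"
  shows "comm_op T (RL \<alpha>)"
proof -
  have "comm_op T (\<lambda>f. foldr (\<lambda>i. RL_partial i (\<alpha> $ i)) xs f)" for xs
  proof (induction xs)
    case Nil
    show ?case unfolding foldr.simps id_apply by (rule comm_op_id)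
  next
    case (Cons i xs)
    show ?case unfolding foldr.simps o_apply
      by (rule comm_op_compose[OF T comm_op_RL_partial[OF T a] Cons.IH])
  qed
  then show ?thesis by (simp add: RL_def[abs_def])
qed

section \<open>Power functions, the values of the Riemann-Liouville integrals at the constant
  1\<close>

definition pw :: "real ^ 'n \<Rightarrow> real ^ 'n \<Rightarrow> real" where
  "pw \<alpha> t = (\<Prod>i\<in>UNIV. t $ i powr (\<alpha> $ i) / Gamma (\<alpha> $ i + 1))"

lemma pw_0: "t \<in> box 0 T \<Longrightarrow> pw 0 t = 1"
  unfolding pw_def
proof (intro prod.neutral ballI)
  fix i assume "t \<in> box 0 T"
  then have "0 < t $ i" by (auto simp: mem_box_cart)
  then show "t $ i powr (0 $ i) / Gamma (0 $ i + 1) = 1" by simp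
qed

lemma set_integral_Beta:
  assumes a: "a > (0::real)" and b: "b > 0" and t: "t > 0"
  shows "(LBINT s:{0<..<t}. (t - s) powr (a - 1) * s powr (b - 1)) = t powr (a + b - 1) * Beta a b"
proof -
  have hi: "((\<lambda>u. u powr (b - 1) * (1 - u) powr (a - 1)) has_integral Beta b a) {0<..<1}"
    using has_integral_Beta_real[OF b a] by (simp add: has_integral_Icc_iff_Ioo)
  then have "(\<lambda>u. u powr (b - 1) * (1 - u) powr (a - 1)) absolutely_integrable_on {0<..<1}"
    by (intro nonnegative_absolutely_integrable_1) auto
  then have "set_integrable lborel {0<..<1} (\<lambda>u. u powr (b - 1) * (1 - u) powr (a - 1))"
    unfolding set_integrable_def by (subst (asm) integrable_completion) auto
  then have B: "(LBINT u:{0<..<1}. u powr (b - 1) * (1 - u) powr (a - 1)) = Beta b a"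
    using hi by (simp add: set_borel_integral_eq_integral(2) integral_unique)
  have "(LBINT s:{0<..<t}. (t - s) powr (a - 1) * s powr (b - 1))
      = t * (\<integral>u. indicator {0<..<t} (t * u) *\<^sub>R ((t - t * u) powr (a - 1) * (t * u) powr (b - 1)) \<partial>lborel)"
    unfolding set_lebesgue_integral_def
    using t by (subst lborel_integral_real_affine[where c=t and t=0]) auto
  also have "\<dots> = t * (\<integral>u. t powr (a + b - 2) * (indicator {0<..<1} u *\<^sub>R (u powr (b - 1) * (1 - u) powr (a - 1))) \<partial>lborel)"
  proof (intro arg_cong[where f="(*) t"] Bochner_Integration.integral_cong refl)
    fix u :: real
    show "indicator {0<..<t} (t * u) *\<^sub>R ((t - t * u) powr (a - 1) * (t * u) powr (b - 1))
      = t powr (a + b - 2) * (indicator {0<..<1} u *\<^sub>R (u powr (b - 1) * (1 - u) powr (a - 1)))"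
    proof (cases "u \<in> {0<..<1}")
      case True
      have "(t - t * u) powr (a - 1) = t powr (a - 1) * (1 - u) powr (a - 1)"
        using powr_mult[of t "1 - u" "a - 1"] t True by (simp add: right_diff_distrib)
      moreover have "(t * u) powr (b - 1) = t powr (b - 1) * u powr (b - 1)"
        using powr_mult[of t u "b - 1"] t True by simp
      moreover have "t powr (a - 1) * t powr (b - 1) = t powr (a + b - 2)"
        by (simp add: powr_add[symmetric])
      ultimately show ?thesis using True t by (simp add: algebra_simps)
    next
      case False
      then have "t * u \<notin> {0<..<t}" using t by (auto simp: zero_less_mult_iff)
      with False show ?thesis by simp
    qed
  qed
  also have "\<dots> = t * t powr (a + b - 2) * Beta b a"
    using B by (simp add: set_lebesgue_integral_def)
  also have "t * t powr (a + b - 2) = t powr (a + b - 1)"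
    using t powr_add[of t 1 "a + b - 2"] by simp
  finally show ?thesis by (simp add: Beta_commute)
qed

text \<open>Euler's Beta integral in the variable \<open>i\<close>; the factors of the other
  variables pass through as the constant \<open>R\<close>.\<close>

lemma RL_partial_pw:
  fixes \<alpha> :: "real ^ 'n"
  assumes t: "t \<in> box 0 T" and a: "a \<ge> 0" and \<alpha>: "\<alpha> $ i \<ge> 0"
  shows "RL_partial i a (pw \<alpha>) t = pw (\<alpha> + axis i a) t"
proof (cases "a = 0")
  case True
  have "axis i 0 = (0 :: real ^ 'n)" by (simp add: vec_eq_iff axis_def)
  then show ?thesis unfolding True by (simp only: RL_partial_def simp_thms if_True add_0_right)
next
  case False
  with a have a: "a > 0" by simp
  define R where "R = (\<Prod>j\<in>UNIV-{i}. t $ j powr (\<alpha> $ j) / Gamma (\<alpha> $ j + 1))"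
  let ?b = "\<alpha> $ i"
  have ti: "t $ i > 0" using t by (auto simp: mem_box_cart)
  have G: "Gamma (1 + ?b) \<noteq> 0" "Gamma a \<noteq> 0"
    by (rule less_imp_neq[THEN not_sym], rule Gamma_real_pos, use \<alpha> a in linarith)+
  have p1: "pw \<alpha> (\<chi> j. if j = i then s else t $ j) = s powr ?b / Gamma (?b + 1) * R" for s
    unfolding pw_def R_def by (subst prod.remove[of _ i]) (auto intro!: prod.cong)
  have p2: "pw (\<alpha> + axis i a) t = t $ i powr (?b + a) / Gamma (?b + a + 1) * R"
    unfolding pw_def R_def by (subst prod.remove[of _ i]) (auto intro!: prod.cong simp: axis_def)
  have "RL_partial i a (pw \<alpha>) t
    = 1 / Gamma a * (LBINT s:{0<..<t $ i}. (R / Gamma (?b + 1)) * ((t $ i - s) powr (a - 1) * s powr (?b + 1 - 1)))"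
    using a unfolding RL_partial_def by (simp add: p1 mult_ac)
  also have "\<dots> = 1 / Gamma a * ((R / Gamma (?b + 1)) * (t $ i powr (a + (?b + 1) - 1) * Beta a (?b + 1)))"
    using set_integral_Beta[OF a _ ti, of "?b + 1"] \<alpha> by simp
  also have "\<dots> = t $ i powr (?b + a) / Gamma (?b + a + 1) * R"
    using G by (simp add: Beta_def field_simps)
  finally show ?thesis by (simp add: p2)
qed

lemma foldr_RL_partial_pw:
  assumes "distinct xs" "\<And>i. \<alpha> $ i \<ge> 0" "\<And>i. \<beta> $ i \<ge> 0" and t: "t \<in> box 0 T"
  shows "foldr (\<lambda>i. RL_partial i (\<alpha> $ i)) xs (pw \<beta>) t = pw (\<beta> + (\<Sum>i\<in>set xs. axis i (\<alpha> $ i))) t"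
  using assms(1) t
proof (induction xs arbitrary: t)
  case (Cons i xs)
  let ?g = "\<beta> + (\<Sum>i\<in>set xs. axis i (\<alpha> $ i))"
  have "0 \<le> (\<Sum>j\<in>set xs. axis j (\<alpha> $ j) $ i)"
    using assms(2) by (intro sum_nonneg) (simp add: axis_def)
  then have g: "0 \<le> ?g $ i"
    using assms(3)[of i] by simp
  have "foldr (\<lambda>i. RL_partial i (\<alpha> $ i)) (i # xs) (pw \<beta>) t = RL_partial i (\<alpha> $ i) (pw ?g) t"
    unfolding foldr.simps o_apply
    by (rule RL_partial_cong_box[OF _ Cons.prems(2)], rule Cons.IH) (use Cons.prems(1) in simp_all)
  also have "\<dots> = pw (?g + axis i (\<alpha> $ i)) t"
    by (rule RL_partial_pw[OF Cons.prems(2) assms(2) g])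
  also have "?g + axis i (\<alpha> $ i) = \<beta> + (\<Sum>i\<in>set (i # xs). axis i (\<alpha> $ i))"
    using Cons.prems(1) by (simp add: add.commute add.left_commute)
  finally show ?case .
qed simp

lemma RL_pw:
  fixes \<alpha> \<beta> :: "real ^ 'n::{finite,linorder}"
  assumes "\<And>i. \<alpha> $ i \<ge> 0" "\<And>i. \<beta> $ i \<ge> 0" and t: "t \<in> box 0 T"
  shows "RL \<alpha> (pw \<beta>) t = pw (\<alpha> + \<beta>) t"
proof -
  have "(\<Sum>i\<in>UNIV. axis i (\<alpha> $ i)) = \<alpha>"
    by (simp add: vec_eq_iff axis_def)
  then show ?thesis
    using foldr_RL_partial_pw[of "sorted_list_of_set UNIV" \<alpha> \<beta> t T] assms
    by (simp add: RL_def add.commute)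
qed

lemma RL_cong_box:
  assumes "\<And>t. t \<in> box 0 T \<Longrightarrow> f t = g t" and "t \<in> box 0 T"
  shows "RL \<alpha> f t = RL \<alpha> g t"
proof -
  have "foldr (\<lambda>i. RL_partial i (\<alpha> $ i)) xs f t = foldr (\<lambda>i. RL_partial i (\<alpha> $ i)) xs g t" for xs
    using assms(2)
  proof (induction xs arbitrary: t)
    case (Cons i xs)
    show ?case unfolding foldr.simps o_apply
      by (rule RL_partial_cong_box[OF Cons.IH Cons.prems])
  qed (simp add: assms(1))
  then show ?thesis by (simp add: RL_def)
qed

lemma RL_one:
  fixes \<alpha> :: "real ^ 'n::{finite,linorder}"
  assumes "\<And>i. \<alpha> $ i \<ge> 0" and t: "t \<in> box 0 T"
  shows "RL \<alpha> (\<lambda>_. 1) t = pw \<alpha> t"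
proof -
  have "RL \<alpha> (\<lambda>_. 1) t = RL \<alpha> (pw 0) t"
    using pw_0 t by (intro RL_cong_box[of T]) auto
  then show ?thesis using RL_pw[OF assms(1) _ t, of 0] by simp
qed

section \<open>Density of the monomials and convolution on the box\<close>

lemma RL_partial_1_L1: "(\<And>i. T $ i > 0) \<Longrightarrow> f \<in> L1 T \<Longrightarrow> RL_partial j 1 f \<in> L1 T"
  by (rule L1_opD(1)[OF L1_op_RL_partial]) simp_all

text \<open>Ordinary powers instead of \<open>powr\<close>, because the density theorem asks for
  continuity on the whole space, while \<open>0 powr 0 = 0\<close>. On the box the two agree up to
  the Gamma factors.\<close>

definition natpw :: "('n::finite \<Rightarrow> nat) \<Rightarrow> real ^ 'n \<Rightarrow> real" where
  "natpw k t = (\<Prod>i\<in>UNIV. t $ i ^ k i)"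

text \<open>Iterated partial integrals of the constant 1 are the monomials up to a factor, and these
  form a multiplicative family that separates points, so \<open>L1_dense_span\<close>
  applies.\<close>

theorem L1_box_induct:
  fixes T :: "real ^ 'n"
  assumes T: "\<And>i. T $ i > 0"
    and one: "V (\<lambda>_. 1)"
    and I: "\<And>f j. f \<in> L1 T \<Longrightarrow> V f \<Longrightarrow> V (RL_partial j 1 f)"
    and lin: "\<And>f g a b. f \<in> L1 T \<Longrightarrow> g \<in> L1 T \<Longrightarrow> V f \<Longrightarrow> V g \<Longrightarrow> V (\<lambda>t. a * f t + b * g t)"
    and lim: "\<And>f s. f \<in> L1 T \<Longrightarrow> (\<And>i::nat. s i \<in> L1 T) \<Longrightarrow> (\<And>i. V (s i)) \<Longrightarrow>
        (\<lambda>i. L1_dist T (s i) f) \<longlonglongrightarrow> 0 \<Longrightarrow> V f"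
    and f: "f \<in> L1 T"
  shows "V f"
proof -
  \<comment> \<open>Lebesgue measure on the box as a measure on all Borel sets, which
    \<open>L1_dense_span\<close> requires; \<open>box_measure T\<close> lives on the restricted
    space.\<close>
  define M where "M = density lborel (\<lambda>t. ennreal (indicator (box 0 T) t))"
  have sM: "sets M = sets borel" by (simp add: M_def)
  have iM: "integrable M g \<longleftrightarrow> g \<in> borel_measurable borel \<and> g \<in> L1 T" for g :: "real ^ 'n \<Rightarrow> real"
  proof -
    have "integrable M g \<longleftrightarrow> g \<in> borel_measurable borel \<and> integrable M g"
      using borel_measurable_integrable[of M g] measurable_cong_sets[OF sM refl, of "borel :: real measure"] by auto
    moreover have "integrable M g \<longleftrightarrow> g \<in> L1 T" if "g \<in> borel_measurable borel"
      unfolding M_def L1_iff using that by (subst integrable_density) (auto simp: ext_def[abs_def])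
    ultimately show ?thesis by blast
  qed
  have intM: "(\<integral>t. \<bar>g t - h t\<bar> \<partial>M) = L1_dist T g h" if "integrable M g" "integrable M h" for g h
    unfolding M_def L1_dist_ext using that[unfolded iM]
    by (subst integral_density)
       (auto simp: ext_def right_diff_distrib[symmetric] abs_mult intro!: Bochner_Integration.integral_cong)
  \<comment> \<open>A constant sequence in \<open>lim\<close> makes \<open>V\<close> invariant under
    almost everywhere equality.\<close>
  have eq: "V h" if "g \<in> L1 T" "V g" "L1_eq T g h" "h \<in> L1 T" for g h
    using lim[of h "\<lambda>_. g"] that L1_dist_eq_0_iff[of g T h] by simp
  have pw: "pw (\<chi> i. real (k i)) \<in> L1 T \<and> V (pw (\<chi> i. real (k i)))" for k
  proof (induction "\<Sum>i\<in>UNIV. k i" arbitrary: k)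
    case 0
    have k: "(\<chi> i. real (k i)) = 0" using 0 by (simp add: vec_eq_iff)
    have "pw 0 \<in> L1 T" using L1_cong[of T "pw 0" "\<lambda>_. 1"] pw_0 by auto
    moreover have "L1_eq T (\<lambda>_. 1) (pw 0)" by (rule L1_eqI) (simp add: pw_0)
    ultimately show ?case unfolding k using eq[OF _ one] by auto
  next
    case (Suc n)
    then obtain j where j: "k j > 0" by (metis neq0_conv sum.neutral Zero_not_Suc)
    define l where "l = k(j := k j - 1)"
    have "(\<Sum>i\<in>UNIV. k i) = k j + (\<Sum>i\<in>UNIV-{j}. l i)" "(\<Sum>i\<in>UNIV. l i) = l j + (\<Sum>i\<in>UNIV-{j}. l i)"
      by (subst sum.remove[of _ j]; simp add: l_def)+
    then have "n = (\<Sum>i\<in>UNIV. l i)" using j Suc(2) by (simp add: l_def)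
    from Suc(1)[OF this] have l: "pw (\<chi> i. real (l i)) \<in> L1 T" "V (pw (\<chi> i. real (l i)))" by auto
    have kl: "(\<chi> i. real (l i)) + axis j 1 = (\<chi> i. real (k i))"
      using j by (auto simp: vec_eq_iff l_def axis_def)
    have e: "RL_partial j 1 (pw (\<chi> i. real (l i))) t = pw (\<chi> i. real (k i)) t" if "t \<in> box 0 T" for t
      using RL_partial_pw[OF that, of 1 "\<chi> i. real (l i)" j] kl by simp
    have "RL_partial j 1 (pw (\<chi> i. real (l i))) \<in> L1 T \<longleftrightarrow> pw (\<chi> i. real (k i)) \<in> L1 T"
      by (rule L1_cong) (rule e)
    then have "pw (\<chi> i. real (k i)) \<in> L1 T"
      using RL_partial_1_L1[OF T l(1), of j] by blast
    then show ?case
      using eq[OF RL_partial_1_L1[OF T l(1), of j] I[OF l] L1_eqI[OF e]] by blast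
  qed
  have npw: "natpw k \<in> L1 T \<and> V (\<lambda>t. c * natpw k t)" for k c
  proof -
    define d where "d = (\<Prod>i\<in>UNIV. Gamma (real (k i) + 1))"
    have G: "Gamma (real (k i) + 1) > 0" for i by (intro Gamma_real_pos) simp
    have dnz: "d \<noteq> 0" unfolding d_def using G by (simp add: less_imp_neq[THEN not_sym])
    have e: "pw (\<chi> i. real (k i)) t = natpw k t / d" if "t \<in> box 0 T" for t
    proof -
      have "t $ i > 0" for i using that by (auto simp: mem_box_cart)
      then show ?thesis
        unfolding pw_def natpw_def d_def prod_dividef[symmetric] by (intro prod.cong) (auto simp: powr_realpow)
    qed
    \<comment> \<open>The vanishing second summand casts a scalar multiple in the two-term form of
      \<open>lin\<close>.\<close>
    have e': "(c * d) * pw (\<chi> i. real (k i)) t + 0 * pw (\<chi> i. real (k i)) t = c * natpw k t"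
      if "t \<in> box 0 T" for t c using e[OF that] dnz by simp
    have i: "(\<lambda>t. (c * d) * pw (\<chi> i. real (k i)) t + 0 * pw (\<chi> i. real (k i)) t) \<in> L1 T" for c
      using pw by (intro L1_linear_comb) auto
    have V1: "V (\<lambda>t. (c * d) * pw (\<chi> i. real (k i)) t + 0 * pw (\<chi> i. real (k i)) t)"
      using pw by (intro lin) auto
    have i2: "(\<lambda>t. c * natpw k t) \<in> L1 T" for c
    proof -
      have "(\<lambda>t. (c * d) * pw (\<chi> i. real (k i)) t + 0 * pw (\<chi> i. real (k i)) t) \<in> L1 T
        \<longleftrightarrow> (\<lambda>t. c * natpw k t) \<in> L1 T"
        by (rule L1_cong) (rule e')
      then show ?thesis using i by blast
    qed
    show ?thesis using eq[OF i V1 L1_eqI[OF e'] i2] i2[of 1] by simp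
  qed
  define F where "F = range (natpw :: ('n \<Rightarrow> nat) \<Rightarrow> _)"
  have F_mult: "(\<lambda>x. f x * g x) \<in> F" if "f \<in> F" "g \<in> F" for f g
  proof -
    from that obtain k l where "f = natpw k" "g = natpw l" by (auto simp: F_def)
    then have "(\<lambda>x. f x * g x) = natpw (\<lambda>i. k i + l i)"
      by (auto simp: natpw_def power_add prod.distrib)
    then show ?thesis by (simp add: F_def)
  qed
  have fin: "finite_measure M"
  proof
    show "emeasure M (space M) \<noteq> \<infinity>"
      unfolding M_def by (subst emeasure_density) (auto simp: ennreal_indicator emeasure_lborel_box_eq)
  qed
  have "V (ext T f)"
  proof (rule L1_dense_span[OF fin sM compact_cbox[of 0 T], where F=F and V=V])
    show "AE x in M. x \<in> cbox 0 T"
      unfolding M_def by (subst AE_density) (auto simp: indicator_def intro!: AE_I2 dest: box_subset_cbox[THEN subsetD])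
    show "continuous_on UNIV g" if "g \<in> F" for g
      using that unfolding F_def natpw_def[abs_def] by (auto intro!: continuous_intros)
    show "(\<lambda>_. 1) \<in> F"
      unfolding F_def by (rule image_eqI[of _ _ "\<lambda>_. 0"]) (auto simp: natpw_def)
    show "\<exists>g\<in>F. g x \<noteq> g y" if "x \<noteq> y" for x y
    proof -
      from that obtain i where i: "x $ i \<noteq> y $ i" by (auto simp: vec_eq_iff)
      have "natpw (\<lambda>j. if j = i then 1 else 0) z = z $ i" for z
      proof -
        have "natpw (\<lambda>j. if j = i then 1 else 0) z = (\<Prod>j\<in>UNIV. if j = i then z $ j else 1)"
          unfolding natpw_def by (intro prod.cong) auto
        then show ?thesis by simp
      qed
      then show ?thesis using i by (intro bexI[of _ "natpw (\<lambda>j. if j = i then 1 else 0)"]) (auto simp: F_def)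
    qed
    show "V (\<lambda>x. c * g x)" if "g \<in> F" for g c using that npw by (auto simp: F_def)
    show "V (\<lambda>x. g x + h x)" if "integrable M g" "integrable M h" "V g" "V h" for g h
      using lin[of g h 1 1] that by (simp add: iM)
    show "V g" if "integrable M g" "\<And>i. integrable M (s i)" "\<And>i::nat. V (s i)"
      "(\<lambda>i. \<integral>x. \<bar>s i x - g x\<bar> \<partial>M) \<longlonglongrightarrow> 0" for g s
      using lim[of g s] that(4) unfolding intM[OF that(2,1)] using that by (simp add: iM)
    have "ext T (ext T f) = ext T f" by (auto simp: ext_def indicator_def)
    then show "integrable M (ext T f)"
      using f borel_measurable_integrable[of lborel "ext T f"] unfolding iM by (auto simp: L1_iff)
  qed (rule F_mult)
  moreover have "ext T f \<in> L1 T" using f L1_cong[of T f "ext T f"] by simp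
  ultimately show ?thesis
    using eq[of "ext T f" f] f L1_eqI[of T "ext T f" f] by simp
qed

text \<open>Agreement of \<open>A\<close> and \<open>B\<close> is inherited under integration
  because both commute with it, under combinations by linearity, and under L1 limits by continuity;
  \<open>L1_box_induct\<close> then spreads it from the constant 1. Nearly every operator identity
  below is reduced to its value at 1 in this way.\<close>

theorem comm_op_agree:
  assumes T: "\<And>i. T $ i > 0" and A: "comm_op T A" and B: "comm_op T B"
    and one: "L1_eq T (A (\<lambda>_. 1)) (B (\<lambda>_. 1))" and f: "f \<in> L1 T"
  shows "L1_eq T (A f) (B f)"
proof (rule L1_box_induct[OF T, where V="\<lambda>f. L1_eq T (A f) (B f)"])
  note a = L1_opD[OF comm_op_op[OF A]] and b = L1_opD[OF comm_op_op[OF B]]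
  show "L1_eq T (A (RL_partial j 1 f)) (B (RL_partial j 1 f))"
    if f: "f \<in> L1 T" and AB: "L1_eq T (A f) (B f)" for f j
  proof -
    have "L1_eq T (A (RL_partial j 1 f)) (RL_partial j 1 (A f))" by (rule comm_opD[OF A f])
    also have "L1_eq T \<dots> (RL_partial j 1 (B f))"
      by (rule L1_opD(2)[OF L1_op_RL_partial[OF T] a(1) b(1) AB]) (use f in simp_all)
    also have "L1_eq T \<dots> (B (RL_partial j 1 f))"
      by (rule L1_eq_sym[OF comm_opD[OF B f]])
    finally show ?thesis .
  qed
  show "L1_eq T (A (\<lambda>t. c * f t + d * g t)) (B (\<lambda>t. c * f t + d * g t))"
    if f: "f \<in> L1 T" "g \<in> L1 T" and AB: "L1_eq T (A f) (B f)" "L1_eq T (A g) (B g)" for f g c d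
  proof -
    have "L1_eq T (A (\<lambda>t. c * f t + d * g t)) (\<lambda>t. c * A f t + d * A g t)" by (rule a(3)[OF f])
    also have "L1_eq T \<dots> (\<lambda>t. c * B f t + d * B g t)"
      using AB unfolding L1_eq_iff by eventually_elim simp
    also have "L1_eq T \<dots> (B (\<lambda>t. c * f t + d * g t))" by (rule L1_eq_sym[OF b(3)[OF f]])
    finally show ?thesis .
  qed
  show "L1_eq T (A f) (B f)"
    if f: "f \<in> L1 T" and s: "\<And>i. s i \<in> L1 T" and AB: "\<And>i::nat. L1_eq T (A (s i)) (B (s i))"
      and lim: "(\<lambda>i. L1_dist T (s i) f) \<longlonglongrightarrow> 0" for f s
  proof (rule L1_limit_unique[where s="\<lambda>i. A (s i)"])
    show "(\<lambda>i. L1_dist T (A (s i)) (A f)) \<longlonglongrightarrow> 0"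
      by (rule L1_op_tendsto[OF comm_op_op[OF A] f s lim])
    have "L1_dist T (A (s i)) (B f) = L1_dist T (B (s i)) (B f)" for i
      by (rule L1_dist_cong[OF AB L1_eq_refl]) (intro a(1) b(1) f s)+
    then show "(\<lambda>i. L1_dist T (A (s i)) (B f)) \<longlonglongrightarrow> 0"
      using L1_op_tendsto[OF comm_op_op[OF B] f s lim] by simp
  qed (intro a(1) b(1) f s)+
qed (use one f in auto)

text \<open>Both sides commute with integration, and at the constant 1 the law is the addition of
  exponents in \<open>RL_pw\<close>.\<close>

lemma RL_add:
  fixes T :: "real ^ 'n::{finite,linorder}"
  assumes T: "\<And>i. T $ i > 0" and \<alpha>: "\<And>i. \<alpha> $ i \<ge> 0" and \<beta>: "\<And>i. \<beta> $ i \<ge> 0" and f: "f \<in> L1 T"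
  shows "L1_eq T (RL (\<alpha> + \<beta>) f) (RL \<alpha> (RL \<beta> f))"
proof (rule comm_op_agree[OF T _ _ _ f])
  show "comm_op T (\<lambda>f. RL \<alpha> (RL \<beta> f))"
    by (rule comm_op_compose[OF T comm_op_RL[OF T \<alpha>] comm_op_RL[OF T \<beta>]])
  show "comm_op T (RL (\<alpha> + \<beta>))" using \<alpha> \<beta> by (intro comm_op_RL[OF T]) simp
  show "L1_eq T (RL (\<alpha> + \<beta>) (\<lambda>_. 1)) (RL \<alpha> (RL \<beta> (\<lambda>_. 1)))"
  proof (rule L1_eqI)
    fix t assume t: "t \<in> box 0 T"
    have "RL \<alpha> (RL \<beta> (\<lambda>_. 1)) t = RL \<alpha> (pw \<beta>) t"
      by (rule RL_cong_box[OF RL_one[OF \<beta>] t])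
    also have "\<dots> = RL (\<alpha> + \<beta>) (\<lambda>_. 1) t"
      using RL_pw[OF \<alpha> \<beta> t] RL_one[OF _ t, of "\<alpha> + \<beta>"] \<alpha> \<beta> by simp
    finally show "RL (\<alpha> + \<beta>) (\<lambda>_. 1) t = RL \<alpha> (RL \<beta> (\<lambda>_. 1)) t" by simp
  qed
qed

section \<open>Convolution of functions on the box\<close>

definition conv :: "real ^ 'n \<Rightarrow> (real ^ 'n \<Rightarrow> real) \<Rightarrow> (real ^ 'n \<Rightarrow> real) \<Rightarrow> real ^ 'n \<Rightarrow> real" where
  "conv T f g t = (\<integral>v. ext T f v * ext T g (t - v) \<partial>lborel)"

lemma conv_eq_kern: "conv T f = kern T lborel (ext T f) (\<lambda>v. v)"
  by (simp add: fun_eq_iff conv_def kern_def)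

lemma causal_conv: "f \<in> L1 T \<Longrightarrow> causal_kernel lborel (ext T f) (\<lambda>v. v)"
  unfolding causal_kernel_def
proof (intro conjI allI impI)
  fix v i assume "ext T f v \<noteq> 0"
  then have "v \<in> box 0 T" by (metis ext_out)
  then show "0 \<le> v $ i" by (auto simp: mem_box_cart less_imp_le)
qed (auto simp: L1_iff sigma_finite_lborel)

lemma comm_op_conv: "(\<And>i. T $ i > 0) \<Longrightarrow> f \<in> L1 T \<Longrightarrow> comm_op T (conv T f)"
  unfolding conv_eq_kern by (intro comm_op_kern causal_conv)

lemma lborel_integral_reflect:
  fixes F :: "'a::euclidean_space \<Rightarrow> real"
  assumes "F \<in> borel_measurable borel"
  shows "(\<integral>v. F (t - v) \<partial>lborel) = (\<integral>v. F v \<partial>lborel)"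
proof -
  have "distr lborel borel (\<lambda>v::'a. t - v) = lborel"
    using lborel_affine[of "-1" t] by (simp add: density_1 one_ennreal_def[symmetric])
  then have "(\<integral>v. F v \<partial>lborel) = (\<integral>v. F v \<partial>distr lborel borel (\<lambda>v::'a. t - v))" by simp
  also have "\<dots> = (\<integral>v. F (t - v) \<partial>lborel)" using assms by (intro integral_distr) auto
  finally show ?thesis ..
qed

text \<open>The reflection v -> t - v preserves Lebesgue measure. The equality holds at every point,
  so it can be used for rewriting.\<close>

lemma conv_commute:
  assumes "f \<in> L1 T" "g \<in> L1 T"
  shows "conv T f g = conv T g f"
proof
  fix t
  have [measurable]: "ext T f \<in> borel_measurable borel" "ext T g \<in> borel_measurable borel"
    using assms by (auto simp: L1_iff)
  have "conv T g f t = (\<integral>v. ext T g (t - v) * ext T f (t - (t - v)) \<partial>lborel)"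
    unfolding conv_def by (rule lborel_integral_reflect[symmetric]) measurable
  then show "conv T f g t = conv T g f t"
    by (simp add: conv_def mult.commute)
qed

lemma conv_L1: "(\<And>i. T $ i > 0) \<Longrightarrow> f \<in> L1 T \<Longrightarrow> g \<in> L1 T \<Longrightarrow> conv T f g \<in> L1 T"
  by (rule L1_opD(1)[OF comm_op_op[OF comm_op_conv]])

lemma conv_cong:
  assumes T: "\<And>i. T $ i > 0"
    and f: "f \<in> L1 T" "f' \<in> L1 T" "L1_eq T f f'" and g: "g \<in> L1 T" "g' \<in> L1 T" "L1_eq T g g'"
  shows "L1_eq T (conv T f g) (conv T f' g')"
proof -
  note c = L1_opD(2)[OF comm_op_op[OF comm_op_conv[OF T]]]
  have "L1_eq T (conv T f g) (conv T f g')" by (rule c[OF f(1) g])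
  also have "L1_eq T \<dots> (conv T f' g')"
    unfolding conv_commute[OF f(1) g(2)] conv_commute[OF f(2) g(2)] by (rule c[OF g(2) f])
  finally show ?thesis .
qed

lemma conv_cong1:
  "\<lbrakk>\<And>i. T $ i > 0; f \<in> L1 T; f' \<in> L1 T; L1_eq T f f'; g \<in> L1 T\<rbrakk> \<Longrightarrow> L1_eq T (conv T f g) (conv T f' g)"
  by (rule conv_cong) auto

lemma conv_cong2:
  "\<lbrakk>\<And>i. T $ i > 0; f \<in> L1 T; g \<in> L1 T; g' \<in> L1 T; L1_eq T g g'\<rbrakk> \<Longrightarrow> L1_eq T (conv T f g) (conv T f g')"
  by (rule conv_cong) auto

lemma conv_dist_le:
  assumes "f \<in> L1 T" "g \<in> L1 T" "h \<in> L1 T"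
  shows "L1_dist T (conv T f g) (conv T f h) \<le> (\<integral>t. \<bar>ext T f t\<bar> \<partial>lborel) * L1_dist T g h"
  unfolding conv_eq_kern by (rule kern_dist_le[OF causal_conv]) fact+

lemma conv_one_one:
  fixes T :: "real ^ 'n"
  assumes t: "t \<in> box 0 T"
  shows "conv T (\<lambda>_. 1) (\<lambda>_. 1) t = pw (\<chi> i. 1) t"
proof -
  have t0: "t $ i > 0" "t $ i < T $ i" for i using t by (auto simp: mem_box_cart)
  have "conv T (\<lambda>_. 1) (\<lambda>_. 1) t = (\<integral>v. indicator (box 0 t) v \<partial>lborel)"
    unfolding conv_def
  proof (intro Bochner_Integration.integral_cong refl)
    fix v
    have "(v \<in> box 0 T \<and> t - v \<in> box 0 T) \<longleftrightarrow> v \<in> box 0 t"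
      using t0 by (auto simp: mem_box_cart) (metis less_trans, smt (verit))
    then show "ext T (\<lambda>_. 1) v * ext T (\<lambda>_. 1) (t - v) = indicator (box 0 t) v"
      by (auto simp: ext_def indicator_def)
  qed
  also have "\<dots> = measure lborel (box 0 t)" by simp
  also have "\<dots> = (\<Prod>i\<in>UNIV. t $ i)"
    using t0 content_cbox_cart[of 0 t] by (simp add: measure_lborel_box_eq measure_lborel_cbox_eq interval_ne_empty_cart less_imp_le cong: prod.cong)
  also have "\<dots> = pw (\<chi> i. 1) t"
    using t0 by (simp add: pw_def Gamma_numeral abs_of_pos cong: prod.cong_simp)
  finally show ?thesis .
qed

text \<open>Both operators commute with integration, so they need comparing only at 1, where each
  gives the volume of the box between 0 and \<open>t\<close>.\<close>

lemma conv_one: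
  fixes T :: "real ^ 'n::{finite,linorder}"
  assumes T: "\<And>i. T $ i > 0" and f: "f \<in> L1 T"
  shows "L1_eq T (conv T (\<lambda>_. 1) f) (RL (\<chi> i. 1) f)"
proof (rule comm_op_agree[OF T comm_op_conv[OF T L1_const] comm_op_RL[OF T] _ f])
  show "L1_eq T (conv T (\<lambda>_. 1) (\<lambda>_. 1)) (RL (\<chi> i. 1) (\<lambda>_. 1))"
    by (rule L1_eqI) (simp add: conv_one_one RL_one)
qed simp

lemma comm_op_RL_ones:
  fixes T :: "real ^ 'n::{finite,linorder}"
  assumes T: "\<And>i. T $ i > 0" and A: "comm_op T A" and f: "f \<in> L1 T"
  shows "L1_eq T (A (RL (\<chi> i. 1) f)) (RL (\<chi> i. 1) (A f))"
proof -
  let ?I = "\<lambda>xs. foldr (\<lambda>i. RL_partial i (1::real)) (xs :: 'n list)"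
  note a = L1_opD[OF comm_op_op[OF A]]
  have I: "?I xs g \<in> L1 T" if "g \<in> L1 T" for xs g
    using that by (induction xs) (simp_all add: RL_partial_1_L1[OF T])
  have "L1_eq T (A (?I xs f)) (?I xs (A f))" for xs
  proof (induction xs)
    case (Cons i xs)
    have "L1_eq T (A (RL_partial i 1 (?I xs f))) (RL_partial i 1 (A (?I xs f)))"
      by (rule comm_opD[OF A I[OF f]])
    also have "L1_eq T \<dots> (RL_partial i 1 (?I xs (A f)))"
      by (rule L1_opD(2)[OF L1_op_RL_partial[OF T] _ _ Cons.IH]) (simp_all add: a(1) I f)
    finally show ?case by simp
  qed simp
  then show ?thesis by (simp add: RL_def)
qed

text \<open>Determination by the value at 1 is used twice. Convolution with 1 is integration of
  order 1 in every variable, so \<open>A\<close> commutes with it; this gives the claim for the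
  second factor 1 and any first factor, after exchanging factors. For a fixed first factor both
  sides are then operators in \<open>g\<close> that agree at 1.\<close>

theorem comm_op_conv_eq:
  fixes T :: "real ^ 'n::{finite,linorder}"
  assumes T: "\<And>i. T $ i > 0" and A: "comm_op T A" and f: "f \<in> L1 T" and g: "g \<in> L1 T"
  shows "L1_eq T (A (conv T f g)) (conv T (A f) g)"
proof -
  note a = L1_opD[OF comm_op_op[OF A]]
  note C = comm_op_compose[OF T]
  let ?i = "\<lambda>_ :: real ^ 'n::_. 1 :: real"
  note L = L1_const[of 1 T]
  have R: "RL (\<chi> i. 1) f \<in> L1 T" if "f \<in> L1 T" for f
    by (rule L1_opD(1)[OF comm_op_op[OF comm_op_RL[OF T]] that]) simp
  have 1: "L1_eq T (A (conv T ?i ?i)) (conv T ?i (A ?i))"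
  proof -
    have "L1_eq T (A (conv T ?i ?i)) (A (RL (\<chi> i. 1) ?i))"
      by (rule a(2)[OF conv_L1[OF T L L] R[OF L] conv_one[OF T L]])
    also have "L1_eq T \<dots> (RL (\<chi> i. 1) (A ?i))" by (rule comm_op_RL_ones[OF T A L])
    also have "L1_eq T \<dots> (conv T ?i (A ?i))" by (rule L1_eq_sym[OF conv_one[OF T a(1)[OF L]]])
    finally show ?thesis .
  qed
  have 2: "L1_eq T (A (conv T ?i h)) (conv T ?i (A h))" if "h \<in> L1 T" for h
    by (rule comm_op_agree[OF T C[OF A comm_op_conv[OF T L]] C[OF comm_op_conv[OF T L] A] 1 that])
  have 3: "L1_eq T (A (conv T h ?i)) (conv T (A h) ?i)" if "h \<in> L1 T" for h
    unfolding conv_commute[OF that L] conv_commute[OF a(1)[OF that] L] by (rule 2[OF that])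
  show ?thesis
    by (rule comm_op_agree[OF T C[OF A comm_op_conv[OF T f]] comm_op_conv[OF T a(1)[OF f]] 3[OF f] g])
qed

lemma comm_op_conv_eq2:
  fixes T :: "real ^ 'n::{finite,linorder}"
  assumes T: "\<And>i. T $ i > 0" and A: "comm_op T A" and f: "f \<in> L1 T" and g: "g \<in> L1 T"
  shows "L1_eq T (A (conv T f g)) (conv T f (A g))"
  unfolding conv_commute[OF f g] conv_commute[OF f L1_opD(1)[OF comm_op_op[OF A] g]]
  by (rule comm_op_conv_eq[OF T A g f])

section \<open>Exponentially small Laplace transforms\<close>

text \<open>Decay is recorded at all rates strictly below \<open>r\<close> rather than at
  \<open>r\<close> itself, so that the property survives division by a function that decays slower
  than every exponential.\<close>

definition exp_small :: "real \<Rightarrow> (real \<Rightarrow> real) \<Rightarrow> bool" where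
  "exp_small r F \<longleftrightarrow> (\<forall>y<r. ((\<lambda>s. exp (y * s) * F s) \<longlongrightarrow> 0) at_top)"

definition subexp_below :: "(real \<Rightarrow> real) \<Rightarrow> bool" where
  "subexp_below H \<longleftrightarrow> (\<forall>e>0. \<exists>c>0. \<forall>\<^sub>F s in at_top. c * exp (- (e * s)) \<le> H s)"

lemma exp_small_mono:
  assumes "exp_small r F" "\<forall>\<^sub>F s in at_top. \<bar>G s\<bar> \<le> \<bar>F s\<bar>"
  shows "exp_small r G"
  unfolding exp_small_def
proof (intro allI impI)
  fix y assume "y < r"
  then have F: "((\<lambda>s. exp (y * s) * F s) \<longlongrightarrow> 0) at_top" using assms(1) by (simp add: exp_small_def)
  show "((\<lambda>s. exp (y * s) * G s) \<longlongrightarrow> 0) at_top"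
    by (rule Lim_null_comparison[OF _ tendsto_rabs_zero[OF F]])
       (use assms(2) in \<open>auto simp: abs_mult elim: eventually_mono\<close>)
qed

lemma exp_small_bound:
  assumes "\<forall>\<^sub>F s in at_top. \<bar>F s\<bar> \<le> C * exp (- (r * s))"
  shows "exp_small r F"
proof -
  have "exp_small r (\<lambda>s. C * exp (- (r * s)))"
    unfolding exp_small_def
  proof (intro allI impI)
    fix y assume "y < r"
    then have "((\<lambda>s. C * exp ((y - r) * s)) \<longlongrightarrow> C * 0) at_top"
      by (intro tendsto_mult tendsto_const filterlim_compose[OF exp_at_bot]
            filterlim_tendsto_neg_mult_at_bot[OF tendsto_const]) (auto simp: filterlim_ident)
    then show "((\<lambda>s. exp (y * s) * (C * exp (- (r * s)))) \<longlongrightarrow> 0) at_top"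
      by (simp add: left_diff_distrib exp_diff exp_minus field_simps)
  qed
  then show ?thesis
    by (rule exp_small_mono) (use assms in \<open>auto elim: eventually_mono\<close>)
qed

lemma exp_small_add: "exp_small r F \<Longrightarrow> exp_small r G \<Longrightarrow> exp_small r (\<lambda>s. F s + G s)"
  unfolding exp_small_def by (auto simp: distrib_left intro!: tendsto_add_zero)

lemma exp_small_uminus: "exp_small r F \<Longrightarrow> exp_small r (\<lambda>s. - F s)"
  by (erule exp_small_mono) auto

lemma exp_small_diff: "exp_small r F \<Longrightarrow> exp_small r G \<Longrightarrow> exp_small r (\<lambda>s. F s - G s)"
  using exp_small_add[OF _ exp_small_uminus, of r F G] by simp

lemma exp_small_divide:
  assumes FH: "exp_small r (\<lambda>s. F s * H s)" and H: "subexp_below H"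
  shows "exp_small r F"
  unfolding exp_small_def
proof (intro allI impI)
  fix y assume "y < r"
  \<comment> \<open>Half of the gap between \<open>y\<close> and \<open>r\<close> pays for the
    division, the other half keeps \<open>y + e\<close> below \<open>r\<close>.\<close>
  define e where "e = (r - y) / 2"
  have e: "e > 0" "y + e < r" using \<open>y < r\<close> by (auto simp: e_def field_simps)
  then obtain c where c: "c > 0" "\<forall>\<^sub>F s in at_top. c * exp (- (e * s)) \<le> H s"
    using H by (auto simp: subexp_below_def)
  have lim: "((\<lambda>s. (exp ((y + e) * s) * (F s * H s)) / c) \<longlongrightarrow> 0) at_top"
    using FH e(2) by (auto simp: exp_small_def intro!: tendsto_divide_zero)
  show "((\<lambda>s. exp (y * s) * F s) \<longlongrightarrow> 0) at_top"
  proof (rule Lim_null_comparison[OF _ tendsto_rabs_zero[OF lim]])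
    show "\<forall>\<^sub>F s in at_top. norm (exp (y * s) * F s) \<le> \<bar>exp ((y + e) * s) * (F s * H s) / c\<bar>"
      using c(2)
    proof eventually_elim
      case (elim s)
      have "0 < c * exp (- (e * s))" using c(1) by simp
      then have "0 < H s" using elim by linarith
      have "1 \<le> exp (e * s) * H s / c"
        using elim c(1) by (simp add: exp_minus field_simps)
      then have "exp (y * s) * \<bar>F s\<bar> * 1 \<le> exp (y * s) * \<bar>F s\<bar> * (exp (e * s) * H s / c)"
        by (intro mult_left_mono) auto
      also have "\<dots> = \<bar>exp ((y + e) * s) * (F s * H s) / c\<bar>"
        using \<open>0 < H s\<close> c(1) by (simp add: abs_mult distrib_right exp_add)
      finally show ?case by (simp add: abs_mult)
    qed
  qed
qed

text \<open>However small \<open>e\<close> is, the part of the mass where \<open>x t < e\<close>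
  alone contributes a positive constant times \<open>exp (- (e * s))\<close>, and nothing cancels it
  because \<open>w\<close> is nonnegative.\<close>

lemma subexp_below_laplace:
  fixes w x :: "'a \<Rightarrow> real"
  assumes w: "integrable M w" "\<And>t. 0 \<le> w t" and x [measurable]: "x \<in> borel_measurable M"
    and x0: "\<And>t. w t \<noteq> 0 \<Longrightarrow> 0 \<le> x t"
    and pos: "\<And>e. e > 0 \<Longrightarrow> 0 < (\<integral>t. w t * indicator {t. x t < e} t \<partial>M)"
  shows "subexp_below (\<lambda>s. \<integral>t. w t * exp (- (s * x t)) \<partial>M)"
  unfolding subexp_below_def
proof (intro allI impI)
  fix e :: real assume "e > 0"
  define c where "c = (\<integral>t. w t * indicator {t. x t < e} t \<partial>M)"
  have [measurable]: "w \<in> borel_measurable M" using w by auto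
  have "c * exp (- (e * s)) \<le> (\<integral>t. w t * exp (- (s * x t)) \<partial>M)" if "s \<ge> 0" for s
  proof -
    have "c * exp (- (e * s)) = (\<integral>t. w t * indicator {t. x t < e} t * exp (- (e * s)) \<partial>M)"
      by (simp add: c_def)
    also have "\<dots> \<le> (\<integral>t. w t * exp (- (s * x t)) \<partial>M)"
    proof (rule integral_mono)
      have "integrable M (\<lambda>t. w t * indicator {t. x t < e} t)"
        by (rule Bochner_Integration.integrable_bound[OF w(1)]) (auto simp: indicator_def)
      then show "integrable M (\<lambda>t. w t * indicator {t. x t < e} t * exp (- (e * s)))" by simp
      show "integrable M (\<lambda>t. w t * exp (- (s * x t)))"
      proof (rule Bochner_Integration.integrable_bound[OF w(1)])
        show "AE t in M. norm (w t * exp (- (s * x t))) \<le> norm (w t)"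
        proof (rule AE_I2)
          fix t
          show "norm (w t * exp (- (s * x t))) \<le> norm (w t)"
          proof (cases "w t = 0")
            case False
            then have "exp (- (s * x t)) \<le> 1" using x0 that by simp
            then show ?thesis by (simp add: abs_mult mult_left_le)
          qed simp
        qed
      qed measurable
      fix t
      show "w t * indicator {t. x t < e} t * exp (- (e * s)) \<le> w t * exp (- (s * x t))"
      proof (cases "x t < e")
        case True
        then have "s * x t \<le> e * s" using that by (simp add: mult.commute[of e] mult_left_mono)
        with True w(2)[of t] show ?thesis by (auto intro: mult_left_mono)
      qed (use w(2)[of t] in auto)
    qed
    finally show ?thesis .
  qed
  then have "\<forall>\<^sub>F s in at_top. c * exp (- (e * s)) \<le> (\<integral>t. w t * exp (- (s * x t)) \<partial>M)"
    by (intro eventually_at_top_linorderI[of 0]) auto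
  then show "\<exists>c>0. \<forall>\<^sub>F s in at_top. c * exp (- (e * s)) \<le> (\<integral>t. w t * exp (- (s * x t)) \<partial>M)"
    using pos[OF \<open>e > 0\<close>] c_def by blast
qed

text \<open>Termwise integration of the exponential series. It is dominated because
  \<open>x \<ge> 0\<close> on the support of \<open>w\<close> bounds
  \<open>exp (s * (y - x t))\<close> by \<open>exp (s * y)\<close>. The index starts at
  \<open>Suc k\<close> because the constant term cancels against the 1.\<close>

lemma laplace_exp_series:
  fixes w x :: "'a \<Rightarrow> real"
  assumes w: "integrable M w" and x [measurable]: "x \<in> borel_measurable M"
    and x0: "\<And>t. w t \<noteq> 0 \<Longrightarrow> 0 \<le> x t" and s: "s \<ge> 0"
  shows "(\<lambda>k. - ((-1) ^ Suc k * exp (real (Suc k) * s * y) / fact (Suc k)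
            * (\<integral>t. w t * exp (- (real (Suc k) * s * x t)) \<partial>M)))
         sums (\<integral>t. w t * (1 - exp (- exp (s * (y - x t)))) \<partial>M)"
proof -
  define E where "E = exp (s * y)"
  define g where "g k t = - (w t * ((- exp (s * (y - x t))) ^ Suc k / fact (Suc k)))" for k t
  have [measurable]: "w \<in> borel_measurable M" using w by auto
  have g_le: "norm (g k t) \<le> \<bar>w t\<bar> * (E ^ Suc k / fact (Suc k))" for k t
  proof (cases "w t = 0")
    case False
    then have "exp (s * (y - x t)) \<le> E" using x0 s by (simp add: E_def mult_left_mono)
    then have "exp (s * (y - x t)) ^ Suc k \<le> E ^ Suc k" by (intro power_mono) auto
    then have "\<bar>w t\<bar> * (exp (s * (y - x t)) ^ Suc k / fact (Suc k)) \<le> \<bar>w t\<bar> * (E ^ Suc k / fact (Suc k))"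
      by (intro mult_left_mono divide_right_mono) auto
    then show ?thesis by (simp add: g_def abs_mult power_abs del: power_Suc fact_Suc)
  qed (simp add: g_def)
  have g_int: "integrable M (g k)" for k
  proof (rule Bochner_Integration.integrable_bound)
    show "integrable M (\<lambda>t. \<bar>w t\<bar> * (E ^ Suc k / fact (Suc k)))" using w by (intro integrable_mult_left) auto
    show "AE t in M. norm (g k t) \<le> norm (\<bar>w t\<bar> * (E ^ Suc k / fact (Suc k)))"
      by (intro AE_I2 order_trans[OF g_le]) (metis abs_ge_self real_norm_def)
  qed (unfold g_def[abs_def], measurable)
  have E_sum: "summable (\<lambda>k. E ^ Suc k / fact (Suc k))"
    using summable_exp[of E] by (subst summable_Suc_iff) (simp add: field_simps)
  have g_sums: "(\<lambda>k. g k t) sums (w t * (1 - exp (- exp (s * (y - x t)))))" for t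
  proof -
    let ?u = "- exp (s * (y - x t))"
    have "(\<lambda>k. ?u ^ k / fact k) sums exp ?u"
      using exp_converges[of ?u] by (simp add: field_simps)
    then have "(\<lambda>k. ?u ^ Suc k / fact (Suc k)) sums (exp ?u - 1)"
      by (subst sums_Suc_iff) simp
    then have "(\<lambda>k. - (w t * (?u ^ Suc k / fact (Suc k)))) sums (- (w t * (exp ?u - 1)))"
      by (intro sums_minus sums_mult)
    then show ?thesis by (simp add: g_def algebra_simps del: power_Suc fact_Suc)
  qed
  have "(\<lambda>k. integral\<^sup>L M (g k)) sums (\<integral>t. (\<Sum>k. g k t) \<partial>M)"
  proof (rule sums_integral[OF g_int])
    show "AE t in M. summable (\<lambda>k. norm (g k t))"
    proof (rule AE_I2)
      fix t
      show "summable (\<lambda>k. norm (g k t))"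
        by (rule summable_comparison_test'[OF summable_mult[OF E_sum, of "\<bar>w t\<bar>"], of 0])
           (simp only: real_norm_def abs_idempotent g_le[unfolded real_norm_def] g_le)
    qed
    show "summable (\<lambda>k. \<integral>t. norm (g k t) \<partial>M)"
    proof (rule summable_comparison_test'[OF summable_mult[OF E_sum], of 0])
      fix k :: nat
      have "(\<integral>t. norm (g k t) \<partial>M) \<le> (\<integral>t. \<bar>w t\<bar> * (E ^ Suc k / fact (Suc k)) \<partial>M)"
        using g_le g_int w by (intro integral_mono) auto
      then show "norm (\<integral>t. norm (g k t) \<partial>M) \<le> (\<integral>t. \<bar>w t\<bar> \<partial>M) * (E ^ Suc k / fact (Suc k))"
        by simp
    qed
  qed
  moreover have "integral\<^sup>L M (g k) = - ((-1) ^ Suc k * exp (real (Suc k) * s * y) / fact (Suc k)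
            * (\<integral>t. w t * exp (- (real (Suc k) * s * x t)) \<partial>M))" for k
  proof -
    have "g k t = - ((-1) ^ Suc k * exp (real (Suc k) * s * y) / fact (Suc k))
        * (w t * exp (- (real (Suc k) * s * x t)))" for t
    proof -
      have "(- exp (s * (y - x t))) ^ Suc k = (-1) ^ Suc k * exp (real (Suc k) * (s * (y - x t)))"
        by (subst power_minus) (simp only: exp_of_nat_mult)
      also have "exp (real (Suc k) * (s * (y - x t))) = exp (real (Suc k) * s * y) * exp (- (real (Suc k) * s * x t))"
        by (simp add: exp_add[symmetric] algebra_simps)
      finally show ?thesis by (simp add: g_def del: power_Suc fact_Suc of_nat_Suc)
    qed
    then have "integral\<^sup>L M (g k) = (\<integral>t. - ((-1) ^ Suc k * exp (real (Suc k) * s * y) / fact (Suc k))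
        * (w t * exp (- (real (Suc k) * s * x t))) \<partial>M)" by presburger
    then show ?thesis by (simp del: power_Suc fact_Suc of_nat_Suc)
  qed
  ultimately show ?thesis using g_sums by (simp add: sums_iff del: power_Suc fact_Suc of_nat_Suc)
qed

text \<open>
  Phragmen's device: \<open>1 - exp (- exp (s (y - x)))\<close> tends to the indicator of \<open>x < y\<close> as \<open>s\<close> grows, and
  its exponential series only involves the Laplace transform at multiples of \<open>s\<close>.
\<close>

theorem laplace_exp_small_imp_zero:
  fixes w x :: "'a \<Rightarrow> real"
  assumes w: "integrable M w" and x [measurable]: "x \<in> borel_measurable M"
    and x0: "\<And>t. w t \<noteq> 0 \<Longrightarrow> 0 \<le> x t"
    and small: "exp_small r (\<lambda>s. \<integral>t. w t * exp (- (s * x t)) \<partial>M)"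
  shows "(\<integral>t. w t * indicator {t. x t < r} t \<partial>M) = 0"
proof -
  define L where "L s = (\<integral>t. w t * exp (- (s * x t)) \<partial>M)" for s
  define I where "I y s = (\<integral>t. w t * (1 - exp (- exp (s * (y - x t)))) \<partial>M)" for y s
  \<comment> \<open>The pointwise limit of the device. On the level set \<open>x t = y\<close> the
    inner exponential is constantly 1, which leaves the value \<open>1 - exp (-1)\<close>.\<close>
  define c where "c y t = (if x t < y then 1 else if x t = y then 1 - exp (-1) else (0::real))" for y t
  have [measurable]: "w \<in> borel_measurable M" using w by auto
  have I0: "(\<lambda>n. I y (real n)) \<longlonglongrightarrow> 0" if "y < r" for y
  proof -
    define z where "z = (y + r) / 2"
    have z: "y < z" "z < r" using that by (auto simp: z_def field_simps)
    have "((\<lambda>s. exp (z * s) * L s) \<longlongrightarrow> 0) at_top" using small z(2) by (simp add: exp_small_def L_def[abs_def])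
    from tendstoD[OF this, of 1] have "\<forall>\<^sub>F s in at_top. \<bar>exp (z * s) * L s\<bar> < 1" by simp
    then obtain s0 where s0: "\<And>s. s \<ge> s0 \<Longrightarrow> \<bar>exp (z * s) * L s\<bar> < 1"
      by (auto simp: eventually_at_top_linorder)
    have L_le: "\<bar>L s\<bar> \<le> exp (- (z * s))" if "s \<ge> s0" for s
      using s0[OF that] by (simp add: abs_mult exp_minus field_simps)
    \<comment> \<open>The decay rate \<open>z\<close> of \<open>L\<close> beats the growth rate
      \<open>y\<close> in every term of the series, so the terms are bounded by those of
      \<open>exp (q n) - 1\<close>.\<close>
    define q where "q n = exp (- ((z - y) * real n))" for n
    have q0: "q \<longlonglongrightarrow> 0"
      unfolding q_def[abs_def]
      by (intro filterlim_compose[OF exp_at_bot] filterlim_uminus_at_bot[THEN iffD2])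
         (use z in \<open>auto intro!: filterlim_tendsto_pos_mult_at_top[OF tendsto_const] filterlim_real_sequentially\<close>)
    have I_le: "\<bar>I y (real n)\<bar> \<le> exp (q n) - 1" if n: "real n \<ge> s0" "n \<ge> 1" for n
    proof -
      let ?a = "\<lambda>k. - ((-1) ^ Suc k * exp (real (Suc k) * real n * y) / fact (Suc k) * L (real (Suc k) * real n))"
      have sums: "?a sums I y (real n)"
        unfolding I_def L_def using laplace_exp_series[OF w x x0, of "real n" y] by (simp add: mult.assoc)
      have "(\<lambda>k. q n ^ k / fact k) sums exp (q n)"
        using exp_converges[of "q n"] by (simp add: field_simps)
      then have qs: "(\<lambda>k. q n ^ Suc k / fact (Suc k)) sums (exp (q n) - 1)"
        by (subst sums_Suc_iff) simp
      have a_le: "norm (?a k) \<le> q n ^ Suc k / fact (Suc k)" for k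
      proof -
        have "s0 \<le> real (Suc k) * real n"
          using n(1) mult_right_mono[of 1 "real (Suc k)" "real n"] by simp
        note Lk = L_le[OF this]
        have "norm (?a k) = exp (real (Suc k) * real n * y) / fact (Suc k) * \<bar>L (real (Suc k) * real n)\<bar>"
          by (simp add: abs_mult power_abs del: power_Suc fact_Suc of_nat_Suc)
        also have "\<dots> \<le> exp (real (Suc k) * real n * y) / fact (Suc k) * exp (- (z * (real (Suc k) * real n)))"
          using Lk by (intro mult_left_mono) auto
        also have "\<dots> = exp (real (Suc k) * (- ((z - y) * real n))) / fact (Suc k)"
          by (simp add: exp_add[symmetric] algebra_simps del: of_nat_Suc fact_Suc)
        also have "\<dots> = q n ^ Suc k / fact (Suc k)"
          unfolding q_def by (simp only: exp_of_nat_mult)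
        finally show ?thesis .
      qed
      have sa: "summable (\<lambda>k. norm (?a k))"
        by (rule summable_comparison_test'[OF sums_summable[OF qs], of 0]) (use a_le in simp)
      have "\<bar>I y (real n)\<bar> = norm (\<Sum>k. ?a k)" using sums by (simp add: sums_iff)
      also have "\<dots> \<le> (\<Sum>k. norm (?a k))" by (rule summable_norm[OF sa])
      also have "\<dots> \<le> (\<Sum>k. q n ^ Suc k / fact (Suc k))"
        by (rule suminf_le[OF a_le sa sums_summable[OF qs]])
      also have "\<dots> = exp (q n) - 1" using qs by (simp add: sums_iff)
      finally show ?thesis .
    qed
    have lim: "(\<lambda>n. exp (q n) - 1) \<longlonglongrightarrow> 0"
      using tendsto_diff[OF tendsto_exp[OF q0] tendsto_const[of 1]] by simp
    have ev: "\<forall>\<^sub>F n in sequentially. norm (I y (real n)) \<le> exp (q n) - 1"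
      using eventually_ge_at_top[of "nat \<lceil>s0\<rceil>"] eventually_ge_at_top[of 1]
      by eventually_elim (use I_le in \<open>auto simp: nat_le_iff ceiling_le_iff\<close>)
    show ?thesis by (rule Lim_null_comparison[OF ev lim])
  qed
  have c0: "(\<integral>t. w t * c y t \<partial>M) = 0" if "y < r" for y
  proof (rule LIMSEQ_unique[OF _ I0[OF that]])
    show "(\<lambda>n. I y (real n)) \<longlonglongrightarrow> (\<integral>t. w t * c y t \<partial>M)"
      unfolding I_def
    proof (rule integral_dominated_convergence[where w="\<lambda>t. \<bar>w t\<bar>"])
      show "AE t in M. (\<lambda>n. w t * (1 - exp (- exp (real n * (y - x t))))) \<longlonglongrightarrow> w t * c y t"
      proof (intro AE_I2 tendsto_mult tendsto_const)
        fix t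
        consider "x t < y" | "x t = y" | "x t > y" by linarith
        then show "(\<lambda>n. 1 - exp (- exp (real n * (y - x t)))) \<longlonglongrightarrow> c y t"
        proof cases
          case 1
          then have "filterlim (\<lambda>n. exp (real n * (y - x t))) at_top sequentially"
            by (intro filterlim_compose[OF exp_at_top] filterlim_at_top_mult_tendsto_pos[OF tendsto_const])
               (auto intro: filterlim_real_sequentially)
          then have "(\<lambda>n. exp (- exp (real n * (y - x t)))) \<longlonglongrightarrow> 0"
            by (intro filterlim_compose[OF exp_at_bot] filterlim_uminus_at_bot[THEN iffD2]) simp
          from tendsto_diff[OF tendsto_const[of 1] this] show ?thesis using 1 by (simp add: c_def)
        next
          case 3
          then have "(\<lambda>n. exp (- (real n * (x t - y)))) \<longlonglongrightarrow> 0"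
            by (intro filterlim_compose[OF exp_at_bot] filterlim_uminus_at_bot[THEN iffD2])
               (auto intro!: filterlim_at_top_mult_tendsto_pos[OF tendsto_const] filterlim_real_sequentially)
          then have "(\<lambda>n. exp (real n * (y - x t))) \<longlonglongrightarrow> 0" by (simp add: algebra_simps)
          from tendsto_diff[OF tendsto_const[of 1] tendsto_exp[OF tendsto_minus[OF this]]]
          show ?thesis using 3 by (simp add: c_def)
        qed (simp add: c_def)
      qed
      show "AE t in M. norm (w t * (1 - exp (- exp (real n * (y - x t))))) \<le> \<bar>w t\<bar>" for n
        by (intro AE_I2) (auto simp: abs_mult intro!: mult_left_le)
      show "(\<lambda>t. w t * c y t) \<in> borel_measurable M" unfolding c_def by measurable
    qed (use w in auto)
  qed
  \<comment> \<open>Decay is available only at rates strictly below \<open>r\<close>. Letting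
    \<open>y n\<close> increase to \<open>r\<close> also turns the limits \<open>c (y n)\<close>
    into the exact indicator, since no point with \<open>x t \<ge> r\<close> is ever
    counted.\<close>
  define y where "y n = r - 1 / real (Suc n)" for n
  have y: "y \<longlonglongrightarrow> r"
    unfolding y_def[abs_def]
    using tendsto_diff[OF tendsto_const[of r] LIMSEQ_inverse_real_of_nat] by (simp add: inverse_eq_divide)
  have yr: "y n < r" for n by (simp add: y_def)
  have "(\<lambda>n. \<integral>t. w t * c (y n) t \<partial>M) \<longlonglongrightarrow> (\<integral>t. w t * indicator {t. x t < r} t \<partial>M)"
  proof (rule integral_dominated_convergence[where w="\<lambda>t. \<bar>w t\<bar>"])
    show "AE t in M. (\<lambda>n. w t * c (y n) t) \<longlonglongrightarrow> w t * indicator {t. x t < r} t"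
    proof (intro AE_I2 tendsto_mult tendsto_const)
      fix t
      show "(\<lambda>n. c (y n) t) \<longlonglongrightarrow> indicator {t. x t < r} t"
      proof (cases "x t < r")
        case True
        from order_tendstoD(1)[OF y this] have "\<forall>\<^sub>F n in sequentially. c (y n) t = 1"
          by eventually_elim (simp add: c_def)
        then show ?thesis using True by (simp add: tendsto_eventually)
      next
        case False
        then have "c (y n) t = 0" for n using yr[of n] by (simp add: c_def)
        then show ?thesis using False by simp
      qed
    qed
    show "(\<lambda>t. w t * c (y n) t) \<in> borel_measurable M" for n unfolding c_def by measurable
    show "AE t in M. norm (w t * c (y n) t) \<le> \<bar>w t\<bar>" for n
      by (intro AE_I2) (auto simp: abs_mult c_def intro!: mult_left_le)
  qed (use w in auto)
  then show ?thesis using c0[OF yr] by (simp add: LIMSEQ_const_iff)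
qed

section \<open>Laplace transforms on the box\<close>

lemma integral_pos_if_pos_on_box:
  fixes u :: "'a::euclidean_space \<Rightarrow> real"
  assumes u: "integrable lborel u" "\<And>t. 0 \<le> u t" and pos: "\<And>t. t \<in> box a b \<Longrightarrow> 0 < u t"
    and ab: "\<And>i. i \<in> Basis \<Longrightarrow> a \<bullet> i < b \<bullet> i"
  shows "0 < (\<integral>t. u t \<partial>lborel)"
proof (rule ccontr)
  assume "\<not> 0 < (\<integral>t. u t \<partial>lborel)"
  moreover have "0 \<le> (\<integral>t. u t \<partial>lborel)"
    by (intro Bochner_Integration.integral_nonneg u(2))
  ultimately have "(\<integral>t. u t \<partial>lborel) = 0" by linarith
  then have "AE t in lborel. u t = 0"
    using integral_nonneg_eq_0_iff_AE[OF u(1)] u(2) by simp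
  then have "AE t in lborel. t \<notin> box a b"
    by eventually_elim (use pos in force)
  then have "emeasure lborel (box a b) = 0"
    by (subst (asm) AE_iff_measurable[of "box a b"]) auto
  moreover have "emeasure lborel (box a b) = ennreal (\<Prod>i\<in>Basis. (b - a) \<bullet> i)"
    using ab by (intro emeasure_lborel_box) (auto simp: less_imp_le)
  moreover have "0 < (\<Prod>i\<in>Basis. (b - a) \<bullet> i)"
    using ab by (intro prod_pos) (auto simp: inner_diff_left)
  ultimately show False by (metis ennreal_less_zero_iff less_irrefl)
qed

lemma inner_cart_nonneg: "(\<And>i. 0 \<le> s $ i) \<Longrightarrow> (\<And>i. 0 \<le> t $ i) \<Longrightarrow> 0 \<le> s \<bullet> t"
  for s t :: "real ^ 'n"
  by (auto simp: inner_vec_def intro!: sum_nonneg)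

lemma inner_cart_ge:
  fixes s t :: "real ^ 'n"
  assumes "\<And>i. 0 \<le> s $ i" "\<And>i. 0 \<le> t $ i"
  shows "s $ i * t $ i \<le> s \<bullet> t"
proof -
  have "s \<bullet> t = s $ i * t $ i + (\<Sum>j\<in>UNIV-{i}. s $ j * t $ j)"
    unfolding inner_vec_def by (subst sum.remove[of _ i]) auto
  moreover have "0 \<le> (\<Sum>j\<in>UNIV-{i}. s $ j * t $ j)"
    using assms by (intro sum_nonneg) simp
  ultimately show ?thesis by simp
qed

text \<open>The exponentials contain 1, are closed under products and separate points, so they are
  dense. Density is applied to the measure with density \<open>\<bar>w\<bar>\<close>: the functional
  g -> \<integral> w g is continuous in its L1 norm, and the test function \<open>sgn (w t)\<close>
  is admissible and turns the integral into that of \<open>\<bar>w\<bar>\<close>.\<close>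

theorem laplace_unique:
  fixes w :: "real ^ 'n \<Rightarrow> real"
  assumes w: "integrable lborel w" and T: "\<And>t. t \<notin> box 0 T \<Longrightarrow> w t = 0"
    and zero: "\<And>\<kappa>. (\<And>i. 0 \<le> \<kappa> $ i) \<Longrightarrow> (\<integral>t. w t * exp (- (\<kappa> \<bullet> t)) \<partial>lborel) = 0"
  shows "AE t in lborel. w t = 0"
proof -
  define M where "M = density lborel (\<lambda>t. ennreal \<bar>w t\<bar>)"
  define V where "V g \<longleftrightarrow> (\<integral>t. w t * g t \<partial>lborel) = 0" for g
  define F where "F = (\<lambda>\<kappa> t. exp (- (\<kappa> \<bullet> t))) ` {\<kappa> :: real ^ 'n. \<forall>i. 0 \<le> \<kappa> $ i}"
  have [measurable]: "w \<in> borel_measurable borel" using w by auto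
  have sM: "sets M = sets borel" by (simp add: M_def)
  have mM: "g \<in> borel_measurable borel" if "integrable M g" for g :: "real ^ 'n \<Rightarrow> real"
    using borel_measurable_integrable[OF that] measurable_cong_sets[OF sM refl] by blast
  have iM: "integrable lborel (\<lambda>t. w t * g t)" if "integrable M g" for g
  proof -
    have "integrable lborel (\<lambda>t. \<bar>w t\<bar> * g t)"
      using that mM[OF that] unfolding M_def by (subst (asm) integrable_density) auto
    then show ?thesis
      by (rule Bochner_Integration.integrable_bound) (use mM[OF that] in \<open>auto simp: abs_mult\<close>)
  qed
  have intM: "(\<integral>t. \<bar>g t - h t\<bar> \<partial>M) = (\<integral>t. \<bar>w t * g t - w t * h t\<bar> \<partial>lborel)"
    if "integrable M g" "integrable M h" for g h
    unfolding M_def using mM[OF that(1)] mM[OF that(2)]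
    by (subst integral_density) (auto simp: abs_mult[symmetric] right_diff_distrib)
  have fin: "finite_measure M"
  proof
    have "(\<integral>\<^sup>+ t. ennreal \<bar>w t\<bar> \<partial>lborel) < \<infinity>"
      using w by (simp add: integrable_iff_bounded)
    then show "emeasure M (space M) \<noteq> \<infinity>"
      unfolding M_def by (subst emeasure_density) auto
  qed
  have "V (\<lambda>t. sgn (w t))"
  proof (rule L1_dense_span[OF fin sM compact_cbox[of 0 T], where F=F and V=V])
    show "AE t in M. t \<in> cbox 0 T"
    proof -
      have "t \<in> cbox 0 T" if "w t \<noteq> 0" for t
        using T[of t] that box_subset_cbox by blast
      then show ?thesis unfolding M_def by (subst AE_density) auto
    qed
    show "continuous_on UNIV g" if "g \<in> F" for g
      using that unfolding F_def by (auto intro!: continuous_intros)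
    show "(\<lambda>_. 1) \<in> F" unfolding F_def by (rule image_eqI[of _ _ 0]) auto
    show "(\<lambda>x. g x * h x) \<in> F" if gh: "g \<in> F" "h \<in> F" for g h
    proof -
      obtain k l where kl: "\<forall>i. 0 \<le> k $ i" "\<forall>i. 0 \<le> l $ i"
        "g = (\<lambda>t. exp (- (k \<bullet> t)))" "h = (\<lambda>t. exp (- (l \<bullet> t)))"
        using gh by (auto simp: F_def)
      then have "(\<lambda>x. g x * h x) = (\<lambda>t. exp (- ((k + l) \<bullet> t)))"
        by (auto simp: exp_add[symmetric] inner_add_left)
      then show ?thesis using kl(1,2) unfolding F_def by (intro image_eqI[of _ _ "k + l"]) auto
    qed
    show "\<exists>g\<in>F. g x \<noteq> g y" if "x \<noteq> y" for x y
    proof -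
      from that obtain i where "x $ i \<noteq> y $ i" by (auto simp: vec_eq_iff)
      then have "exp (- (axis i 1 \<bullet> x)) \<noteq> exp (- (axis i 1 \<bullet> y))" by (simp add: inner_axis')
      moreover have "(\<lambda>t. exp (- (axis i 1 \<bullet> t))) \<in> F"
        unfolding F_def by (rule imageI) (auto simp: axis_def)
      ultimately show ?thesis by (rule bexI)
    qed
    show "V (\<lambda>x. c * g x)" if gF: "g \<in> F" for g c
    proof -
      obtain k where k: "\<forall>i. 0 \<le> k $ i" "g = (\<lambda>t. exp (- (k \<bullet> t)))" using gF by (auto simp: F_def)
      have "(\<integral>t. w t * (c * g t) \<partial>lborel) = c * (\<integral>t. w t * exp (- (k \<bullet> t)) \<partial>lborel)"
        unfolding k(2) by (subst integral_mult_right_zero[symmetric]) (simp add: mult_ac)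
      then show ?thesis using zero k(1) by (simp add: V_def)
    qed
    show "V (\<lambda>x. g x + h x)" if "integrable M g" "integrable M h" "V g" "V h" for g h
      using iM[OF that(1)] iM[OF that(2)] that(3,4) by (simp add: V_def distrib_left)
    show "V g" if g: "integrable M g" and s: "\<And>i. integrable M (s i)" and Vs: "\<And>i::nat. V (s i)"
      and lim: "(\<lambda>i. \<integral>x. \<bar>s i x - g x\<bar> \<partial>M) \<longlonglongrightarrow> 0" for g s
    proof -
      have "\<bar>\<integral>t. w t * g t \<partial>lborel\<bar> \<le> (\<integral>x. \<bar>s i x - g x\<bar> \<partial>M)" for i
      proof -
        have "\<bar>\<integral>t. w t * g t \<partial>lborel\<bar> = \<bar>\<integral>t. w t * s i t - w t * g t \<partial>lborel\<bar>"
          using iM[OF g] iM[OF s[of i]] Vs[of i] by (simp add: V_def)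
        also have "\<dots> \<le> (\<integral>t. \<bar>w t * s i t - w t * g t\<bar> \<partial>lborel)"
          by (rule integral_abs_bound)
        finally show ?thesis by (simp add: intM[OF s g])
      qed
      then have "\<bar>\<integral>t. w t * g t \<partial>lborel\<bar> \<le> 0"
        by (intro LIMSEQ_le_const[OF lim]) auto
      then show ?thesis by (simp add: V_def)
    qed
    show "integrable M (\<lambda>t. sgn (w t))"
    proof -
      interpret finite_measure M by (rule fin)
      have "(\<lambda>t. sgn (w t)) \<in> borel_measurable M"
        unfolding measurable_cong_sets[OF sM refl] by measurable
      then show ?thesis
        by (intro integrable_const_bound[where B=1]) (auto simp: abs_sgn_eq)
    qed
  qed
  then have "(\<integral>t. \<bar>w t\<bar> \<partial>lborel) = 0" by (simp add: V_def abs_sgn)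
  then show ?thesis
    using integral_nonneg_eq_0_iff_AE[of lborel "\<lambda>t. \<bar>w t\<bar>"] w by simp
qed

definition lap :: "real ^ 'n \<Rightarrow> real ^ 'n \<Rightarrow> (real ^ 'n \<Rightarrow> real) \<Rightarrow> real" where
  "lap T s f = (\<integral>t. ext T f t * exp (- (s \<bullet> t)) \<partial>lborel)"

lemma integrable_times_exp:
  fixes F :: "real ^ 'n \<Rightarrow> real"
  assumes F: "integrable lborel F" and s: "\<And>i. 0 \<le> s $ i"
    and t: "\<And>t i. F t \<noteq> 0 \<Longrightarrow> 0 \<le> t $ i"
  shows "integrable lborel (\<lambda>t. F t * exp (- (s \<bullet> t)))"
proof (rule Bochner_Integration.integrable_bound[OF F])
  have [measurable]: "F \<in> borel_measurable borel" using F by auto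
  show "(\<lambda>t. F t * exp (- (s \<bullet> t))) \<in> borel_measurable lborel" by measurable
  show "AE x in lborel. norm (F x * exp (- (s \<bullet> x))) \<le> norm (F x)"
  proof (rule AE_I2)
    fix x
    show "norm (F x * exp (- (s \<bullet> x))) \<le> norm (F x)"
    proof (cases "F x = 0")
      case False
      then have "0 \<le> s \<bullet> x" using s t by (intro inner_cart_nonneg) auto
      then show ?thesis by (simp add: abs_mult mult_left_le)
    qed simp
  qed
qed

lemma ext_nonzero: "ext T f t \<noteq> 0 \<Longrightarrow> 0 < t $ i \<and> t $ i < T $ i"
  by (metis ext_out mem_box_cart zero_index)

lemma lap_integrable:
  "f \<in> L1 T \<Longrightarrow> (\<And>i. 0 \<le> s $ i) \<Longrightarrow> integrable lborel (\<lambda>t. ext T f t * exp (- (s \<bullet> t)))"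
  by (rule integrable_times_exp) (auto simp: L1_iff dest: ext_nonzero intro: less_imp_le)

lemma lap_cong:
  assumes "f \<in> L1 T" "g \<in> L1 T" "L1_eq T f g"
  shows "lap T s f = lap T s g"
  unfolding lap_def
proof (rule integral_cong_AE)
  show "AE t in lborel. ext T f t * exp (- (s \<bullet> t)) = ext T g t * exp (- (s \<bullet> t))"
    using assms(3) unfolding L1_eq_ext by eventually_elim simp
qed (use assms(1,2) in \<open>auto simp: L1_iff\<close>)

text \<open>Without truncation the transform of a superposition of translates is exactly the
  product. Truncating the result to the box discards only points outside the box that are reached by
  a shift from inside, and there the exponential is at most \<open>exp (- \<rho>)\<close>.\<close>

theorem kern_laplace:
  fixes T :: "real ^ 'n" and w :: "'h \<Rightarrow> real"
  assumes K: "causal_kernel N w \<phi>" and f: "f \<in> L1 T" and s: "\<And>i. 0 \<le> s $ i"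
    and \<rho>: "\<And>h v. w h \<noteq> 0 \<Longrightarrow> v \<in> box 0 T \<Longrightarrow> v + \<phi> h \<notin> box 0 T \<Longrightarrow> \<rho> \<le> s \<bullet> (v + \<phi> h)"
  shows "\<bar>lap T s (kern T N w \<phi> f) - (\<integral>h. w h * exp (- (s \<bullet> \<phi> h)) \<partial>N) * lap T s f\<bar>
    \<le> exp (- \<rho>) * ((\<integral>h. \<bar>w h\<bar> \<partial>N) * (\<integral>t. \<bar>ext T f t\<bar> \<partial>lborel))"
proof -
  interpret N: sigma_finite_measure N using K by (simp add: causal_kernel_def)
  interpret Q: pair_sigma_finite lborel N by standard
  have w: "integrable N w" and [measurable]: "\<phi> \<in> borel_measurable N"
    and \<phi>0: "\<And>h i. w h \<noteq> 0 \<Longrightarrow> 0 \<le> \<phi> h $ i" using K by (auto simp: causal_kernel_def)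
  have [measurable]: "w \<in> borel_measurable N" "ext T f \<in> borel_measurable borel"
    using w f by (auto simp: L1_iff)
  let ?F = "\<lambda>(t, h). w h * ext T f (t - \<phi> h)"
  \<comment> \<open>\<open>?G\<close> integrates over the whole space and factorizes;
    \<open>?H\<close> is its restriction to the box. The error is the integral of their
    difference.\<close>
  let ?G = "\<lambda>(t, h). exp (- (s \<bullet> t)) * (w h * ext T f (t - \<phi> h))"
  let ?H = "\<lambda>(t, h). indicator (box 0 T) t * (exp (- (s \<bullet> t)) * (w h * ext T f (t - \<phi> h)))"
  have F: "integrable (lborel \<Otimes>\<^sub>M N) ?F" and
    F_norm: "(\<integral>t. \<integral>h. \<bar>w h * ext T f (t - \<phi> h)\<bar> \<partial>N \<partial>lborel) = (\<integral>h. \<bar>w h\<bar> \<partial>N) * (\<integral>t. \<bar>ext T f t\<bar> \<partial>lborel)"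
    using f w by (auto intro!: integrable_translates N.sigma_finite_measure_axioms simp: L1_iff)
  have nz: "0 \<le> t $ i" if "w h * ext T f (t - \<phi> h) \<noteq> 0" for t h i
  proof -
    have "w h \<noteq> 0" "ext T f (t - \<phi> h) \<noteq> 0" using that by auto
    then show ?thesis using \<phi>0[of h i] ext_nonzero[of T f "t - \<phi> h" i] by simp
  qed
  have G: "integrable (lborel \<Otimes>\<^sub>M N) ?G"
  proof (rule Bochner_Integration.integrable_bound[OF F])
    show "AE p in lborel \<Otimes>\<^sub>M N. norm (?G p) \<le> norm (?F p)"
    proof (intro AE_I2)
      fix p :: "(real ^ 'n) \<times> 'h"
      obtain t h where p: "p = (t, h)" by (cases p)
      show "norm (?G p) \<le> norm (?F p)"
      proof (cases "w h * ext T f (t - \<phi> h) = 0")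
        case False
        then have "0 \<le> s \<bullet> t" using nz by (intro inner_cart_nonneg s) auto
        then have "exp (- (s \<bullet> t)) * \<bar>w h * ext T f (t - \<phi> h)\<bar> \<le> 1 * \<bar>w h * ext T f (t - \<phi> h)\<bar>"
          by (intro mult_right_mono) auto
        then show ?thesis by (simp add: p abs_mult)
      qed (auto simp: p)
    qed
  qed measurable
  have H: "integrable (lborel \<Otimes>\<^sub>M N) ?H"
    by (rule Bochner_Integration.integrable_bound[OF G]) (auto simp: abs_mult indicator_def)
  have lapK: "lap T s (kern T N w \<phi> f) = integral\<^sup>L (lborel \<Otimes>\<^sub>M N) ?H"
  proof -
    have "lap T s (kern T N w \<phi> f) = (\<integral>t. \<integral>h. indicator (box 0 T) t * (exp (- (s \<bullet> t)) * (w h * ext T f (t - \<phi> h))) \<partial>N \<partial>lborel)"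
      unfolding lap_def ext_def[of T "kern T N w \<phi> f"] kern_def by (simp only: integral_mult_right_zero) (simp only: mult_ac)
    also have "\<dots> = integral\<^sup>L (lborel \<Otimes>\<^sub>M N) ?H" using Q.integral_fst'[OF H] by simp
    finally show ?thesis .
  qed
  have lapG: "(\<integral>h. w h * exp (- (s \<bullet> \<phi> h)) \<partial>N) * lap T s f = integral\<^sup>L (lborel \<Otimes>\<^sub>M N) ?G"
  proof -
    have "integral\<^sup>L (lborel \<Otimes>\<^sub>M N) ?G = (\<integral>h. \<integral>t. exp (- (s \<bullet> t)) * (w h * ext T f (t - \<phi> h)) \<partial>lborel \<partial>N)"
      using Q.integral_snd[of "\<lambda>t h. exp (- (s \<bullet> t)) * (w h * ext T f (t - \<phi> h))"] G by simp
    also have "\<dots> = (\<integral>h. w h * exp (- (s \<bullet> \<phi> h)) * lap T s f \<partial>N)"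
    proof (intro Bochner_Integration.integral_cong refl)
      fix h
      have e: "exp (- (s \<bullet> t)) = exp (- (s \<bullet> \<phi> h)) * exp (- (s \<bullet> (t - \<phi> h)))" for t
        by (simp add: exp_add[symmetric] inner_diff_right)
      have "(\<integral>t. exp (- (s \<bullet> t)) * (w h * ext T f (t - \<phi> h)) \<partial>lborel)
        = (\<integral>t. (\<lambda>v. w h * exp (- (s \<bullet> \<phi> h)) * (ext T f v * exp (- (s \<bullet> v)))) (t - \<phi> h) \<partial>lborel)"
        by (intro Bochner_Integration.integral_cong refl, subst e) (simp only: mult_ac)
      also have "\<dots> = (\<integral>v. w h * exp (- (s \<bullet> \<phi> h)) * (ext T f v * exp (- (s \<bullet> v))) \<partial>lborel)"
        by (rule lborel_integral_shift(1))
      also have "\<dots> = w h * exp (- (s \<bullet> \<phi> h)) * lap T s f" unfolding lap_def by simp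
      finally show "(\<integral>t. exp (- (s \<bullet> t)) * (w h * ext T f (t - \<phi> h)) \<partial>lborel)
        = w h * exp (- (s \<bullet> \<phi> h)) * lap T s f" .
    qed
    also have "\<dots> = (\<integral>h. w h * exp (- (s \<bullet> \<phi> h)) \<partial>N) * lap T s f" by simp
    finally show ?thesis by simp
  qed
  have "\<bar>integral\<^sup>L (lborel \<Otimes>\<^sub>M N) ?H - integral\<^sup>L (lborel \<Otimes>\<^sub>M N) ?G\<bar>
      = \<bar>\<integral>p. ?H p - ?G p \<partial>(lborel \<Otimes>\<^sub>M N)\<bar>"
    using Bochner_Integration.integral_diff[OF H G] by simp
  also have "\<dots> \<le> (\<integral>p. \<bar>?H p - ?G p\<bar> \<partial>(lborel \<Otimes>\<^sub>M N))" by (rule integral_abs_bound)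
  also have "\<dots> \<le> (\<integral>p. exp (- \<rho>) * \<bar>?F p\<bar> \<partial>(lborel \<Otimes>\<^sub>M N))"
  proof (rule integral_mono)
    show "integrable (lborel \<Otimes>\<^sub>M N) (\<lambda>p. \<bar>?H p - ?G p\<bar>)"
      by (intro integrable_abs Bochner_Integration.integrable_diff H G)
    show "integrable (lborel \<Otimes>\<^sub>M N) (\<lambda>p. exp (- \<rho>) * \<bar>?F p\<bar>)"
      by (intro integrable_mult_right integrable_abs F)
    fix p :: "(real ^ 'n) \<times> 'h"
    obtain t h where p: "p = (t, h)" by (cases p)
    show "\<bar>?H p - ?G p\<bar> \<le> exp (- \<rho>) * \<bar>?F p\<bar>"
    proof (cases "t \<notin> box 0 T \<and> w h * ext T f (t - \<phi> h) \<noteq> 0")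
      case True
      then have "w h \<noteq> 0" by simp
      moreover have "t - \<phi> h \<in> box 0 T" by (rule ccontr) (use True in simp)
      ultimately have "\<rho> \<le> s \<bullet> t" using \<rho>[of h "t - \<phi> h"] True by simp
      then show ?thesis using True by (auto simp: p abs_mult intro!: mult_right_mono)
    qed (auto simp: p)
  qed
  also have "\<dots> = exp (- \<rho>) * (\<integral>p. \<bar>?F p\<bar> \<partial>(lborel \<Otimes>\<^sub>M N))" by simp
  also have "(\<integral>p. \<bar>?F p\<bar> \<partial>(lborel \<Otimes>\<^sub>M N)) = (\<integral>t. \<integral>h. \<bar>w h * ext T f (t - \<phi> h)\<bar> \<partial>N \<partial>lborel)"
    using Q.integral_fst'[OF integrable_abs[OF F]] by simp
  also note F_norm
  finally show ?thesis unfolding lapK lapG .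
qed

section \<open>Injectivity\<close>

text \<open>If the integral vanishes, then the transform of \<open>f\<close> times that of the
  kernel is of order exp (- T_i \<sigma>) in the direction of axis \<open>i\<close>. The transform
  of the kernel is positive and decays slower than every exponential, so dividing by it shows that
  \<open>f\<close> vanishes where t_i < T_i, which is the whole box.\<close>

lemma RL_partial_injective:
  fixes T :: "real ^ 'n"
  assumes T: "\<And>i. T $ i > 0" and a: "a \<ge> 0" and f: "f \<in> L1 T"
    and zero: "L1_eq T (RL_partial i a f) (\<lambda>_. 0)"
  shows "L1_eq T f (\<lambda>_. 0)"
proof (cases "a = 0")
  case True
  then show ?thesis using zero by (simp add: RL_partial_def)
next
  case False
  with a have a: "a > 0" by simp
  let ?w = "rl_weight T i a"
  let ?K = "kern T lborel ?w (axis i)"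
  note K = causal_rl_weight[OF T[of i] a]
  have "L1_eq T (?K f) (RL_partial i a f)"
    by (rule L1_eqI) (simp add: RL_partial_eq_kern[OF _ False])
  also note zero
  finally have K0: "L1_eq T (?K f) (\<lambda>_. 0)" .
  have w_int: "integrable lborel ?w" using K by (simp add: causal_kernel_def)
  have w_nn: "0 \<le> ?w h" for h
    using Gamma_real_pos[OF a] by (auto simp: rl_weight_def indicator_def)
  have w_pos: "0 < ?w h" if "0 < h" "h < T $ i" for h
    using Gamma_real_pos[OF a] that by (auto simp: rl_weight_def)
  have w_supp: "0 < h \<and> h < T $ i" if "?w h \<noteq> 0" for h
    using that by (auto simp: rl_weight_def indicator_def split: if_splits)
  have [measurable]: "?w \<in> borel_measurable borel" "ext T f \<in> borel_measurable borel"
    using w_int f by (auto simp: L1_iff)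
  have "(\<integral>t. ext T f t * exp (- (\<kappa> \<bullet> t)) \<partial>lborel) = 0" if \<kappa>: "\<And>j. 0 \<le> \<kappa> $ j" for \<kappa>
  proof -
    \<comment> \<open>The kernel shifts only in variable \<open>i\<close>, so the box can be left
      only through the face t_i = T_i. Moving along this axis makes the exponent there at least
      \<open>T $ i * \<sigma>\<close>.\<close>
    define S where "S \<sigma> = \<kappa> + axis i \<sigma>" for \<sigma> :: real
    have S0: "0 \<le> S \<sigma> $ j" if "0 \<le> \<sigma>" for \<sigma> j using that \<kappa>[of j] by (simp add: S_def axis_def)
    define W where "W \<sigma> = (\<integral>h. ?w h * exp (- (S \<sigma> \<bullet> axis i h)) \<partial>lborel)" for \<sigma>
    have W_eq: "W \<sigma> = (\<integral>h. (?w h * exp (- (\<kappa> $ i * h))) * exp (- (\<sigma> * h)) \<partial>lborel)" for \<sigma>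
      unfolding W_def
      by (intro Bochner_Integration.integral_cong refl)
         (simp add: S_def inner_axis exp_add[symmetric] algebra_simps)
    have wk_int: "integrable lborel (\<lambda>h. ?w h * exp (- (\<kappa> $ i * h)))"
    proof (rule Bochner_Integration.integrable_bound[OF w_int])
      show "AE h in lborel. norm (?w h * exp (- (\<kappa> $ i * h))) \<le> norm (?w h)"
      proof (rule AE_I2)
        fix h
        show "norm (?w h * exp (- (\<kappa> $ i * h))) \<le> norm (?w h)"
          using w_supp[of h] \<kappa>[of i] by (cases "?w h = 0") (auto simp: abs_mult intro!: mult_left_le)
      qed
    qed measurable
    have W_sub: "subexp_below W"
      unfolding W_eq[abs_def]
    proof (rule subexp_below_laplace[OF wk_int])
      show "0 \<le> ?w h * exp (- (\<kappa> $ i * h))" for h using w_nn by simp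
      show "0 \<le> h" if "?w h * exp (- (\<kappa> $ i * h)) \<noteq> 0" for h
        using that w_supp[of h] by auto
      fix e :: real assume e: "e > 0"
      show "0 < (\<integral>h. ?w h * exp (- (\<kappa> $ i * h)) * indicator {h. h < e} h \<partial>lborel)"
      proof (rule integral_pos_if_pos_on_box[where a=0 and b="min e (T $ i)"])
        show "integrable lborel (\<lambda>h. ?w h * exp (- (\<kappa> $ i * h)) * indicator {h. h < e} h)"
          by (rule Bochner_Integration.integrable_bound[OF wk_int]) (auto simp: indicator_def)
        show "0 \<le> ?w h * exp (- (\<kappa> $ i * h)) * indicator {h. h < e} h" for h
          using w_nn by simp
        show "0 < ?w h * exp (- (\<kappa> $ i * h)) * indicator {h. h < e} h"
          if "h \<in> box 0 (min e (T $ i))" for h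
          using that w_pos[of h] by (auto simp: box_real)
      qed (use e T in auto)
    qed measurable
    define C where "C = (\<integral>h. \<bar>?w h\<bar> \<partial>lborel) * (\<integral>t. \<bar>ext T f t\<bar> \<partial>lborel)"
    have "\<bar>W \<sigma> * lap T (S \<sigma>) f\<bar> \<le> exp (- (T $ i * \<sigma>)) * C" if \<sigma>: "0 \<le> \<sigma>" for \<sigma>
    proof -
      have "\<bar>lap T (S \<sigma>) (?K f) - W \<sigma> * lap T (S \<sigma>) f\<bar> \<le> exp (- (T $ i * \<sigma>)) * C"
        unfolding W_def C_def
      proof (rule kern_laplace[OF K f S0[OF \<sigma>]])
        fix h v assume h: "?w h \<noteq> 0" "v \<in> box 0 T" "v + axis i h \<notin> box 0 T"
        have v: "0 < v $ j" "v $ j < T $ j" for j using h(2) by (auto simp: mem_box_cart)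
        have h0: "0 < h" using w_supp[OF h(1)] by simp
        have nn: "0 \<le> (v + axis i h) $ j" for j using v[of j] h0 by (simp add: axis_def)
        have ge: "T $ i \<le> (v + axis i h) $ i"
        proof (rule ccontr)
          assume "\<not> T $ i \<le> (v + axis i h) $ i"
          then have "0 < (v + axis i h) $ j \<and> (v + axis i h) $ j < T $ j" for j
            using v[of j] h0 by (cases "j = i") (auto simp: axis_def)
          with h(3) show False by (auto simp: mem_box_cart)
        qed
        have "T $ i * \<sigma> \<le> (v + axis i h) $ i * S \<sigma> $ i"
          using ge T[of i] nn[of i] \<kappa>[of i] \<sigma> by (intro mult_mono) (auto simp: S_def axis_def)
        also have "\<dots> \<le> S \<sigma> \<bullet> (v + axis i h)"
          using inner_cart_ge[of "S \<sigma>" "v + axis i h" i] S0[OF \<sigma>] nn by (simp add: mult.commute)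
        finally show "T $ i * \<sigma> \<le> S \<sigma> \<bullet> (v + axis i h)" .
      qed
      moreover have "lap T (S \<sigma>) (?K f) = 0"
        using lap_cong[OF kern_L1[OF K f] L1_const K0] by (simp add: lap_def ext_def)
      ultimately show ?thesis by simp
    qed
    then have "exp_small (T $ i) (\<lambda>\<sigma>. lap T (S \<sigma>) f * W \<sigma>)"
      by (intro exp_small_bound[of _ C] eventually_at_top_linorderI[of 0]) (simp add: mult.commute)
    then have "exp_small (T $ i) (\<lambda>\<sigma>. lap T (S \<sigma>) f)"
      by (rule exp_small_divide[OF _ W_sub])
    moreover have "lap T (S \<sigma>) f = (\<integral>t. (ext T f t * exp (- (\<kappa> \<bullet> t))) * exp (- (\<sigma> * t $ i)) \<partial>lborel)" for \<sigma>
      unfolding lap_def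
      by (intro Bochner_Integration.integral_cong refl)
         (simp add: S_def inner_add_left inner_axis' exp_add[symmetric] algebra_simps)
    ultimately have sm: "exp_small (T $ i) (\<lambda>\<sigma>. \<integral>t. (ext T f t * exp (- (\<kappa> \<bullet> t))) * exp (- (\<sigma> * t $ i)) \<partial>lborel)"
      by simp
    have "(\<integral>t. ext T f t * exp (- (\<kappa> \<bullet> t)) * indicator {t. t $ i < T $ i} t \<partial>lborel) = 0"
    proof (rule laplace_exp_small_imp_zero[OF lap_integrable[OF f \<kappa>] _ _ sm])
      show "0 \<le> t $ i" if "ext T f t * exp (- (\<kappa> \<bullet> t)) \<noteq> 0" for t
        using ext_nonzero[of T f t i] that by auto
    qed measurable
    moreover have "ext T f t * exp (- (\<kappa> \<bullet> t)) * indicator {t. t $ i < T $ i} t = ext T f t * exp (- (\<kappa> \<bullet> t))" for t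
      using ext_nonzero[of T f t i] by (auto simp: indicator_def)
    ultimately show ?thesis by simp
  qed
  then have "AE t in lborel. ext T f t = 0"
    using f by (intro laplace_unique[where T=T]) (auto simp: L1_iff)
  then show ?thesis unfolding L1_eq_ext by eventually_elim (simp add: ext_def)
qed

lemma RL_injective:
  fixes T :: "real ^ 'n::{finite,linorder}"
  assumes T: "\<And>i. T $ i > 0" and \<alpha>: "\<And>i. \<alpha> $ i \<ge> 0" and f: "f \<in> L1 T"
    and zero: "L1_eq T (RL \<alpha> f) (\<lambda>_. 0)"
  shows "L1_eq T f (\<lambda>_. 0)"
proof -
  let ?I = "\<lambda>xs. foldr (\<lambda>i. RL_partial i (\<alpha> $ i)) xs"
  have I: "?I xs f \<in> L1 T" for xs
    by (induction xs) (simp_all add: f L1_opD(1)[OF L1_op_RL_partial[OF T \<alpha>]])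
  have "L1_eq T (?I xs f) (\<lambda>_. 0) \<Longrightarrow> L1_eq T f (\<lambda>_. 0)" for xs
  proof (induction xs)
    case (Cons i xs)
    then show ?case using RL_partial_injective[OF T \<alpha> I[of xs]] by simp
  qed simp
  then show ?thesis using zero by (simp add: RL_def)
qed

lemma conv_RL_one:
  fixes T :: "real ^ 'n::{finite,linorder}"
  assumes T: "\<And>i. T $ i > 0" and \<alpha>: "\<And>i. \<alpha> $ i \<ge> 0" and b: "b \<in> L1 T" "L1_eq T b (RL \<alpha> (\<lambda>_. 1))"
    and f: "f \<in> L1 T"
  shows "L1_eq T (conv T b f) (RL \<alpha> (RL (\<chi> i. 1) f))"
proof -
  note R = comm_op_RL[OF T \<alpha>]
  note r = L1_opD[OF comm_op_op[OF R]]
  note o = L1_opD(1)[OF comm_op_op[OF comm_op_RL[OF T, of "\<chi> i. 1"]]]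
  have "L1_eq T (conv T b f) (conv T (RL \<alpha> (\<lambda>_. 1)) f)"
    by (rule conv_cong1[OF T b(1) r(1)[OF L1_const] b(2) f])
  also have "L1_eq T \<dots> (RL \<alpha> (conv T (\<lambda>_. 1) f))"
    by (rule L1_eq_sym[OF comm_op_conv_eq[OF T R L1_const f]])
  also have "L1_eq T \<dots> (RL \<alpha> (RL (\<chi> i. 1) f))"
    by (rule r(2)[OF conv_L1[OF T L1_const f] o[OF _ f] conv_one[OF T f]]) simp
  finally show ?thesis .
qed

text \<open>Convolution with \<open>b\<close> is the Riemann-Liouville integral of order
  \<open>\<alpha>\<close> after the one of order 1 in every variable, and both are injective. This
  supplies the non-zero-divisors of the convolution algebra.\<close>

lemma conv_RL_one_injective:
  fixes T :: "real ^ 'n::{finite,linorder}"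
  assumes T: "\<And>i. T $ i > 0" and \<alpha>: "\<And>i. \<alpha> $ i \<ge> 0" and b: "b \<in> L1 T" "L1_eq T b (RL \<alpha> (\<lambda>_. 1))"
    and f: "f \<in> L1 T" and zero: "L1_eq T (conv T b f) (\<lambda>_. 0)"
  shows "L1_eq T f (\<lambda>_. 0)"
proof -
  have o: "RL (\<chi> i. 1) f \<in> L1 T"
    by (rule L1_opD(1)[OF comm_op_op[OF comm_op_RL[OF T]] f]) simp
  have "L1_eq T (RL \<alpha> (RL (\<chi> i. 1) f)) (\<lambda>_. 0)"
    using L1_eq_trans[OF L1_eq_sym[OF conv_RL_one[OF T \<alpha> b f]] zero] .
  from RL_injective[OF T \<alpha> o this] show ?thesis
    by (intro RL_injective[OF T _ f]) simp_all
qed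

section \<open>Laplace transforms along a ray\<close>

definition weight :: "real ^ 'n \<Rightarrow> real ^ 'n" where
  "weight T = (\<chi> i. 1 / T $ i)"

text \<open>The direction gives \<open>t\<close> the height \<open>weight T \<bullet> t\<close>.
  Points with positive coordinates outside the box have height at least 1, while the box lies below
  height \<open>CARD('n)\<close>; the first fact fixes the error rate 1, the second the number of
  convolution powers needed for nilpotency.\<close>

definition ray :: "real ^ 'n \<Rightarrow> real ^ 'n \<Rightarrow> real \<Rightarrow> real ^ 'n" where
  "ray T \<kappa> \<sigma> = \<kappa> + \<sigma> *\<^sub>R weight T"

lemma ray_nonneg:
  "(\<And>i. T $ i > 0) \<Longrightarrow> (\<And>i. 0 \<le> \<kappa> $ i) \<Longrightarrow> 0 \<le> \<sigma> \<Longrightarrow> 0 \<le> ray T \<kappa> \<sigma> $ i"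
  by (simp add: ray_def weight_def less_imp_le)

lemma lap_ray:
  "lap T (ray T \<kappa> \<sigma>) f = (\<integral>t. (ext T f t * exp (- (\<kappa> \<bullet> t))) * exp (- (\<sigma> * (weight T \<bullet> t))) \<partial>lborel)"
  unfolding lap_def
  by (intro Bochner_Integration.integral_cong refl)
     (simp add: ray_def inner_add_left exp_add[symmetric] algebra_simps)

text \<open>If \<open>v\<close> and \<open>h\<close> lie in the box but \<open>v + h\<close> does
  not, then some coordinate \<open>j\<close> has reached \<open>T $ j\<close>. Its term in the inner
  product with the ray is already at least \<open>\<sigma>\<close>, so \<open>kern_laplace\<close>
  applies with that value.\<close>

lemma exp_small_lap_conv:
  fixes T :: "real ^ 'n"
  assumes T: "\<And>i. T $ i > 0" and \<kappa>: "\<And>i. 0 \<le> \<kappa> $ i" and f: "f \<in> L1 T" and g: "g \<in> L1 T"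
  shows "exp_small 1 (\<lambda>\<sigma>. lap T (ray T \<kappa> \<sigma>) (conv T f g) - lap T (ray T \<kappa> \<sigma>) f * lap T (ray T \<kappa> \<sigma>) g)"
proof -
  define C where "C = (\<integral>t. \<bar>ext T f t\<bar> \<partial>lborel) * (\<integral>t. \<bar>ext T g t\<bar> \<partial>lborel)"
  have "\<bar>lap T (ray T \<kappa> \<sigma>) (conv T f g) - lap T (ray T \<kappa> \<sigma>) f * lap T (ray T \<kappa> \<sigma>) g\<bar> \<le> exp (- \<sigma>) * C"
    if \<sigma>: "0 \<le> \<sigma>" for \<sigma>
    unfolding conv_eq_kern C_def lap_def[of T _ f]
  proof (rule kern_laplace[OF causal_conv[OF f] g ray_nonneg[OF T \<kappa> \<sigma>]])
    fix h v assume h: "ext T f h \<noteq> 0" "v \<in> box 0 T" "v + h \<notin> box 0 T"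
    have p: "0 < (v + h) $ j" for j
      using h(2) ext_nonzero[OF h(1), of j] by (simp add: mem_box_cart add_pos_pos)
    then obtain j where j: "T $ j \<le> (v + h) $ j"
      using h(3) by (auto simp: mem_box_cart not_less)
    have "\<sigma> = \<sigma> / T $ j * T $ j" using T[of j] by simp
    also have "\<dots> \<le> ray T \<kappa> \<sigma> $ j * (v + h) $ j"
      using j T[of j] \<kappa>[of j] \<sigma> by (intro mult_mono) (auto simp: ray_def weight_def)
    also have "\<dots> \<le> ray T \<kappa> \<sigma> \<bullet> (v + h)"
      by (rule inner_cart_ge) (use p in \<open>auto intro: ray_nonneg[OF T \<kappa> \<sigma>] less_imp_le\<close>)
    finally show "\<sigma> \<le> ray T \<kappa> \<sigma> \<bullet> (v + h)" .
  qed
  then show ?thesis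
    by (intro exp_small_bound[of _ C] eventually_at_top_linorderI[of 0]) (simp add: mult.commute)
qed

lemma subexp_below_lap:
  fixes T :: "real ^ 'n"
  assumes T: "\<And>i. T $ i > 0" and \<kappa>: "\<And>i. 0 \<le> \<kappa> $ i" and b: "b \<in> L1 T"
    and pos: "\<And>t. t \<in> box 0 T \<Longrightarrow> 0 < b t"
  shows "subexp_below (\<lambda>\<sigma>. lap T (ray T \<kappa> \<sigma>) b)"
  unfolding lap_ray
proof (rule subexp_below_laplace[OF lap_integrable[OF b \<kappa>]])
  have [measurable]: "ext T b \<in> borel_measurable borel" using b by (auto simp: L1_iff)
  show nn: "0 \<le> ext T b t * exp (- (\<kappa> \<bullet> t))" for t
    using pos[of t] by (auto simp: ext_def indicator_def)
  show "0 \<le> weight T \<bullet> t" if "ext T b t * exp (- (\<kappa> \<bullet> t)) \<noteq> 0" for t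
    by (rule inner_cart_nonneg) (use T that ext_nonzero[of T b t] in \<open>auto simp: weight_def intro: less_imp_le\<close>)
  show "(\<lambda>t. weight T \<bullet> t) \<in> borel_measurable lborel" by measurable
  fix e :: real assume e: "e > 0"
  \<comment> \<open>The box scaled by \<open>c\<close> lies inside the original one since
    \<open>c \<le> 1\<close>, and below height \<open>e\<close> since each of the
    \<open>CARD('n)\<close> summands of the height is less than \<open>c\<close>.\<close>
  define c where "c = min 1 (e / real CARD('n))"
  have c: "0 < c" "c \<le> 1" "c * real CARD('n) \<le> e"
    using e by (auto simp: c_def min_def field_simps)
  show "0 < (\<integral>t. ext T b t * exp (- (\<kappa> \<bullet> t)) * indicator {t. weight T \<bullet> t < e} t \<partial>lborel)"
  proof (rule integral_pos_if_pos_on_box[where a=0 and b="c *\<^sub>R T"])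
    show "integrable lborel (\<lambda>t. ext T b t * exp (- (\<kappa> \<bullet> t)) * indicator {t. weight T \<bullet> t < e} t)"
      by (rule Bochner_Integration.integrable_bound[OF lap_integrable[OF b \<kappa>]]) (auto simp: indicator_def)
    show "0 \<le> ext T b t * exp (- (\<kappa> \<bullet> t)) * indicator {t. weight T \<bullet> t < e} t" for t
      using nn by simp
    show "0 < ext T b t * exp (- (\<kappa> \<bullet> t)) * indicator {t. weight T \<bullet> t < e} t" if "t \<in> box 0 (c *\<^sub>R T)" for t
    proof -
      have t: "0 < t $ j" "t $ j < c * T $ j" for j using that by (auto simp: mem_box_cart)
      have "c * T $ j \<le> T $ j" for j using c T[of j] by (simp add: mult_left_le_one_le)
      then have "t \<in> box 0 T" using t less_le_trans by (fastforce simp: mem_box_cart)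
      have "weight T \<bullet> t = (\<Sum>j\<in>UNIV. t $ j / T $ j)"
        by (simp add: inner_vec_def weight_def)
      also have "\<dots> < (\<Sum>j\<in>(UNIV::'n set). c)"
        using t T by (intro sum_strict_mono) (auto simp: divide_less_eq)
      also have "\<dots> \<le> e" using c by (simp add: mult.commute)
      finally show ?thesis using \<open>t \<in> box 0 T\<close> pos[of t] by simp
    qed
    show "0 \<bullet> i < (c *\<^sub>R T) \<bullet> i" if "i \<in> Basis" for i
      using that c T by (auto simp: Basis_vec_def inner_axis)
  qed
qed

section \<open>Uniqueness of square roots\<close>

lemma subexp_below_perturb:
  assumes H: "subexp_below H" and E: "exp_small r E" and r: "r > 0"
    and F: "\<forall>\<^sub>F s in at_top. H s + E s \<le> F s"
  shows "subexp_below F"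
  unfolding subexp_below_def
proof (intro allI impI)
  fix e :: real assume e: "e > 0"
  \<comment> \<open>A rate below \<open>r\<close> lets the error consume at most half of the lower
    bound for \<open>H\<close>; a bound at the rate \<open>e'\<close> implies one at
    \<open>e\<close> because \<open>e' \<le> e\<close>.\<close>
  define e' where "e' = min e (r / 2)"
  have e': "e' > 0" "e' \<le> e" "e' < r" using e r by (auto simp: e'_def)
  obtain c where c: "c > 0" "\<forall>\<^sub>F s in at_top. c * exp (- (e' * s)) \<le> H s"
    using H e'(1) unfolding subexp_below_def by blast
  have "((\<lambda>s. exp (e' * s) * E s) \<longlongrightarrow> 0) at_top" using E e'(3) by (simp add: exp_small_def)
  from tendstoD[OF this, of "c / 2"] have ev: "\<forall>\<^sub>F s in at_top. \<bar>exp (e' * s) * E s\<bar> < c / 2"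
    using c(1) by simp
  have "\<forall>\<^sub>F s in at_top. c / 2 * exp (- (e * s)) \<le> F s"
    using c(2) ev F eventually_ge_at_top[of 0]
  proof eventually_elim
    case (elim s)
    have "\<bar>E s\<bar> * exp (e' * s) < c / 2" using elim(2) by (simp add: abs_mult mult.commute)
    then have "\<bar>E s\<bar> < c / 2 * exp (- (e' * s))"
      by (simp add: exp_minus field_simps)
    moreover have "c / 2 * exp (- (e * s)) \<le> c / 2 * exp (- (e' * s))"
      using e'(2) elim(4) c(1) by (intro mult_left_mono) (auto intro: mult_right_mono)
    ultimately show ?case using elim(1,3) by (auto simp: field_simps)
  qed
  then show "\<exists>c>0. \<forall>\<^sub>F s in at_top. c * exp (- (e * s)) \<le> F s"
    using c(1) by (intro exI[of _ "c / 2"]) auto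
qed

lemma subexp_below_pos: "subexp_below H \<Longrightarrow> \<forall>\<^sub>F s in at_top. 0 < H s"
proof -
  assume "subexp_below H"
  then obtain c where "c > 0" "\<forall>\<^sub>F s in at_top. c * exp (- (1 * s)) \<le> H s"
    unfolding subexp_below_def by (meson zero_less_one)
  from this(2) show ?thesis
  proof eventually_elim
    case (elim s)
    have "0 < c * exp (- (1 * s))" using \<open>c > 0\<close> by simp
    then show ?case using elim by linarith
  qed
qed

section \<open>Vanishing below a height, and square roots for convolution\<close>

definition vanish_below :: "real ^ 'n \<Rightarrow> real \<Rightarrow> (real ^ 'n \<Rightarrow> real) \<Rightarrow> bool" where
  "vanish_below T c f \<longleftrightarrow> (AE t in lborel. weight T \<bullet> t < c \<longrightarrow> ext T f t = 0)"

lemma vanish_below_cong: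
  assumes "L1_eq T f g" "vanish_below T c f"
  shows "vanish_below T c g"
  using assms unfolding vanish_below_def L1_eq_ext by eventually_elim simp

lemma vanish_below_card:
  fixes T :: "real ^ 'n"
  assumes T: "\<And>i. T $ i > 0" and c: "real CARD('n) \<le> c" and f: "vanish_below T c f"
  shows "L1_eq T f (\<lambda>_. 0)"
  using f unfolding L1_eq_iff vanish_below_def
proof eventually_elim
  case (elim t)
  show ?case
  proof
    assume t: "t \<in> box 0 T"
    have "weight T \<bullet> t = (\<Sum>j\<in>UNIV. t $ j / T $ j)"
      by (simp add: inner_vec_def weight_def)
    also have "\<dots> < (\<Sum>j\<in>(UNIV::'n set). 1)"
      using t T by (intro sum_strict_mono) (auto simp: divide_less_eq mem_box_cart)
    also have "\<dots> \<le> c" using c by simp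
    finally show "f t = 0" using elim t by simp
  qed
qed

lemma AE_lborel_reflect:
  fixes t :: "'a::euclidean_space"
  assumes "AE v in lborel. P v" and [measurable]: "Measurable.pred borel P"
  shows "AE v in lborel. P (t - v)"
proof -
  have *: "distr lborel borel (\<lambda>v::'a. t - v) = lborel"
    using lborel_affine[of "-1" t] by (simp add: density_1 one_ennreal_def[symmetric])
  have "AE v in distr lborel borel (\<lambda>v. t - v). P v" by (subst *) (rule assms(1))
  then show ?thesis by (subst (asm) AE_distr_iff) auto
qed

text \<open>Heights are additive: if \<open>t\<close> lies below \<open>a + b\<close>, then
  \<open>v\<close> lies below \<open>a\<close> or \<open>t - v\<close> lies below \<open>b\<close>,
  so one factor of the integrand vanishes almost everywhere.\<close>

lemma vanish_below_conv:
  assumes f: "f \<in> L1 T" "vanish_below T a f" and g: "g \<in> L1 T" "vanish_below T b g"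
  shows "vanish_below T (a + b) (conv T f g)"
  unfolding vanish_below_def
proof (intro AE_I2 impI)
  fix t assume t: "weight T \<bullet> t < a + b"
  have [measurable]: "ext T f \<in> borel_measurable borel" "ext T g \<in> borel_measurable borel"
    using f g by (auto simp: L1_iff)
  have "AE v in lborel. weight T \<bullet> (t - v) < b \<longrightarrow> ext T g (t - v) = 0"
    using g(2) unfolding vanish_below_def by (rule AE_lborel_reflect) measurable
  with f(2) have "AE v in lborel. ext T f v * ext T g (t - v) = 0"
    unfolding vanish_below_def
  proof eventually_elim
    case (elim v)
    show ?case
    proof (cases "weight T \<bullet> v < a")
      case False
      then have "weight T \<bullet> (t - v) < b" using t by (simp add: inner_diff_right)
      then show ?thesis using elim by simp
    qed (use elim in simp)
  qed
  then have "conv T f g t = 0"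
    unfolding conv_def by (rule integral_eq_zero_AE)
  then show "ext T (conv T f g) t = 0" by (simp add: ext_def)
qed

lemma conv_lin2:
  assumes "\<And>i. T $ i > 0" "f \<in> L1 T" "g \<in> L1 T" "h \<in> L1 T"
  shows "L1_eq T (conv T f (\<lambda>t. c * g t + d * h t)) (\<lambda>t. c * conv T f g t + d * conv T f h t)"
  by (rule L1_opD(3)[OF comm_op_op[OF comm_op_conv]]) fact+

lemma conv_lin1:
  assumes "\<And>i. T $ i > 0" "f \<in> L1 T" "g \<in> L1 T" "h \<in> L1 T"
  shows "L1_eq T (conv T (\<lambda>t. c * g t + d * h t) f) (\<lambda>t. c * conv T g f t + d * conv T h f t)"
  using conv_lin2[OF assms, of c d] conv_commute[OF assms(2,3)] conv_commute[OF assms(2,4)]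
    conv_commute[OF assms(2) L1_linear_comb[OF assms(3,4)]] by simp

text \<open>The difference of squares of the transforms factors, so it remains to bound the sum
  \<open>L a + L b\<close> from below. Here \<open>b > 0\<close> makes \<open>L b\<close> decay
  slower than every exponential, and \<open>L a\<close> can be negative only by an exponentially
  small amount, since \<open>L a * L 1\<close> is a square up to such an error.\<close>

lemma square_root_vanish:
  fixes T :: "real ^ 'n"
  assumes T: "\<And>i. T $ i > 0"
    and a: "a \<in> L1 T" and b: "b \<in> L1 T" and g: "g \<in> L1 T"
    and sq: "L1_eq T (conv T a a) (conv T b b)"
    and gg: "L1_eq T (conv T a (\<lambda>_. 1)) (conv T g g)"
    and pos: "\<And>t. t \<in> box 0 T \<Longrightarrow> 0 < b t"
  shows "vanish_below T 1 (\<lambda>t. a t - b t)"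
proof -
  define u where "u t = a t - b t" for t
  have u: "u \<in> L1 T" unfolding u_def[abs_def] using a b by (rule L1_diff)
  have mu [measurable]: "ext T u \<in> borel_measurable borel" using u by (auto simp: L1_iff)
  have one: "(\<lambda>_. 1) \<in> L1 T" by simp
  have "(\<integral>t. (ext T u t * indicator {t. weight T \<bullet> t < 1} t) * exp (- (\<kappa> \<bullet> t)) \<partial>lborel) = 0"
    if \<kappa>: "\<And>i. 0 \<le> \<kappa> $ i" for \<kappa>
  proof -
    define L where "L f \<sigma> = lap T (ray T \<kappa> \<sigma>) f" for f \<sigma>
    note C = exp_small_lap_conv[OF T \<kappa>, folded L_def]
    have sq_eq: "L (conv T a a) \<sigma> = L (conv T b b) \<sigma>" for \<sigma>
      unfolding L_def by (rule lap_cong[OF conv_L1[OF T a a] conv_L1[OF T b b] sq])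
    have gg_eq: "L (conv T a (\<lambda>_. 1)) \<sigma> = L (conv T g g) \<sigma>" for \<sigma>
      unfolding L_def by (rule lap_cong[OF conv_L1[OF T a one] conv_L1[OF T g g] gg])
    have E1: "exp_small 1 (\<lambda>\<sigma>. L a \<sigma> * L a \<sigma> - L b \<sigma> * L b \<sigma>)"
      using exp_small_diff[OF C[OF b b] C[OF a a]] by (simp add: sq_eq)
    have E2: "exp_small 1 (\<lambda>\<sigma>. L a \<sigma> * L (\<lambda>_. 1) \<sigma> - L g \<sigma> * L g \<sigma>)"
      using exp_small_diff[OF C[OF g g] C[OF a one]] by (simp add: gg_eq)
    have S1: "subexp_below (L (\<lambda>_. 1))" and Sb: "subexp_below (L b)"
      unfolding L_def[abs_def] by (rule subexp_below_lap[OF T \<kappa> one], simp)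
        (rule subexp_below_lap[OF T \<kappa> b pos])
    \<comment> \<open>\<open>L a\<close> exceeds \<open>E\<close> by (L g)^2 / L 1, which is
      nonnegative once \<open>L 1\<close> is positive. Thus \<open>E\<close> is an exponentially
      small lower bound for \<open>L a\<close>.\<close>
    define E where "E \<sigma> = (L a \<sigma> * L (\<lambda>_. 1) \<sigma> - L g \<sigma> * L g \<sigma>) / L (\<lambda>_. 1) \<sigma>" for \<sigma>
    note p1 = subexp_below_pos[OF S1]
    have E: "exp_small 1 E"
    proof (rule exp_small_divide[OF exp_small_mono[OF E2] S1])
      show "\<forall>\<^sub>F \<sigma> in at_top. \<bar>E \<sigma> * L (\<lambda>_. 1) \<sigma>\<bar> \<le> \<bar>L a \<sigma> * L (\<lambda>_. 1) \<sigma> - L g \<sigma> * L g \<sigma>\<bar>"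
        using p1 by eventually_elim (simp add: E_def)
    qed
    have "\<forall>\<^sub>F \<sigma> in at_top. L b \<sigma> + E \<sigma> \<le> L a \<sigma> + L b \<sigma>"
      using p1
    proof eventually_elim
      case (elim \<sigma>)
      have "E \<sigma> * L (\<lambda>_. 1) \<sigma> \<le> L a \<sigma> * L (\<lambda>_. 1) \<sigma>" using elim by (simp add: E_def)
      then show ?case using elim by simp
    qed
    from subexp_below_perturb[OF Sb E _ this] have S: "subexp_below (\<lambda>\<sigma>. L a \<sigma> + L b \<sigma>)" by simp
    have "exp_small 1 (\<lambda>\<sigma>. (L a \<sigma> - L b \<sigma>) * (L a \<sigma> + L b \<sigma>))"
      using E1 by (simp add: algebra_simps)
    then have diff: "exp_small 1 (\<lambda>\<sigma>. L a \<sigma> - L b \<sigma>)" by (rule exp_small_divide[OF _ S])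
    have eq_u: "\<forall>\<^sub>F \<sigma> in at_top. L a \<sigma> - L b \<sigma> = L u \<sigma>"
      using eventually_ge_at_top[of 0]
    proof eventually_elim
      case (elim \<sigma>)
      note i = lap_integrable[OF _ ray_nonneg[OF T \<kappa> elim]]
      show ?case
        unfolding L_def lap_def Bochner_Integration.integral_diff[OF i[OF a] i[OF b], symmetric]
        by (intro Bochner_Integration.integral_cong refl) (simp add: u_def ext_def algebra_simps)
    qed
    have "exp_small 1 (L u)"
      by (rule exp_small_mono[OF diff]) (use eq_u in \<open>auto elim: eventually_mono\<close>)
    then have sm: "exp_small 1 (\<lambda>\<sigma>. \<integral>t. (ext T u t * exp (- (\<kappa> \<bullet> t))) * exp (- (\<sigma> * (weight T \<bullet> t))) \<partial>lborel)"
      unfolding L_def[abs_def] lap_ray .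
    have "(\<integral>t. ext T u t * exp (- (\<kappa> \<bullet> t)) * indicator {t. weight T \<bullet> t < 1} t \<partial>lborel) = 0"
    proof (rule laplace_exp_small_imp_zero[OF lap_integrable[OF u \<kappa>] _ _ sm])
      show "0 \<le> weight T \<bullet> t" if "ext T u t * exp (- (\<kappa> \<bullet> t)) \<noteq> 0" for t
        by (rule inner_cart_nonneg) (use T that ext_nonzero[of T u t] in \<open>auto simp: weight_def intro: less_imp_le\<close>)
    qed measurable
    then show ?thesis by (simp add: mult_ac)
  qed
  then have "AE t in lborel. ext T u t * indicator {t. weight T \<bullet> t < 1} t = 0"
  proof (intro laplace_unique[where T=T])
    show "integrable lborel (\<lambda>t. ext T u t * indicator {t. weight T \<bullet> t < 1} t)"
      by (rule Bochner_Integration.integrable_bound[of _ "ext T u"]) (use u in \<open>auto simp: L1_iff indicator_def\<close>)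
  qed auto
  then show ?thesis
    unfolding vanish_below_def u_def[abs_def, symmetric] by eventually_elim (auto simp: indicator_def)
qed

text \<open>With D f = - 2 b * f, every further convolution of \<open>u\<close> with itself amounts
  to applying \<open>D\<close>. The powers of \<open>u\<close> move upwards in height until they
  leave the box, and then \<open>inj\<close> cancels the factors \<open>D\<close> one by
  one.\<close>

theorem square_root_unique:
  fixes T :: "real ^ 'n::{finite,linorder}"
  assumes T: "\<And>i. T $ i > 0"
    and a: "a \<in> L1 T" and b: "b \<in> L1 T" and g: "g \<in> L1 T"
    and sq: "L1_eq T (conv T a a) (conv T b b)"
    and gg: "L1_eq T (conv T a (\<lambda>_. 1)) (conv T g g)"
    and pos: "\<And>t. t \<in> box 0 T \<Longrightarrow> 0 < b t"
    and inj: "\<And>f. f \<in> L1 T \<Longrightarrow> L1_eq T (conv T b f) (\<lambda>_. 0) \<Longrightarrow> L1_eq T f (\<lambda>_. 0)"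
  shows "L1_eq T a b"
proof -
  define u where "u = (\<lambda>t. 1 * a t + (-1) * b t)"
  \<comment> \<open>The summand with coefficient 0 matches the two-term form of
    \<open>conv_lin2\<close>.\<close>
  define D where "D = (\<lambda>f t. (-2) * conv T b f t + 0 * conv T b f t)"
  have u: "u \<in> L1 T" unfolding u_def using a b by (rule L1_linear_comb)
  note cb = conv_L1[OF T b] and cu = conv_L1[OF T u]
  have D: "D f \<in> L1 T" if "f \<in> L1 T" for f
    unfolding D_def by (intro L1_linear_comb cb that)
  have v1: "vanish_below T 1 u"
    using square_root_vanish[OF T a b g sq gg pos] by (simp add: u_def)
  have uu: "L1_eq T (conv T u u) (D u)"
  proof -
    have 1: "L1_eq T (conv T u u) (\<lambda>t. 1 * conv T a u t + (-1) * conv T b u t)"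
      using conv_lin1[OF T u a b, of 1 "-1"] by (simp add: u_def)
    have 2: "L1_eq T (conv T a u) (\<lambda>t. 1 * conv T a a t + (-1) * conv T a b t)"
      using conv_lin2[OF T a a b, of 1 "-1"] by (simp add: u_def)
    have 3: "L1_eq T (conv T b u) (\<lambda>t. 1 * conv T b a t + (-1) * conv T b b t)"
      using conv_lin2[OF T b a b, of 1 "-1"] by (simp add: u_def)
    show ?thesis
      using 1 2 3 sq unfolding L1_eq_iff
      by eventually_elim (auto simp: D_def conv_commute[OF a b])
  qed
  have comm: "L1_eq T (conv T u (D f)) (D (conv T u f))" if f: "f \<in> L1 T" for f
  proof -
    have "L1_eq T (conv T u (D f)) (\<lambda>t. (-2) * conv T u (conv T b f) t + 0 * conv T u (conv T b f) t)"
      unfolding D_def by (rule conv_lin2[OF T u cb[OF f] cb[OF f]])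
    moreover have "L1_eq T (conv T u (conv T b f)) (conv T b (conv T u f))"
      by (rule comm_op_conv_eq2[OF T comm_op_conv[OF T u] b f])
    ultimately show ?thesis unfolding L1_eq_iff by eventually_elim (simp add: D_def)
  qed
  have D_cong: "L1_eq T (D f) (D h)" if "f \<in> L1 T" "h \<in> L1 T" "L1_eq T f h" for f h
    using conv_cong2[OF T b that] unfolding L1_eq_iff by eventually_elim (simp add: D_def)
  \<comment> \<open>Up to null sets \<open>x k\<close> is the convolution power of \<open>u\<close>
    with \<open>k + 1\<close> factors; this is \<open>step\<close>, and it explains the height
    \<open>Suc k\<close> in \<open>van\<close>.\<close>
  define x where "x k = (D ^^ k) u" for k
  have x: "x k \<in> L1 T" for k by (induction k) (simp_all add: x_def u D)
  have step: "L1_eq T (conv T u (x k)) (x (Suc k))" for k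
  proof (induction k)
    case (Suc k)
    have "L1_eq T (conv T u (x (Suc k))) (D (conv T u (x k)))"
      using comm[OF x[of k]] by (simp add: x_def)
    also have "L1_eq T \<dots> (D (x (Suc k)))" by (rule D_cong[OF cu[OF x] x Suc])
    finally show ?case by (simp add: x_def)
  qed (use uu in \<open>simp add: x_def\<close>)
  have van: "vanish_below T (real (Suc k)) (x k)" for k
  proof (induction k)
    case (Suc k)
    from vanish_below_cong[OF step vanish_below_conv[OF u v1 x Suc]] show ?case by simp
  qed (use v1 in \<open>simp add: x_def\<close>)
  \<comment> \<open>A descending induction from the power that has left the box to
    \<open>x 0 = u\<close>. Subtraction is truncated, so from \<open>k = CARD('n)\<close> on the
    claim merely repeats itself.\<close>
  have "L1_eq T (x (CARD('n) - k)) (\<lambda>_. 0)" for k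
  proof (induction k)
    case 0
    show ?case by (rule vanish_below_card[OF T _ van]) simp
  next
    case (Suc k)
    show ?case
    proof (cases "k < CARD('n)")
      case True
      define m where "m = CARD('n) - Suc k"
      have "CARD('n) - k = Suc m" using True by (simp add: m_def)
      then have "x (CARD('n) - k) = D (x m)" by (simp add: x_def)
      with Suc have "L1_eq T (D (x m)) (\<lambda>_. 0)" by simp
      then have "L1_eq T (conv T b (x m)) (\<lambda>_. 0)"
        unfolding L1_eq_iff by eventually_elim (simp add: D_def)
      from inj[OF x this] show ?thesis by (simp add: m_def)
    qed (use Suc in simp)
  qed
  from this[of "CARD('n)"] have "L1_eq T u (\<lambda>_. 0)" by (simp add: x_def)
  then show ?thesis unfolding L1_eq_iff by eventually_elim (simp add: u_def)
qed

section \<open>The index law determines the family\<close>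

lemma RL_axis:
  fixes f :: "real ^ 'n::{finite,linorder} \<Rightarrow> real"
  shows "RL (axis j a) f = RL_partial j a f"
proof -
  have "distinct xs \<Longrightarrow> foldr (\<lambda>i. RL_partial i (axis j a $ i)) xs f
      = (if j \<in> set xs then RL_partial j a f else f)" for xs
  proof (induction xs)
    case (Cons i xs)
    have "RL_partial i 0 g = g" for g :: "real ^ 'n::_ \<Rightarrow> real" by (simp add: RL_partial_def)
    with Cons show ?case by (auto simp: axis_def)
  qed simp
  from this[of "sorted_list_of_set UNIV"] show ?thesis by (simp add: RL_def)
qed

text \<open>\<open>A\<close> is moved out of one factor and then out of the other. Through this the
  index law for doubled orders becomes an equation between convolution squares.\<close>

lemma conv_square:
  fixes T :: "real ^ 'n::{finite,linorder}"
  assumes T: "\<And>i. T $ i > 0" and A: "comm_op T A"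
  shows "L1_eq T (conv T (A (\<lambda>_. 1)) (A (\<lambda>_. 1))) (A (A (conv T (\<lambda>_. 1) (\<lambda>_. 1))))"
proof -
  note one = L1_const[of 1 T]
  note a = L1_opD[OF comm_op_op[OF A]]
  have "L1_eq T (conv T (A (\<lambda>_. 1)) (A (\<lambda>_. 1))) (A (conv T (\<lambda>_. 1) (A (\<lambda>_. 1))))"
    by (rule L1_eq_sym[OF comm_op_conv_eq[OF T A one a(1)[OF one]]])
  also have "L1_eq T \<dots> (A (A (conv T (\<lambda>_. 1) (\<lambda>_. 1))))"
    by (rule a(2)[OF conv_L1[OF T one a(1)[OF one]] a(1)[OF conv_L1[OF T one one]]
          L1_eq_sym[OF comm_op_conv_eq2[OF T A one one]]])
  finally show ?thesis .
qed

section \<open>Dependence of the power functions on the order\<close>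

lemma pw_pos:
  assumes "t \<in> box 0 T" "\<And>i. 0 \<le> \<alpha> $ i"
  shows "0 < pw \<alpha> t"
  unfolding pw_def
proof (intro prod_pos ballI divide_pos_pos)
  fix i
  show "0 < t $ i powr \<alpha> $ i" using assms(1) by (auto simp: mem_box_cart) (metis less_irrefl)
  show "0 < Gamma (\<alpha> $ i + 1)" by (rule Gamma_real_pos) (use assms(2)[of i] in simp)
qed

lemma pw_eq_RL:
  fixes T :: "real ^ 'n::{finite,linorder}"
  assumes "\<And>i. 0 \<le> \<alpha> $ i"
  shows "L1_eq T (pw \<alpha>) (RL \<alpha> (\<lambda>_. 1))"
  by (rule L1_eqI) (simp add: RL_one assms)

lemma pw_L1:
  fixes T :: "real ^ 'n::{finite,linorder}"
  assumes T: "\<And>i. T $ i > 0" and \<alpha>: "\<And>i. 0 \<le> \<alpha> $ i"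
  shows "pw \<alpha> \<in> L1 T"
proof -
  have "RL \<alpha> (\<lambda>_. 1) \<in> L1 T" by (rule L1_opD(1)[OF comm_op_op[OF comm_op_RL[OF T \<alpha>]] L1_const])
  moreover have "RL \<alpha> (\<lambda>_. 1) \<in> L1 T \<longleftrightarrow> pw \<alpha> \<in> L1 T" by (rule L1_cong) (rule RL_one[OF \<alpha>])
  ultimately show ?thesis by blast
qed

lemma tendsto_pw:
  fixes q :: "nat \<Rightarrow> real ^ 'n"
  assumes q: "q \<longlonglongrightarrow> r" and r: "\<And>i. 0 < r $ i" and t: "\<And>i. 0 < t $ i"
  shows "(\<lambda>m. pw (q m) t) \<longlonglongrightarrow> pw r t"
  unfolding pw_def
proof (intro tendsto_prod)
  fix i
  have qi: "(\<lambda>m. q m $ i) \<longlonglongrightarrow> r $ i" by (rule tendsto_vec_nth[OF q])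
  have "r $ i + 1 \<notin> \<int>\<^sub>\<le>\<^sub>0" using r[of i] by (auto elim!: nonpos_Ints_cases')
  moreover have "Gamma (r $ i + 1) \<noteq> 0"
    by (rule less_imp_neq[THEN not_sym], rule Gamma_real_pos) (use r[of i] in simp)
  ultimately show "(\<lambda>m. t $ i powr q m $ i / Gamma (q m $ i + 1)) \<longlonglongrightarrow> t $ i powr r $ i / Gamma (r $ i + 1)"
    using t[of i] by (intro tendsto_divide tendsto_powr tendsto_const qi tendsto_Gamma tendsto_add) auto
qed

lemma pw_dist_tendsto:
  fixes q :: "nat \<Rightarrow> real ^ 'n::{finite,linorder}"
  assumes T: "\<And>i. T $ i > 0" and q: "q \<longlonglongrightarrow> r" and r: "\<And>i. 0 < r $ i" and q0: "\<And>m i. 0 \<le> q m $ i"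
  shows "(\<lambda>m. L1_dist T (pw (q m)) (pw r)) \<longlonglongrightarrow> 0"
proof -
  \<comment> \<open>A corner dominating the whole box: powers increase with the base, so
    \<open>pw (q m) S\<close> bounds \<open>pw (q m)\<close> on the box, and as a convergent
    sequence these values are bounded in \<open>m\<close>.\<close>
  define S where "S = (\<chi> i. max 1 (T $ i))"
  have r0: "0 \<le> r $ i" for i using r[of i] by simp
  note L = pw_L1[OF T q0, unfolded L1_iff] pw_L1[OF T r0, unfolded L1_iff]
  have S: "0 < S $ i" for i by (simp add: S_def)
  have "Bseq (\<lambda>m. pw (q m) S)"
    by (rule convergent_imp_Bseq[OF convergentI[OF tendsto_pw[OF q r S]]])
  then obtain C where C: "\<And>m. \<bar>pw (q m) S\<bar> \<le> C" by (auto simp: Bseq_def)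
  have le: "\<bar>pw (q m) t\<bar> \<le> C" if t: "t \<in> box 0 T" for m t
  proof -
    have "0 \<le> t $ i powr q m $ i / Gamma (q m $ i + 1)
        \<and> t $ i powr q m $ i / Gamma (q m $ i + 1) \<le> S $ i powr q m $ i / Gamma (q m $ i + 1)" for i
    proof -
      have "0 < Gamma (q m $ i + 1)" by (rule Gamma_real_pos) (use q0[of m i] in simp)
      moreover have "0 < t $ i" "t $ i \<le> S $ i" using t by (auto simp: mem_box_cart S_def le_max_iff_disj less_imp_le)
      ultimately show ?thesis using q0[of m i] by (auto intro!: divide_right_mono powr_mono2)
    qed
    then have "pw (q m) t \<le> pw (q m) S" unfolding pw_def by (intro prod_mono) blast
    then show ?thesis using pw_pos[OF t q0, of m] C[of m] by linarith
  qed
  have "(\<lambda>m. \<integral>t. \<bar>ext T (pw (q m)) t - ext T (pw r) t\<bar> \<partial>lborel) \<longlonglongrightarrow> (\<integral>t. 0 \<partial>(lborel :: (real ^ 'n::_) measure))"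
  proof (rule integral_dominated_convergence[where w="\<lambda>t. C * indicator (box 0 T) t + \<bar>ext T (pw r) t\<bar>"])
    show "integrable lborel (\<lambda>t. C * indicator (box 0 T) t + \<bar>ext T (pw r) t\<bar>)"
      using L(2) by (auto simp: emeasure_lborel_box_eq)
    show "AE t in lborel. (\<lambda>m. \<bar>ext T (pw (q m)) t - ext T (pw r) t\<bar>) \<longlonglongrightarrow> 0"
    proof (rule AE_I2)
      fix t
      show "(\<lambda>m. \<bar>ext T (pw (q m)) t - ext T (pw r) t\<bar>) \<longlonglongrightarrow> 0"
      proof (cases "t \<in> box 0 T")
        case True
        then have "0 < t $ i" for i by (auto simp: mem_box_cart)
        from tendsto_rabs[OF tendsto_diff[OF tendsto_pw[OF q r this] tendsto_const[of "pw r t"]]]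
        show ?thesis using True by simp
      qed simp
    qed
    show "AE t in lborel. norm \<bar>ext T (pw (q m)) t - ext T (pw r) t\<bar> \<le> C * indicator (box 0 T) t + \<bar>ext T (pw r) t\<bar>" for m
    proof (rule AE_I2)
      fix t
      show "norm \<bar>ext T (pw (q m)) t - ext T (pw r) t\<bar> \<le> C * indicator (box 0 T) t + \<bar>ext T (pw r) t\<bar>"
        using le[of t m] by (cases "t \<in> box 0 T") auto
    qed
  qed (use L in auto)
  then show ?thesis by (simp add: L1_dist_ext)
qed

lemma conv_tendsto:
  assumes "f \<in> L1 T" "g \<in> L1 T" "\<And>m. s m \<in> L1 T" "(\<lambda>m. L1_dist T (s m) g) \<longlonglongrightarrow> 0"
  shows "(\<lambda>m. L1_dist T (conv T f (s m)) (conv T f g)) \<longlonglongrightarrow> 0"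
proof (rule real_tendsto_sandwich[OF _ _ tendsto_const tendsto_mult_right_zero[OF assms(4)]])
  show "\<forall>\<^sub>F m in sequentially. L1_dist T (conv T f (s m)) (conv T f g)
      \<le> (\<integral>t. \<bar>ext T f t\<bar> \<partial>lborel) * L1_dist T (s m) g"
    using assms(1-3) by (intro always_eventually allI conv_dist_le)
qed simp

section \<open>Families of operators obeying the index law\<close>

locale fractional_family =
  fixes T :: "real ^ 'n::{finite,linorder}"
    and J :: "real ^ 'n::_ \<Rightarrow> (real ^ 'n::_ \<Rightarrow> real) \<Rightarrow> (real ^ 'n::_ \<Rightarrow> real)"
  assumes T_pos: "\<And>i. T $ i > 0"
    and J_op: "\<And>\<alpha>. (\<And>i. \<alpha> $ i \<ge> 0) \<Longrightarrow> L1_op T (J \<alpha>)"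
    and J_axis: "\<And>i f. f \<in> L1 T \<Longrightarrow> L1_eq T (J (axis i 1) f) (RL (axis i 1) f)"
    and J_add: "\<And>\<alpha> \<beta> f. (\<And>i. \<alpha> $ i \<ge> 0) \<Longrightarrow> (\<And>i. \<beta> $ i \<ge> 0) \<Longrightarrow> f \<in> L1 T \<Longrightarrow>
          L1_eq T (J (\<alpha> + \<beta>) f) (J \<alpha> (J \<beta> f))"
begin

text \<open>The index law read in both orders for \<open>\<alpha> + axis j 1\<close>, where
  \<open>J (axis j 1)\<close> is known to be integration.\<close>

lemma J_comm_op:
  assumes \<alpha>: "\<And>i. \<alpha> $ i \<ge> 0"
  shows "comm_op T (J \<alpha>)"
  unfolding comm_op_def
proof (intro conjI allI ballI)
  show "L1_op T (J \<alpha>)" by (rule J_op[OF \<alpha>])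
  fix j f assume f: "f \<in> L1 T"
  have ax: "0 \<le> (axis j 1 :: real ^ 'n::_) $ i" for i by (simp add: axis_def)
  note a = L1_opD[OF J_op[OF \<alpha>]]
  have I: "L1_eq T (RL_partial j 1 g) (J (axis j 1) g)" if "g \<in> L1 T" for g
    using L1_eq_sym[OF J_axis[OF that, of j]] by (simp add: RL_axis)
  have "L1_eq T (J \<alpha> (RL_partial j 1 f)) (J \<alpha> (J (axis j 1) f))"
    by (rule a(2)[OF RL_partial_1_L1[OF T_pos f] L1_opD(1)[OF J_op[OF ax] f] I[OF f]])
  also have "L1_eq T \<dots> (J (\<alpha> + axis j 1) f)" by (rule L1_eq_sym[OF J_add[OF \<alpha> ax f]])
  also have "L1_eq T \<dots> (J (axis j 1) (J \<alpha> f))"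
    unfolding add.commute[of \<alpha>] by (rule J_add[OF ax \<alpha> f])
  also have "L1_eq T \<dots> (RL_partial j 1 (J \<alpha> f))" by (rule L1_eq_sym[OF I[OF a(1)[OF f]]])
  finally show "L1_eq T (J \<alpha> (RL_partial j 1 f)) (RL_partial j 1 (J \<alpha> f))" .
qed

definition agrees :: "real ^ 'n::_ \<Rightarrow> bool" where
  "agrees \<alpha> \<longleftrightarrow> (\<forall>i. 0 \<le> \<alpha> $ i) \<and> (\<forall>f\<in>L1 T. L1_eq T (J \<alpha> f) (RL \<alpha> f))"

lemma agrees_if_one:
  assumes "\<And>i. 0 \<le> \<alpha> $ i" "L1_eq T (J \<alpha> (\<lambda>_. 1)) (pw \<alpha>)"
  shows "agrees \<alpha>"
  unfolding agrees_def
  using assms(1) comm_op_agree[OF T_pos J_comm_op[OF assms(1)] comm_op_RL[OF T_pos assms(1)]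
      L1_eq_trans[OF assms(2) pw_eq_RL[OF assms(1)]]] by blast

lemma agrees_one:
  assumes "agrees \<alpha>"
  shows "L1_eq T (J \<alpha> (\<lambda>_. 1)) (pw \<alpha>)"
proof -
  have "L1_eq T (J \<alpha> (\<lambda>_. 1)) (RL \<alpha> (\<lambda>_. 1))" using assms by (simp add: agrees_def)
  also have "L1_eq T \<dots> (pw \<alpha>)" by (rule L1_eq_sym[OF pw_eq_RL]) (use assms in \<open>simp add: agrees_def\<close>)
  finally show ?thesis .
qed

lemma agrees_add:
  assumes "agrees \<alpha>" "agrees \<beta>"
  shows "agrees (\<alpha> + \<beta>)"
  unfolding agrees_def
proof (intro conjI allI ballI)
  have \<alpha>: "\<And>i. 0 \<le> \<alpha> $ i" "\<And>f. f \<in> L1 T \<Longrightarrow> L1_eq T (J \<alpha> f) (RL \<alpha> f)"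
    and \<beta>: "\<And>i. 0 \<le> \<beta> $ i" "\<And>f. f \<in> L1 T \<Longrightarrow> L1_eq T (J \<beta> f) (RL \<beta> f)"
    using assms by (auto simp: agrees_def)
  show "0 \<le> (\<alpha> + \<beta>) $ i" for i using \<alpha>(1) \<beta>(1) by simp
  fix f assume f: "f \<in> L1 T"
  have R: "RL \<beta> f \<in> L1 T" by (rule L1_opD(1)[OF comm_op_op[OF comm_op_RL[OF T_pos \<beta>(1)]] f])
  have "L1_eq T (J (\<alpha> + \<beta>) f) (J \<alpha> (J \<beta> f))" by (rule J_add[OF \<alpha>(1) \<beta>(1) f])
  also have "L1_eq T \<dots> (J \<alpha> (RL \<beta> f))"
    by (rule L1_opD(2)[OF J_op[OF \<alpha>(1)] L1_opD(1)[OF J_op[OF \<beta>(1)] f] R \<beta>(2)[OF f]])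
  also have "L1_eq T \<dots> (RL \<alpha> (RL \<beta> f))" by (rule \<alpha>(2)[OF R])
  also have "L1_eq T \<dots> (RL (\<alpha> + \<beta>) f)" by (rule L1_eq_sym[OF RL_add[OF T_pos \<alpha>(1) \<beta>(1) f]])
  finally show "L1_eq T (J (\<alpha> + \<beta>) f) (RL (\<alpha> + \<beta>) f)" .
qed

text \<open>Multiples start at 1, because \<open>J 0\<close> has not been identified with the
  identity at this stage.\<close>

lemma agrees_multiple: "agrees \<alpha> \<Longrightarrow> agrees (real (Suc k) *\<^sub>R \<alpha>)"
proof (induction k)
  case (Suc k)
  have "real (Suc (Suc k)) *\<^sub>R \<alpha> = real (Suc k) *\<^sub>R \<alpha> + \<alpha>" by (simp add: vec_eq_iff algebra_simps)
  then show ?case using agrees_add[OF Suc.IH[OF Suc.prems] Suc.prems] by simp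
qed simp

text \<open>Besides agreement at order 2c, which yields equal squares, order c / 2 enters: about
  \<open>J (axis i (c / 2))\<close> only the index law is used, to exhibit the value at 1 of order
  c, convolved with 1, as a square. That settles the sign.\<close>

lemma agrees_halve:
  assumes c: "c > 0" and ag: "agrees (axis i (2 * c))"
  shows "agrees (axis i c)"
proof -
  have ax: "0 \<le> axis i d $ j" if "0 \<le> d" for d :: real and j using that by (simp add: axis_def)
  have dbl: "axis i d + axis i d = (axis i (2 * d) :: real ^ 'n::_)" for d :: real
    by (simp add: vec_eq_iff axis_def)
  note ac = ax[of c, OF less_imp_le[OF c]]
  have ac2: "0 \<le> axis i (c / 2) $ j" for j using ax[of "c / 2"] c by simp
  let ?one = "\<lambda>_ :: real ^ 'n::_. 1 :: real" and ?A = "J (axis i c)" and ?G = "J (axis i (c / 2))" and ?B = "RL (axis i c)"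
  note one = L1_const[of 1 T]
  let ?h = "conv T ?one ?one"
  have h: "?h \<in> L1 T" by (rule conv_L1[OF T_pos one one])
  note A = J_comm_op[OF ac] and G = J_comm_op[OF ac2] and B = comm_op_RL[OF T_pos ac]
  note mA = L1_opD(1)[OF comm_op_op[OF A]] and mG = L1_opD(1)[OF comm_op_op[OF G]]
    and mB = L1_opD(1)[OF comm_op_op[OF B]]
  define b where "b = pw (axis i c :: real ^ 'n::_)"
  have b: "b \<in> L1 T" unfolding b_def by (rule pw_L1[OF T_pos ac])
  have bB: "L1_eq T b (?B ?one)" unfolding b_def by (rule pw_eq_RL[OF ac])
  have "L1_eq T (?A ?one) b"
  proof (rule square_root_unique[OF T_pos mA[OF one] b mG[OF one]])
    have "L1_eq T (conv T (?A ?one) (?A ?one)) (?A (?A ?h))" by (rule conv_square[OF T_pos A])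
    also have "L1_eq T \<dots> (J (axis i (2 * c)) ?h)"
      using L1_eq_sym[OF J_add[OF ac ac h]] by (simp only: dbl)
    also have "L1_eq T \<dots> (RL (axis i (2 * c)) ?h)" using ag h by (simp add: agrees_def)
    also have "L1_eq T \<dots> (?B (?B ?h))"
      using RL_add[OF T_pos ac ac h] by (simp only: dbl)
    also have "L1_eq T \<dots> (conv T (?B ?one) (?B ?one))" by (rule L1_eq_sym[OF conv_square[OF T_pos B]])
    also have "L1_eq T \<dots> (conv T b b)"
      using L1_eq_sym[OF bB] b mB[OF one] by (intro conv_cong[OF T_pos])
    finally show "L1_eq T (conv T (?A ?one) (?A ?one)) (conv T b b)" .
    have "L1_eq T (conv T (?A ?one) ?one) (?A ?h)"
      by (rule L1_eq_sym[OF comm_op_conv_eq[OF T_pos A one one]])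
    also have "L1_eq T \<dots> (?G (?G ?h))"
      using J_add[OF ac2 ac2 h] by (simp add: dbl)
    also have "L1_eq T \<dots> (conv T (?G ?one) (?G ?one))" by (rule L1_eq_sym[OF conv_square[OF T_pos G]])
    finally show "L1_eq T (conv T (?A ?one) ?one) (conv T (?G ?one) (?G ?one))" .
    show "0 < b t" if "t \<in> box 0 T" for t unfolding b_def by (rule pw_pos[OF that ac])
    show "L1_eq T f (\<lambda>_. 0)" if "f \<in> L1 T" "L1_eq T (conv T b f) (\<lambda>_. 0)" for f
      by (rule conv_RL_one_injective[OF T_pos ac b bB that])
  qed
  then show ?thesis unfolding b_def by (rule agrees_if_one[OF ac])
qed

lemma agrees_dyadic_axis: "agrees (axis i (1 / 2 ^ m))"
proof (induction m)
  case 0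
  show ?case using J_axis by (auto simp: agrees_def axis_def)
next
  case (Suc m)
  show ?case by (rule agrees_halve) (use Suc in simp_all)
qed

lemma agrees_dyadic: "agrees (\<chi> i. real (Suc (k i)) / 2 ^ m)"
proof -
  have ax: "agrees (axis i (real (Suc (k i)) / 2 ^ m))" for i
  proof -
    have "real (Suc (k i)) *\<^sub>R axis i (1 / 2 ^ m) = (axis i (real (Suc (k i)) / 2 ^ m) :: real ^ 'n::_)"
      by (simp add: vec_eq_iff axis_def)
    then show ?thesis using agrees_multiple[OF agrees_dyadic_axis[of i m], of "k i"] by simp
  qed
  have sum: "agrees (\<Sum>i\<in>S. axis i (real (Suc (k i)) / 2 ^ m))" if "finite S" "S \<noteq> {}" for S :: "'n set"
    using that by (induction rule: finite_ne_induct) (simp_all add: ax agrees_add del: of_nat_Suc)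
  have "(\<Sum>i\<in>UNIV. axis i (real (Suc (k i)) / 2 ^ m)) = (\<chi> i. real (Suc (k i)) / 2 ^ m)"
    by (simp add: vec_eq_iff axis_def)
  with sum[of UNIV] show ?thesis by simp
qed

lemma dyadic_approximation:
  assumes r: "\<And>i. 0 < r $ i"
  obtains q where "q \<longlonglongrightarrow> r" "\<And>m. agrees (q m)" "\<And>m i. 0 < q m $ i"
proof
  \<comment> \<open>Rounding down and adding one keeps the numerators positive, as
    \<open>agrees_dyadic\<close> requires, and stays within \<open>(1 / 2) ^ m\<close> of
    \<open>r $ i\<close>.\<close>
  define q where "q m = (\<chi> i. real (Suc (nat \<lfloor>r $ i * 2 ^ m\<rfloor>)) / 2 ^ m)" for m :: nat
  show "agrees (q m)" for m unfolding q_def by (rule agrees_dyadic)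
  show "0 < q m $ i" for m i by (simp add: q_def)
  show "q \<longlonglongrightarrow> r"
  proof (rule vec_tendstoI)
    fix i
    have "\<bar>q m $ i - r $ i\<bar> \<le> (1 / 2) ^ m" for m
    proof -
      have "real (nat \<lfloor>r $ i * 2 ^ m\<rfloor>) = of_int \<lfloor>r $ i * 2 ^ m\<rfloor>"
        using r[of i] by simp
      then have "r $ i * 2 ^ m \<le> real (Suc (nat \<lfloor>r $ i * 2 ^ m\<rfloor>))" "real (Suc (nat \<lfloor>r $ i * 2 ^ m\<rfloor>)) \<le> r $ i * 2 ^ m + 1"
        by linarith+
      then have "\<bar>real (Suc (nat \<lfloor>r $ i * 2 ^ m\<rfloor>)) - r $ i * 2 ^ m\<bar> / 2 ^ m \<le> 1 / 2 ^ m"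
        by (intro divide_right_mono) auto
      moreover have "q m $ i - r $ i = (real (Suc (nat \<lfloor>r $ i * 2 ^ m\<rfloor>)) - r $ i * 2 ^ m) / 2 ^ m"
        by (simp add: q_def diff_divide_distrib del: of_nat_Suc)
      ultimately show ?thesis by (simp add: abs_divide power_one_over del: of_nat_Suc)
    qed
    then show "(\<lambda>m. q m $ i) \<longlonglongrightarrow> r $ i"
      by (intro LIM_zero_cancel[OF Lim_null_comparison[OF _ LIMSEQ_realpow_zero[of "1 / 2"]]])
         (auto intro: always_eventually)
  qed
qed

text \<open>Continuity is available at a single order, so every approximating sequence has to
  converge to it. Dyadic orders identify the value at 1 there; a smaller order
  \<open>\<beta>\<close> is reached by adding to it dyadic approximations of the difference and
  cancelling that difference afterwards.\<close>

theorem agrees_all: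
  assumes \<alpha>\<^sub>0: "\<And>i. 0 < \<alpha>\<^sub>0 $ i"
    and cont: "((\<lambda>\<alpha>. L1_dist T (J \<alpha> (\<lambda>_. 1)) (J \<alpha>\<^sub>0 (\<lambda>_. 1))) \<longlongrightarrow> 0)
            (at \<alpha>\<^sub>0 within {\<alpha>. \<forall>i. \<alpha> $ i > 0})"
    and \<alpha>: "\<And>i. 0 \<le> \<alpha> $ i"
  shows "agrees \<alpha>"
proof -
  note one = L1_const[of 1 T]
  have a0: "0 \<le> \<alpha>\<^sub>0 $ i" for i using \<alpha>\<^sub>0[of i] by simp
  have lim: "(\<lambda>m. L1_dist T (J (s m) (\<lambda>_. 1)) (J \<alpha>\<^sub>0 (\<lambda>_. 1))) \<longlonglongrightarrow> 0"
    if s: "s \<longlonglongrightarrow> \<alpha>\<^sub>0" "\<And>m i. 0 < s m $ i" for s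
  proof (rule LIMSEQ_I)
    fix e :: real assume "e > 0"
    from tendstoD[OF cont this] obtain d where d: "d > 0"
      "\<And>\<alpha>. (\<And>i. \<alpha> $ i > 0) \<Longrightarrow> \<alpha> \<noteq> \<alpha>\<^sub>0 \<Longrightarrow> dist \<alpha> \<alpha>\<^sub>0 < d \<Longrightarrow> L1_dist T (J \<alpha> (\<lambda>_. 1)) (J \<alpha>\<^sub>0 (\<lambda>_. 1)) < e"
      unfolding eventually_at by auto
    from metric_LIMSEQ_D[OF s(1) d(1)] obtain N where N: "\<And>m. m \<ge> N \<Longrightarrow> dist (s m) \<alpha>\<^sub>0 < d" by blast
    \<comment> \<open>The punctured limit says nothing when \<open>s m\<close> is
      \<open>\<alpha>\<^sub>0\<close> itself, but there the distance is 0.\<close>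
    have "L1_dist T (J (s m) (\<lambda>_. 1)) (J \<alpha>\<^sub>0 (\<lambda>_. 1)) < e" if "m \<ge> N" for m
      using d(2)[OF s(2) _ N[OF that]] \<open>e > 0\<close> by (cases "s m = \<alpha>\<^sub>0") auto
    then show "\<exists>N. \<forall>m\<ge>N. norm (L1_dist T (J (s m) (\<lambda>_. 1)) (J \<alpha>\<^sub>0 (\<lambda>_. 1)) - 0) < e"
      by (intro exI[of _ N]) simp
  qed
  note Jm = L1_opD(1)[OF J_op]
  have J0: "L1_eq T (J \<alpha>\<^sub>0 (\<lambda>_. 1)) (pw \<alpha>\<^sub>0)"
  proof -
    obtain q where q: "q \<longlonglongrightarrow> \<alpha>\<^sub>0" "\<And>m. agrees (q m)" "\<And>m i. 0 < q m $ i"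
      by (rule dyadic_approximation[OF \<alpha>\<^sub>0]) blast
    have q0: "0 \<le> q m $ i" for m i using q(3)[of m i] by simp
    show ?thesis
    proof (rule L1_limit_unique[OF Jm[OF a0 one] pw_L1[OF T_pos a0] Jm[OF q0 one] lim[OF q(1,3)]])
      have "L1_dist T (J (q m) (\<lambda>_. 1)) (pw \<alpha>\<^sub>0) = L1_dist T (pw (q m)) (pw \<alpha>\<^sub>0)" for m
        by (rule L1_dist_cong[OF agrees_one[OF q(2)] L1_eq_refl Jm[OF q0 one] pw_L1[OF T_pos q0]
              pw_L1[OF T_pos a0] pw_L1[OF T_pos a0]])
      then show "(\<lambda>m. L1_dist T (J (q m) (\<lambda>_. 1)) (pw \<alpha>\<^sub>0)) \<longlonglongrightarrow> 0"
        using pw_dist_tendsto[OF T_pos q(1) \<alpha>\<^sub>0 q0] by simp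
    qed
  qed
  \<comment> \<open>The case \<open>\<beta> = 0\<close> is included, and this is where
    \<open>J 0\<close> is identified.\<close>
  have small: "agrees \<beta>" if \<beta>: "\<And>i. 0 \<le> \<beta> $ i" "\<And>i. \<beta> $ i < \<alpha>\<^sub>0 $ i" for \<beta>
  proof -
    define r where "r = \<alpha>\<^sub>0 - \<beta>"
    have r_\<beta>: "r + \<beta> = \<alpha>\<^sub>0" by (simp add: r_def)
    have r: "0 < r $ i" for i using \<beta>(2)[of i] by (simp add: r_def)
    have r0: "0 \<le> r $ i" for i using r[of i] by simp
    obtain q where q: "q \<longlonglongrightarrow> r" "\<And>m. agrees (q m)" "\<And>m i. 0 < q m $ i"
      by (rule dyadic_approximation[OF r]) blast
    have q0: "0 \<le> q m $ i" for m i using q(3)[of m i] by simp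
    have s: "(\<lambda>m. q m + \<beta>) \<longlonglongrightarrow> \<alpha>\<^sub>0" using tendsto_add[OF q(1) tendsto_const[of \<beta>]] by (simp add: r_def)
    have s_pos: "0 < (q m + \<beta>) $ i" for m i using q(3)[of m i] \<beta>(1)[of i] by simp
    have s0: "0 \<le> (q m + \<beta>) $ i" for m i using s_pos[of m i] by simp
    define f where "f = J \<beta> (\<lambda>_. 1)"
    have f: "f \<in> L1 T" unfolding f_def by (rule Jm[OF \<beta>(1) one])
    note pr = pw_L1[OF T_pos r0] and pq = pw_L1[OF T_pos q0] and p0 = pw_L1[OF T_pos a0]
      and p\<beta> = pw_L1[OF T_pos \<beta>(1)]
    \<comment> \<open>Convolving with 1 turns the operator \<open>RL \<gamma>\<close> into
      convolution with the function \<open>pw \<gamma>\<close>, so L1 convergence of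
      \<open>pw (q m)\<close> is enough to control the operators \<open>RL (q m)\<close> on
      \<open>f\<close>.\<close>
    have shift: "L1_eq T (conv T (\<lambda>_. 1) (RL \<gamma> g)) (conv T (pw \<gamma>) g)"
      if \<gamma>: "\<And>i. 0 \<le> \<gamma> $ i" and g: "g \<in> L1 T" for \<gamma> g
    proof -
      note R = comm_op_RL[OF T_pos \<gamma>]
      have "L1_eq T (conv T (\<lambda>_. 1) (RL \<gamma> g)) (RL \<gamma> (conv T (\<lambda>_. 1) g))"
        by (rule L1_eq_sym[OF comm_op_conv_eq2[OF T_pos R one g]])
      also have "L1_eq T \<dots> (conv T (RL \<gamma> (\<lambda>_. 1)) g)" by (rule comm_op_conv_eq[OF T_pos R one g])
      also have "L1_eq T \<dots> (conv T (pw \<gamma>) g)"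
        by (rule conv_cong1[OF T_pos L1_opD(1)[OF comm_op_op[OF R] one] pw_L1[OF T_pos \<gamma>] L1_eq_sym[OF pw_eq_RL[OF \<gamma>]] g])
      finally show ?thesis .
    qed
    have Js: "L1_eq T (conv T (\<lambda>_. 1) (J (q m + \<beta>) (\<lambda>_. 1))) (conv T f (pw (q m)))" for m
    proof -
      have "L1_eq T (J (q m + \<beta>) (\<lambda>_. 1)) (J (q m) f)" unfolding f_def by (rule J_add[OF q0 \<beta>(1) one])
      also have "L1_eq T \<dots> (RL (q m) f)" using q(2)[of m] f by (simp add: agrees_def)
      finally have "L1_eq T (conv T (\<lambda>_. 1) (J (q m + \<beta>) (\<lambda>_. 1))) (conv T (\<lambda>_. 1) (RL (q m) f))"
        by (rule conv_cong2[OF T_pos one Jm[OF s0 one] L1_opD(1)[OF comm_op_op[OF comm_op_RL[OF T_pos q0]] f]])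
      also have "L1_eq T \<dots> (conv T (pw (q m)) f)" by (rule shift[OF q0 f])
      finally show ?thesis unfolding conv_commute[OF f pq] .
    qed
    \<comment> \<open>Two limits of the sequence \<open>conv T f (pw (q m))\<close>: one from the
      convergence of \<open>pw (q m)\<close> to \<open>pw r\<close>, the other from
      \<open>Js\<close> and the continuity at \<open>\<alpha>\<^sub>0\<close>, to which
      \<open>q m + \<beta>\<close> converges.\<close>
    have "L1_eq T (conv T f (pw r)) (conv T (\<lambda>_. 1) (J \<alpha>\<^sub>0 (\<lambda>_. 1)))"
    proof (rule L1_limit_unique[OF conv_L1[OF T_pos f pr] conv_L1[OF T_pos one Jm[OF a0 one]] conv_L1[OF T_pos f pq]])
      show "(\<lambda>m. L1_dist T (conv T f (pw (q m))) (conv T f (pw r))) \<longlonglongrightarrow> 0"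
        by (rule conv_tendsto[OF f pr pq pw_dist_tendsto[OF T_pos q(1) r q0]])
      have "L1_dist T (conv T f (pw (q m))) (conv T (\<lambda>_. 1) (J \<alpha>\<^sub>0 (\<lambda>_. 1)))
        = L1_dist T (conv T (\<lambda>_. 1) (J (q m + \<beta>) (\<lambda>_. 1))) (conv T (\<lambda>_. 1) (J \<alpha>\<^sub>0 (\<lambda>_. 1)))" for m
        by (rule L1_dist_cong[OF L1_eq_sym[OF Js] L1_eq_refl])
           (intro conv_L1[OF T_pos] f pq one Jm a0 s0)+
      then show "(\<lambda>m. L1_dist T (conv T f (pw (q m))) (conv T (\<lambda>_. 1) (J \<alpha>\<^sub>0 (\<lambda>_. 1)))) \<longlonglongrightarrow> 0"
        using conv_tendsto[OF one Jm[OF a0 one] Jm[OF s0 one] lim[OF s s_pos]] by simp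
    qed
    also have "L1_eq T \<dots> (conv T (\<lambda>_. 1) (RL r (pw \<beta>)))"
    proof (rule conv_cong2[OF T_pos one Jm[OF a0 one] L1_opD(1)[OF comm_op_op[OF comm_op_RL[OF T_pos r0]] p\<beta>]])
      have "L1_eq T (pw \<alpha>\<^sub>0) (RL r (pw \<beta>))"
        by (rule L1_eqI) (simp add: RL_pw[OF r0 \<beta>(1)] r_\<beta>)
      with J0 show "L1_eq T (J \<alpha>\<^sub>0 (\<lambda>_. 1)) (RL r (pw \<beta>))" by (rule L1_eq_trans)
    qed
    also have "L1_eq T \<dots> (conv T (pw r) (pw \<beta>))" by (rule shift[OF r0 p\<beta>])
    finally have "L1_eq T (conv T (pw r) f) (conv T (pw r) (pw \<beta>))" unfolding conv_commute[OF f pr] .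
    moreover have "L1_eq T (conv T (pw r) (\<lambda>t. 1 * f t + (-1) * pw \<beta> t))
        (\<lambda>t. 1 * conv T (pw r) f t + (-1) * conv T (pw r) (pw \<beta>) t)"
      by (rule conv_lin2[OF T_pos pr f p\<beta>])
    ultimately have "L1_eq T (conv T (pw r) (\<lambda>t. 1 * f t + (-1) * pw \<beta> t)) (\<lambda>_. 0)"
      unfolding L1_eq_iff by eventually_elim simp
    from conv_RL_one_injective[OF T_pos r0 pr pw_eq_RL[OF r0] L1_linear_comb[OF f p\<beta>] this]
    have "L1_eq T (J \<beta> (\<lambda>_. 1)) (pw \<beta>)"
      unfolding L1_eq_iff f_def by eventually_elim simp
    then show ?thesis by (rule agrees_if_one[OF \<beta>(1)])
  qed
  \<comment> \<open>Dividing \<open>\<alpha>\<close> by \<open>Suc k\<close> brings it below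
    \<open>\<alpha>\<^sub>0\<close> in every coordinate, where \<open>small\<close> applies;
    \<open>agrees_multiple\<close> then restores it.\<close>
  obtain k :: nat where k: "\<And>i. \<alpha> $ i / \<alpha>\<^sub>0 $ i < real (Suc k)"
  proof -
    have "\<exists>k::nat. \<forall>i. \<alpha> $ i / \<alpha>\<^sub>0 $ i < real k"
      using reals_Archimedean2[of "Max (range (\<lambda>i. \<alpha> $ i / \<alpha>\<^sub>0 $ i))"]
      by (auto simp: Max_less_iff)
    then obtain k :: nat where "\<forall>i. \<alpha> $ i / \<alpha>\<^sub>0 $ i < real k" by blast
    then show ?thesis by (intro that[of k]) (auto intro: less_trans)
  qed
  define \<beta> where "\<beta> = (1 / real (Suc k)) *\<^sub>R \<alpha>"
  have "agrees \<beta>"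
  proof (rule small)
    show "0 \<le> \<beta> $ i" for i using \<alpha>[of i] by (simp add: \<beta>_def)
    show "\<beta> $ i < \<alpha>\<^sub>0 $ i" for i
      using k[of i] \<alpha>\<^sub>0[of i] by (simp add: \<beta>_def field_simps del: of_nat_Suc)
  qed
  from agrees_multiple[OF this, of k] show ?thesis by (simp add: \<beta>_def del: of_nat_Suc)
qed

end

theorem corollary5p5:
  fixes T :: "real ^ 'n::{finite,linorder}"
    and J :: "real ^ 'n::_ \<Rightarrow> (real ^ 'n::_ \<Rightarrow> real) \<Rightarrow> (real ^ 'n::_ \<Rightarrow> real)"
  assumes "CARD('n) > 1"
    and "\<forall>i. T $ i > 0"
    and operator: "\<And>\<alpha>. \<forall>i. \<alpha> $ i \<ge> 0 \<Longrightarrow>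
          L1_operator T (J \<alpha>) \<and> L1_linear T (J \<alpha>) \<and> L1_continuous T (J \<alpha>)"
    and identity: "\<And>i f. f \<in> L1 T \<Longrightarrow> L1_eq T (J (axis i 1) f) (RL (axis i 1) f)"
    and index_law: "\<And>\<alpha> \<beta> f. \<forall>i. \<alpha> $ i \<ge> 0 \<Longrightarrow> \<forall>i. \<beta> $ i \<ge> 0 \<Longrightarrow> f \<in> L1 T \<Longrightarrow>
          L1_eq T (J (\<alpha> + \<beta>) f) (J \<alpha> (J \<beta> f))"
    and continuity: "\<exists>\<alpha>\<^sub>0. (\<forall>i. \<alpha>\<^sub>0 $ i > 0) \<and>
          ((\<lambda>\<alpha>. L1_dist T (J \<alpha> (\<lambda>_. 1)) (J \<alpha>\<^sub>0 (\<lambda>_. 1))) \<longlongrightarrow> 0)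
            (at \<alpha>\<^sub>0 within {\<alpha>. \<forall>i. \<alpha> $ i > 0})"
  shows "\<forall>\<alpha>. (\<forall>i. \<alpha> $ i \<ge> 0) \<longrightarrow> (\<forall>f\<in>L1 T. L1_eq T (J \<alpha> f) (RL \<alpha> f))"
proof -
  interpret fractional_family T J
  proof
    show "T $ i > 0" for i using assms(2) by simp
    show "L1_op T (J \<alpha>)" if "\<And>i. \<alpha> $ i \<ge> 0" for \<alpha>
      unfolding L1_op_def using operator that by blast
    show "L1_eq T (J (axis i 1) f) (RL (axis i 1) f)" if "f \<in> L1 T" for i f
      by (rule identity[OF that])
    show "L1_eq T (J (\<alpha> + \<beta>) f) (J \<alpha> (J \<beta> f))"
      if "\<And>i. \<alpha> $ i \<ge> 0" "\<And>i. \<beta> $ i \<ge> 0" "f \<in> L1 T" for \<alpha> \<beta> f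
      by (rule index_law) (use that in auto)
  qed
  from continuity obtain \<alpha>\<^sub>0 where \<alpha>\<^sub>0: "\<And>i. \<alpha>\<^sub>0 $ i > 0"
    "((\<lambda>\<alpha>. L1_dist T (J \<alpha> (\<lambda>_. 1)) (J \<alpha>\<^sub>0 (\<lambda>_. 1))) \<longlongrightarrow> 0)
            (at \<alpha>\<^sub>0 within {\<alpha>. \<forall>i. \<alpha> $ i > 0})" by blast
  show ?thesis
    using agrees_all[OF \<alpha>\<^sub>0] by (auto simp: agrees_def)
qed

end
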